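(* Let $x_0(u_0,v_0)$ be a non-developable surface with unit normal $N_0$ and let $x_z(u_1,v_1)$ be a surface (not equal to $x_0$ with $x_z$ ruled by the parameter lines) such that, on the tangency set $S:=\{(u_0,v_0,u_1,v_1):(x_z(u_1,v_1)-x_0(u_0,v_0))^TN_0(u_0,v_0)=0\}$ (a $3$-dimensional submanifold on which $(\partial_{u_1}x_z)^TN_0\,(\partial_{v_1}x_z)^TN_0\neq0$), one has $$(I_3-N_0N_0^T)\big[\partial_{u_1}x_z(\partial_{v_1}x_z)^T+\partial_{v_1}x_z(\partial_{u_1}x_z)^T\big]N_0=(\partial^2_{u_1v_1}x_z)^TN_0\,(x_z-x_0)$$ (this is the integrability condition of a $3$-dimensional tangential integrable rolling distribution of facets whose leaves collapse, for the defining surface $x_0$, to the two families of parameter curves of $x_z$). Then $\partial^2_{u_1}x_z\times\partial_{u_1}x_z=0$ and $\partial^2_{v_1}x_z\times\partial_{v_1}x_z=0$, i.e. $x_z$ is doubly ruled by its parameter lines (an open piece of a plane or of a doubly ruled quadric, possibly singular or isotropic); moreover $x_0$ is an open piece of a quadric and $x_z$ is a (possibly singular) member of the confocal family of $x_0$. Thus the only B\"acklund transformation with defining surface is Bianchi's B\"acklund transformation of quadrics.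
   Context: Work in $\mathbb{C}^3$ with the complex bilinear product $x^Ty$; a surface is a map $x:D\to\mathbb{C}^3$ with $dx\times\wedge dx\neq0$, non-developable means nonzero Gau\ss\ curvature. Confocal family: if a non-degenerate quadric has $4\times4$ symmetric matrix $Q$ in homogeneous coordinates, its confocal quadrics are those with dual (tangential) matrix $Q^{-1}-w\,\mathrm{diag}(1,1,1,0)$, $w\in\mathbb{C}$; the members for which this dual matrix is singular are the singular confocal quadrics (conics, lines, or, by convention, (isotropic) planes of the corresponding pencils). For a central quadric $x^TCx^{}$-form $x^TC^{-1}x=1$ the confocal members are $x^T(C-wI_3)^{-1}x=1$. *)

theory Defs
  imports "HOL-Analysis.Analysis"
begin

definition bdot :: "complex^'n \<Rightarrow> complex^'n \<Rightarrow> complex" where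
  "bdot x y = (\<Sum>i\<in>UNIV. x$i * y$i)"

definition cross3 :: "complex^3 \<Rightarrow> complex^3 \<Rightarrow> complex^3" where
  "cross3 x y = (\<chi> i. if i = 1 then x$2 * y$3 - x$3 * y$2
                     else if i = 2 then x$3 * y$1 - x$1 * y$3
                     else x$1 * y$2 - x$2 * y$1)"

definition outer :: "complex^'n \<Rightarrow> complex^'m \<Rightarrow> complex^'m^'n" where
  "outer a b = (\<chi> i j. a$i * b$j)"

definition hom :: "complex^3 \<Rightarrow> complex^4" where
  "hom x = (\<chi> i. if i = 1 then x$1 else if i = 2 then x$2 else if i = 3 then x$3 else 1)"

definition Ediag :: "complex^4^4" where
  "Ediag = (\<chi> i j. if i = j \<and> i \<in> {1,2,3} then 1 else 0)"

definition quadric_pts :: "complex^4^4 \<Rightarrow> (complex^3) set" where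
  "quadric_pts Q = {x. bdot (hom x) (Q *v hom x) = 0}"

definition nondeg_quadric :: "complex^4^4 \<Rightarrow> bool" where
  "nondeg_quadric Q \<longleftrightarrow> transpose Q = Q \<and> det Q \<noteq> 0"

text \<open>A set of points A is (contained in) the member with parameter w of the
  confocal family of the non-degenerate quadric Q: the member has dual matrix
  P = Q^{-1} - w diag(1,1,1,0).  If P is non-singular the member is the quadric
  with point matrix P^{-1}; if P is singular (singular confocal quadric: conic,
  line, ...) the member is, by convention, a plane of the corresponding pencil,
  i.e. a plane whose dual coordinate vector lies in the kernel of P.\<close>
definition confocal_member :: "complex^4^4 \<Rightarrow> complex \<Rightarrow> (complex^3) set \<Rightarrow> bool" where
  "confocal_member Q w A \<longleftrightarrow>
     (let P = (\<chi> i j. matrix_inv Q $ i $ j - w * Ediag $ i $ j) in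
      (det P \<noteq> 0 \<and> A \<subseteq> quadric_pts (matrix_inv P)) \<or>
      (det P = 0 \<and> (\<exists>\<pi>::complex^4. \<pi> \<noteq> 0 \<and> P *v \<pi> = 0 \<and> (\<forall>x\<in>A. bdot \<pi> (hom x) = 0))))"

definition holo2 :: "(complex \<times> complex) set \<Rightarrow> (complex \<times> complex \<Rightarrow> complex) \<Rightarrow> bool" where
  "holo2 D f \<longleftrightarrow> open D \<and>
     (\<forall>p\<in>D. \<exists>a b. (f has_derivative (\<lambda>(h,k). a * h + b * k)) (at p))"

definition Pu :: "(complex \<times> complex \<Rightarrow> complex^3) \<Rightarrow> complex \<times> complex \<Rightarrow> complex^3" where
  "Pu x p = (\<chi> i. deriv (\<lambda>s. x (s, snd p) $ i) (fst p))"

definition Pv :: "(complex \<times> complex \<Rightarrow> complex^3) \<Rightarrow> complex \<times> complex \<Rightarrow> complex^3" where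
  "Pv x p = (\<chi> i. deriv (\<lambda>t. x (fst p, t) $ i) (snd p))"

definition surface :: "(complex \<times> complex \<Rightarrow> complex^3) \<Rightarrow> (complex \<times> complex) set \<Rightarrow> bool" where
  "surface x D \<longleftrightarrow> open D \<and> connected D \<and> D \<noteq> {} \<and>
     (\<forall>i. holo2 D (\<lambda>p. x p $ i)) \<and> (\<forall>p\<in>D. cross3 (Pu x p) (Pv x p) \<noteq> 0)"

definition unit_normal :: "(complex \<times> complex \<Rightarrow> complex^3) \<Rightarrow> (complex \<times> complex \<Rightarrow> complex^3)
    \<Rightarrow> (complex \<times> complex) set \<Rightarrow> bool" where
  "unit_normal x N D \<longleftrightarrow> (\<forall>i. holo2 D (\<lambda>p. N p $ i)) \<and>
     (\<forall>p\<in>D. bdot (N p) (N p) = 1 \<and> bdot (N p) (Pu x p) = 0 \<and> bdot (N p) (Pv x p) = 0)"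

definition gauss_curv :: "(complex \<times> complex \<Rightarrow> complex^3) \<Rightarrow> (complex \<times> complex \<Rightarrow> complex^3)
    \<Rightarrow> complex \<times> complex \<Rightarrow> complex" where
  "gauss_curv x N p =
     (bdot (Pu (Pu x) p) (N p) * bdot (Pv (Pv x) p) (N p) - (bdot (Pu (Pv x) p) (N p))^2) /
     (bdot (Pu x p) (Pu x p) * bdot (Pv x p) (Pv x p) - (bdot (Pu x p) (Pv x p))^2)"

definition non_developable :: "(complex \<times> complex \<Rightarrow> complex^3) \<Rightarrow> (complex \<times> complex \<Rightarrow> complex^3)
    \<Rightarrow> (complex \<times> complex) set \<Rightarrow> bool" where
  "non_developable x N D \<longleftrightarrow> (\<forall>p\<in>D. gauss_curv x N p \<noteq> 0)"

definition tangency_set :: "(complex \<times> complex \<Rightarrow> complex^3) \<Rightarrow> (complex \<times> complex \<Rightarrow> complex^3)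
   \<Rightarrow> (complex \<times> complex) set \<Rightarrow> (complex \<times> complex \<Rightarrow> complex^3) \<Rightarrow> (complex \<times> complex) set
   \<Rightarrow> ((complex \<times> complex) \<times> (complex \<times> complex)) set" where
  "tangency_set x0 N0 D0 xz D1 =
     {(p0, p1). p0 \<in> D0 \<and> p1 \<in> D1 \<and> bdot (xz p1 - x0 p0) (N0 p0) = 0}"

end

theory Submission
  imports Defs "HOL-Complex_Analysis.Complex_Analysis"
begin

text \<open>
  Write \<open>V = x\<^sub>z - x\<^sub>0\<close> and let \<open>a = \<partial>\<^sub>u x\<^sub>z \<cdot> N\<^sub>0\<close>, \<open>b = \<partial>\<^sub>v x\<^sub>z \<cdot> N\<^sub>0\<close>. On the tangency set \<open>S\<close>, cut out by
  \<open>F = V \<cdot> N\<^sub>0 = 0\<close>, the integrability condition says that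
  \<open>d(a b) = (\<partial>\<^sub>u\<^sup>2 x\<^sub>z \<cdot> N\<^sub>0) b du + (\<partial>\<^sub>v\<^sup>2 x\<^sub>z \<cdot> N\<^sub>0) a dv\<close>. Differentiating the condition once more along \<open>S\<close> gives
  \<open>V \<cdot> (\<partial>\<^sub>u\<^sup>2 x\<^sub>z \<times> \<partial>\<^sub>u x\<^sub>z) = 0\<close> on \<open>S\<close>. If \<open>\<partial>\<^sub>u\<^sup>2 x\<^sub>z \<times> \<partial>\<^sub>u x\<^sub>z\<close> did not vanish, the chords \<open>V\<close> would have to be
  asymptotic directions of \<open>x\<^sub>0\<close>, then isotropic, and finally zero, which is absurd; hence the
  parameter curves of \<open>x\<^sub>z\<close> are straight lines. Therefore \<open>a b\<close> is, locally on \<open>S\<close>, a function \<open>g\<close> of the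
  point of \<open>x\<^sub>z\<close> alone, with \<open>\<partial>\<^sub>u\<^sup>2 x\<^sub>z = (\<partial>\<^sub>u g / g) \<partial>\<^sub>u x\<^sub>z\<close> and \<open>\<partial>\<^sub>v\<^sup>2 x\<^sub>z = (\<partial>\<^sub>v g / g) \<partial>\<^sub>v x\<^sub>z\<close>.

  With \<open>X = (x\<^sub>z, 1)\<close> and \<open>\<odot>\<close> the symmetrised tensor product, there is a constant \<open>l\<close> for which the matrix
  \<open>M = (X \<odot> X\<^sub>u\<^sub>v - X\<^sub>u \<odot> X\<^sub>v) / g - l X X\<^sup>T\<close> does not depend on the point; it is the dual matrix of the quadric (or plane)
  containing \<open>x\<^sub>z\<close>. The integrability condition now reads \<open>(M + 2 diag(1,1,1,0)) \<nu> \<parallel> (x\<^sub>0, 1)\<close>, where \<open>\<nu>\<close> is the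
  tangent plane of \<open>x\<^sub>0\<close>, so \<open>M + 2 diag(1,1,1,0)\<close> is the dual matrix of a quadric containing \<open>x\<^sub>0\<close>, and
  \<open>x\<^sub>z\<close> lies on its confocal member with parameter 2.
\<close>

section \<open>Holomorphic functions of two variables\<close>

definition Du :: "(complex \<times> complex \<Rightarrow> complex) \<Rightarrow> complex \<times> complex \<Rightarrow> complex" where
  "Du f p = deriv (\<lambda>s. f (s, snd p)) (fst p)"

definition Dv :: "(complex \<times> complex \<Rightarrow> complex) \<Rightarrow> complex \<times> complex \<Rightarrow> complex" where
  "Dv f p = deriv (\<lambda>t. f (fst p, t)) (snd p)"

text \<open>Continuity plus holomorphy in each variable separately: equivalent to
  \<open>holo2\<close> (see \<open>holo2_iff_sep_holo\<close>), but in a form to which one-variable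
  function theory applies directly.\<close>

definition sep_holo :: "(complex \<times> complex) set \<Rightarrow> (complex \<times> complex \<Rightarrow> complex) \<Rightarrow> bool" where
  "sep_holo D f \<longleftrightarrow> open D \<and> continuous_on D f \<and>
     (\<forall>(u,v)\<in>D. (\<lambda>s. f (s, v)) field_differentiable (at u) \<and>
                (\<lambda>t. f (u, t)) field_differentiable (at v))"

lemma holo2_slices:
  assumes "(f has_derivative (\<lambda>(h,k). a * h + b * k)) (at (u, v))"
  shows "((\<lambda>s. f (s, v)) has_field_derivative a) (at u)"
    and "((\<lambda>t. f (u, t)) has_field_derivative b) (at v)"
proof -
  have 1: "((\<lambda>s. (s, v)) has_derivative (\<lambda>h. (h, 0))) (at u)"
    by (auto intro!: derivative_eq_intros)
  have 2: "((\<lambda>t. (u, t)) has_derivative (\<lambda>h. (0, h))) (at v)"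
    by (auto intro!: derivative_eq_intros)
  show "((\<lambda>s. f (s, v)) has_field_derivative a) (at u)"
    using diff_chain_at[OF 1 assms] by (simp add: has_field_derivative_def o_def)
  show "((\<lambda>t. f (u, t)) has_field_derivative b) (at v)"
    using diff_chain_at[OF 2 assms] by (simp add: has_field_derivative_def o_def)
qed

lemma holo2_imp_sep_holo:
  assumes "holo2 D f" shows "sep_holo D f"
proof -
  have "open D" using assms by (simp add: holo2_def)
  moreover have "continuous_on D f"
    using assms unfolding holo2_def
    by (metis continuous_at_imp_continuous_on has_derivative_continuous)
  moreover have "(\<lambda>s. f (s, v)) field_differentiable (at u) \<and> (\<lambda>t. f (u, t)) field_differentiable (at v)"
    if "(u,v) \<in> D" for u v
    using assms that holo2_slices[of f _ _ u v] unfolding holo2_def field_differentiable_def by blast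
  ultimately show ?thesis by (auto simp: sep_holo_def)
qed

section \<open>Cauchy's integral formula and regularity of the partial derivatives\<close>

lemma open_prod_ballE:
  fixes u v :: complex
  assumes "open D" "(u,v) \<in> D"
  obtains r where "r > 0" "cball u r \<times> cball v r \<subseteq> D"
proof -
  obtain A B where AB: "open A" "open B" "u \<in> A" "v \<in> B" "A \<times> B \<subseteq> D"
    using assms open_prod_elim by (metis mem_Sigma_iff)
  obtain r1 where "r1 > 0" "cball u r1 \<subseteq> A" using AB open_contains_cball_eq by blast
  moreover obtain r2 where "r2 > 0" "cball v r2 \<subseteq> B" using AB open_contains_cball_eq by blast
  ultimately have "min r1 r2 > 0" "cball u (min r1 r2) \<times> cball v (min r1 r2) \<subseteq> D"
    using AB(5) by (auto simp: subset_eq)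
  then show ?thesis using that by blast
qed

lemma sep_holo_swap:
  "sep_holo D f \<Longrightarrow> sep_holo (prod.swap ` D) (f \<circ> prod.swap)"
proof -
  assume f: "sep_holo D f"
  have eq: "prod.swap ` D = prod.swap -` D" by force
  have c: "continuous_on A (prod.swap :: complex \<times> complex \<Rightarrow> _)" for A
    by (simp add: prod.swap_def continuous_on_Pair continuous_on_fst continuous_on_snd)
  show ?thesis
    using f c[of UNIV] unfolding sep_holo_def eq
    by (auto simp: o_def intro: open_vimage continuous_on_compose2[OF _ c])
qed

text \<open>Cauchy's formula for the first derivative on the slice through \<open>v\<close>. The
  contour integral is written out over the unit interval, so that its dependence on \<open>u\<close>
  and \<open>v\<close> is that of an integral with parameters.\<close>

lemma Cauchy_Du:
  assumes f: "sep_holo D f" and r: "r > 0" "cball u0 r \<times> cball v0 r \<subseteq> D"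
    and u: "u \<in> ball u0 r" and v: "v \<in> cball v0 r"
  shows "Du f (u,v) = (1 / (2 * of_real pi * \<i>)) * integral (cbox 0 1)
     (\<lambda>x. f (circlepath u0 r x, v) / (circlepath u0 r x - u)^2 * (2 * pi * \<i> * r * exp(2 * of_real pi * \<i> * x)))"
proof -
  have "continuous_on (cball u0 r) (\<lambda>s. f (s, v))"
    using f r v unfolding sep_holo_def
    by (intro continuous_on_compose2[of D f _ "\<lambda>s. (s, v)"] continuous_intros) auto
  moreover have "(\<lambda>s. f (s, v)) holomorphic_on ball u0 r"
    unfolding holomorphic_on_def
  proof
    fix x assume "x \<in> ball u0 r"
    then have "(x, v) \<in> D" using r v by (auto simp: subset_eq)
    then show "(\<lambda>s. f (s, v)) field_differentiable at x within ball u0 r"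
      using f field_differentiable_at_within unfolding sep_holo_def by blast
  qed
  ultimately have "contour_integral(circlepath u0 r) (\<lambda>s. f (s, v)/(s-u)^2) = (2 * pi * \<i>) * Du f (u,v)"
    using Cauchy_contour_integral_circlepath_2 u by (fastforce simp: Du_def)
  then show ?thesis
    by (simp add: contour_integral_integral vector_derivative_circlepath)
qed

lemma circlepath_in: "r > 0 \<Longrightarrow> circlepath z r x \<in> cball z r"
  by (simp add: circlepath dist_norm norm_mult)

lemma circlepath_ne: "r > 0 \<Longrightarrow> u \<in> ball z r \<Longrightarrow> circlepath z r x - u \<noteq> 0"
  by (auto simp: circlepath dist_norm norm_mult)

lemma continuous_circlepath: "continuous_on A (circlepath z r)"
  by (simp add: circlepath_def part_circlepath_def linepath_def) (intro continuous_intros)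

text \<open>On a bidisc \<open>Du f\<close> is an integral over a compact interval whose integrand
  depends jointly continuously on the parameters.\<close>

lemma sep_holo_continuous_Du:
  assumes f: "sep_holo D f"
  shows "continuous_on D (Du f)"
proof -
  have "isCont (Du f) (u0, v0)" if p: "(u0,v0) \<in> D" for u0 v0
  proof -
    obtain r where r: "r > 0" "cball u0 r \<times> cball v0 r \<subseteq> D"
      using f p open_prod_ballE unfolding sep_holo_def by metis
    let ?U = "ball u0 r \<times> ball v0 r"
    let ?I = "\<lambda>p. (1 / (2 * of_real pi * \<i>)) * integral (cbox 0 1)
     (\<lambda>x. f (circlepath u0 r x, snd p) / (circlepath u0 r x - fst p)^2 * (2 * pi * \<i> * r * exp(2 * of_real pi * \<i> * x)))"
    have "continuous_on (?U \<times> cbox 0 1) (\<lambda>q. f (circlepath u0 r (snd q), snd (fst q)))"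
      using f r circlepath_in[OF r(1), of u0] unfolding sep_holo_def
      by (intro continuous_on_compose2[of D f _ "\<lambda>q. (circlepath u0 r (snd q), snd (fst q))"]
          continuous_intros continuous_on_compose2[OF continuous_circlepath[of UNIV]])
        (auto simp: subset_eq)
    then have "continuous_on ?U ?I"
      using circlepath_ne[OF r(1)]
      by (intro continuous_on_mult_left integral_continuous_on_param)
        (auto simp: case_prod_unfold intro!: continuous_intros continuous_on_compose2[OF continuous_circlepath[of UNIV]])
    then have "continuous_on ?U (Du f)"
      by (rule continuous_on_eq) (use Cauchy_Du[OF f r] in auto)
    then show ?thesis
      using r(1) by (simp add: continuous_on_eq_continuous_at open_Times)
  qed
  then show ?thesis by (auto intro: continuous_at_imp_continuous_on)
qed

lemma Dv_swap: "Dv f = Du (f \<circ> prod.swap) \<circ> prod.swap"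
  by (auto simp: Du_def Dv_def fun_eq_iff)

lemma sep_holo_continuous_Dv:
  assumes f: "sep_holo D f"
  shows "continuous_on D (Dv f)"
  unfolding Dv_swap
  using sep_holo_continuous_Du[OF sep_holo_swap[OF f]]
  by (intro continuous_on_compose) (auto simp: prod.swap_def continuous_on_Pair continuous_on_fst continuous_on_snd)

lemma sep_holo_DERIV:
  assumes "sep_holo D f" "(u,v) \<in> D"
  shows "((\<lambda>s. f (s, v)) has_field_derivative Du f (u,v)) (at u)"
    and "((\<lambda>t. f (u, t)) has_field_derivative Dv f (u,v)) (at v)"
  using assms unfolding sep_holo_def Du_def Dv_def
  by (auto simp: field_differentiable_derivI)

text \<open>Existence of both partial derivatives and continuity of one of them, here
  \<open>Dv f\<close>, give the total derivative.\<close>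

lemma sep_holo_imp_holo2:
  assumes f: "sep_holo D f" and p: "p \<in> D"
  shows "(f has_derivative (\<lambda>(h,k). Du f p * h + Dv f p * k)) (at p)"
proof -
  obtain u0 v0 where pe: "p = (u0,v0)" by force
  obtain r where r: "r > 0" "cball u0 r \<times> cball v0 r \<subseteq> D"
    using f p pe open_prod_ballE unfolding sep_holo_def by metis
  let ?fy = "\<lambda>x y. blinfun_mult_right (Dv f (x,y))"
  have "((\<lambda>(x, y). f (x,y)) has_derivative (\<lambda>(tx, ty). Du f p * tx + blinfun_apply (?fy u0 v0) ty))
      (at (u0, v0) within ball u0 r \<times> ball v0 r)"
  proof (rule has_derivative_partialsI)
    show "((\<lambda>x. f (x, v0)) has_derivative (*) (Du f p)) (at u0 within ball u0 r)"
      using sep_holo_DERIV(1)[OF f] p pe by (auto simp: has_field_derivative_def intro: has_derivative_at_withinI)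
    show "((\<lambda>y. f (x, y)) has_derivative blinfun_apply (?fy x y)) (at y within ball v0 r)"
      if "x \<in> ball u0 r" "y \<in> ball v0 r" for x y
    proof -
      have "(x,y) \<in> D" using that r by (auto simp: subset_eq)
      then show ?thesis
        using sep_holo_DERIV(2)[OF f, of x y] by (auto simp: has_field_derivative_def intro: has_derivative_at_withinI)
    qed
    have "isCont (Dv f) (u0,v0)"
      using sep_holo_continuous_Dv[OF f] p pe f continuous_on_eq_continuous_at unfolding sep_holo_def by blast
    then have "isCont (\<lambda>q. blinfun_mult_right (Dv f q)) (u0,v0)"
      by (rule bounded_linear.continuous[OF bounded_linear_blinfun_mult_right])
    then show "continuous (at (u0, v0) within ball u0 r \<times> ball v0 r) (\<lambda>(x, y). ?fy x y)"
      by (simp add: continuous_at_imp_continuous_at_within case_prod_unfold)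
  qed (use r in auto)
  moreover have "at (u0, v0) within ball u0 r \<times> ball v0 r = at (u0,v0)"
    using r(1) by (intro at_within_open) (auto simp: open_Times)
  ultimately show ?thesis by (simp add: pe case_prod_unfold)
qed

lemma Du_field_differentiable_u:
  assumes f: "sep_holo D f" and p: "(u0,v0) \<in> D"
  shows "(\<lambda>s. Du f (s, v0)) field_differentiable (at u0)"
proof -
  obtain r where r: "r > 0" "cball u0 r \<times> cball v0 r \<subseteq> D"
    using f p open_prod_ballE unfolding sep_holo_def by metis
  have "(\<lambda>s. f (s, v0)) holomorphic_on ball u0 r"
    unfolding holomorphic_on_def
  proof
    fix x assume "x \<in> ball u0 r"
    then have "(x, v0) \<in> D" using r by (auto simp: subset_eq)
    then show "(\<lambda>s. f (s, v0)) field_differentiable at x within ball u0 r"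
      using f field_differentiable_at_within unfolding sep_holo_def by blast
  qed
  then have "deriv (\<lambda>s. f (s, v0)) holomorphic_on ball u0 r"
    by (simp add: holomorphic_deriv)
  then show ?thesis
    using r(1) by (simp add: Du_def holomorphic_on_imp_differentiable_at)
qed

text \<open>Differentiation of the Cauchy integral under the integral sign. The value is the Cauchy
  integral of \<open>Dv f\<close>, which later yields the symmetry of mixed partials.\<close>

lemma Du_DERIV_v:
  assumes f: "sep_holo D f" and r: "r > 0" "cball u0 r \<times> cball v0 r \<subseteq> D"
  shows "((\<lambda>t. Du f (u0, t)) has_field_derivative (1 / (2 * of_real pi * \<i>)) * integral (cbox 0 1)
     (\<lambda>x. Dv f (circlepath u0 r x, v0) / (circlepath u0 r x - u0)^2 *
        (2 * pi * \<i> * r * exp(2 * of_real pi * \<i> * x)))) (at v0)"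
proof -
  let ?U = "ball v0 r"
  let ?k = "\<lambda>x. (2 * pi * \<i> * r * exp(2 * of_real pi * \<i> * x))"
  have inD: "(circlepath u0 r x, t) \<in> D" if "t \<in> ball v0 r" for x t
    using that r(2) circlepath_in[OF r(1), of u0 x] by (auto simp: subset_eq)
  have ne: "circlepath u0 r x - u0 \<noteq> 0" for x
    using circlepath_ne[OF r(1)] r(1) by simp
  have cont: "continuous_on (?U \<times> cbox 0 1) (\<lambda>q. g (circlepath u0 r (snd q), fst q))"
    if "continuous_on D g" for g :: "complex \<times> complex \<Rightarrow> complex"
    using inD that
    by (intro continuous_on_compose2[of D g _ "\<lambda>q. (circlepath u0 r (snd q), fst q)"]
          continuous_intros continuous_on_compose2[OF continuous_circlepath[of UNIV]])
        (auto simp: subset_eq)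
  have cont2: "continuous_on (?U \<times> cbox 0 1) (\<lambda>(t,x). g (circlepath u0 r x, t) / (circlepath u0 r x - u0)^2 * ?k x)"
    if "continuous_on D g" for g :: "complex \<times> complex \<Rightarrow> complex"
    using cont[OF that] ne
    by (auto simp: case_prod_unfold intro!: continuous_intros continuous_on_compose2[OF continuous_circlepath[of UNIV]])
  have "((\<lambda>t. integral (cbox 0 1) (\<lambda>x. f (circlepath u0 r x, t) / (circlepath u0 r x - u0)^2 * ?k x))
     has_field_derivative integral (cbox 0 1) (\<lambda>x. Dv f (circlepath u0 r x, v0) / (circlepath u0 r x - u0)^2 * ?k x)) (at v0 within ?U)"
  proof (rule leibniz_rule_field_derivative)
    show "((\<lambda>t. f (circlepath u0 r x, t) / (circlepath u0 r x - u0)^2 * ?k x) has_field_derivative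
            Dv f (circlepath u0 r x, t) / (circlepath u0 r x - u0)^2 * ?k x) (at t within ?U)"
      if "t \<in> ?U" for t x
      by (intro DERIV_cmult_right DERIV_cdivide has_field_derivative_at_within[OF sep_holo_DERIV(2)[OF f inD[OF that]]])
    show "(\<lambda>x. f (circlepath u0 r x, t) / (circlepath u0 r x - u0)^2 * ?k x) integrable_on cbox 0 1"
      if "t \<in> ?U" for t
    proof (rule integrable_continuous)
      have "continuous_on (cbox 0 1) ((\<lambda>(t,x). f (circlepath u0 r x, t) / (circlepath u0 r x - u0)^2 * ?k x) \<circ> Pair t)"
        using f that unfolding sep_holo_def
        by (intro continuous_on_compose continuous_intros continuous_on_subset[OF cont2]) auto
      then show "continuous_on (cbox 0 1) (\<lambda>x. f (circlepath u0 r x, t) / (circlepath u0 r x - u0)^2 * ?k x)"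
        by (simp add: o_def)
    qed
  qed (use r cont2 sep_holo_continuous_Dv[OF f] in auto)
  then have "((\<lambda>t. (1 / (2 * of_real pi * \<i>)) * integral (cbox 0 1) (\<lambda>x. f (circlepath u0 r x, t) / (circlepath u0 r x - u0)^2 * ?k x))
     has_field_derivative (1 / (2 * of_real pi * \<i>)) * integral (cbox 0 1) (\<lambda>x. Dv f (circlepath u0 r x, v0) / (circlepath u0 r x - u0)^2 * ?k x)) (at v0)"
    using r(1) by (intro DERIV_cmult) (simp add: at_within_open[of v0 ?U])
  then show ?thesis
    by (rule has_field_derivative_transform_within_open[where S = ?U])
       (use r Cauchy_Du[OF f r, of u0] in auto)
qed

lemma sep_holo_Du:
  assumes f: "sep_holo D f"
  shows "sep_holo D (Du f)"
  unfolding sep_holo_def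
proof (intro conjI ballI)
  show "open D" using f by (simp add: sep_holo_def)
  show "continuous_on D (Du f)" by (rule sep_holo_continuous_Du[OF f])
  fix p assume p: "p \<in> D"
  obtain u0 v0 where pe: "p = (u0,v0)" by force
  obtain r where "r > 0" "cball u0 r \<times> cball v0 r \<subseteq> D"
    using f p pe open_prod_ballE unfolding sep_holo_def by metis
  then show "case p of (u,v) \<Rightarrow> (\<lambda>s. Du f (s, v)) field_differentiable (at u) \<and>
                (\<lambda>t. Du f (u, t)) field_differentiable (at v)"
    using Du_field_differentiable_u[OF f] Du_DERIV_v[OF f] p pe
    unfolding field_differentiable_def by blast
qed

lemma sep_holo_Dv:
  assumes f: "sep_holo D f"
  shows "sep_holo D (Dv f)"
proof -
  have "sep_holo (prod.swap ` prod.swap ` D) (Du (f \<circ> prod.swap) \<circ> prod.swap)"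
    by (intro sep_holo_swap sep_holo_Du f)
  moreover have "prod.swap ` prod.swap ` D = D" by (simp add: image_comp)
  ultimately show ?thesis by (simp add: Dv_swap)
qed

lemma Dv_Du_commute:
  assumes f: "sep_holo D f" and p: "p \<in> D"
  shows "Dv (Du f) p = Du (Dv f) p"
proof -
  obtain u0 v0 where pe: "p = (u0,v0)" by force
  obtain r where r: "r > 0" "cball u0 r \<times> cball v0 r \<subseteq> D"
    using f p pe open_prod_ballE unfolding sep_holo_def by metis
  have "((\<lambda>t. Du f (u0, t)) has_field_derivative Du (Dv f) (u0,v0)) (at v0)"
    using Du_DERIV_v[OF f r] Cauchy_Du[OF sep_holo_Dv[OF f] r, of u0 v0] r(1) by simp
  then show ?thesis
    by (simp add: pe Dv_def DERIV_imp_deriv)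
qed

lemma holo2_iff_sep_holo: "holo2 D f \<longleftrightarrow> sep_holo D f"
proof
  assume f: "sep_holo D f"
  then have "open D" by (simp add: sep_holo_def)
  then show "holo2 D f"
    using sep_holo_imp_holo2[OF f] unfolding holo2_def by blast
qed (rule holo2_imp_sep_holo)

text \<open>The interior \<open>Z\<close> of the zero set is open; if it were not all of
  \<open>D\<close>, connectedness would give a point outside \<open>Z\<close> all of whose
  neighbourhoods meet \<open>Z\<close>, and a bidisc around it is shown to lie in
  \<open>Z\<close>.\<close>

lemma sep_holo_identity:
  assumes f: "sep_holo D f" and D: "connected D" and U: "open U" "U \<noteq> {}" "U \<subseteq> D"
    and z: "\<And>p. p \<in> U \<Longrightarrow> f p = 0" and p: "p \<in> D"
  shows "f p = 0"
proof -
  define Z where "Z = interior {p \<in> D. f p = 0}"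
  have "open D" using f by (simp add: sep_holo_def)
  have "Z = D"
  proof (rule ccontr)
    assume "Z \<noteq> D"
    have ZD: "Z \<subseteq> D" using interior_subset by (auto simp: Z_def)
    have "U \<subseteq> Z" unfolding Z_def using U z by (intro interior_maximal) auto
    then have "Z \<noteq> {}" using U by auto
    have "\<not> openin (top_of_set D) (D - Z)"
    proof
      assume "openin (top_of_set D) (D - Z)"
      moreover have "openin (top_of_set D) Z"
        using ZD \<open>open D\<close> by (simp add: Z_def openin_open_eq)
      ultimately show False
        using D ZD \<open>Z \<noteq> {}\<close> \<open>Z \<noteq> D\<close> unfolding connected_openin by blast
    qed
    then have "\<not> open (D - Z)" using \<open>open D\<close> by (simp add: openin_open_eq)
    then obtain q where q: "q \<in> D" "q \<notin> Z" "q \<notin> interior (D - Z)"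
      by (metis DiffD1 DiffD2 interior_subset interior_eq subset_antisym subsetI)
    obtain u0 v0 where qe: "q = (u0,v0)" by force
    obtain r where r: "r > 0" "cball u0 r \<times> cball v0 r \<subseteq> D"
      using \<open>open D\<close> q qe open_prod_ballE by metis
    let ?B = "ball u0 r \<times> ball v0 r"
    have BD: "?B \<subseteq> D" using r(2) by (auto simp: subset_eq)
    have oB: "open ?B" by (simp add: open_Times)
    have "?B \<inter> Z \<noteq> {}"
    proof
      assume "?B \<inter> Z = {}"
      then have "?B \<subseteq> interior (D - Z)" using oB BD by (intro interior_maximal) auto
      then show False using q(3) qe r(1) by (metis SigmaI centre_in_ball subsetD)
    qed
    then obtain u1 v1 where w: "(u1,v1) \<in> ?B" "(u1,v1) \<in> Z" by blast
    have "open (?B \<inter> Z)" using oB by (simp add: Z_def open_Int)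
    then obtain e where e: "e > 0" "cball u1 e \<times> cball v1 e \<subseteq> ?B \<inter> Z"
      using w open_prod_ballE by (metis IntI)
    have hu: "(\<lambda>s. f (s, t)) holomorphic_on ball u0 r" if "t \<in> ball v0 r" for t
      unfolding holomorphic_on_def
      using f BD that field_differentiable_at_within unfolding sep_holo_def by blast
    have hv: "(\<lambda>t. f (s, t)) holomorphic_on ball v0 r" if "s \<in> ball u0 r" for s
      unfolding holomorphic_on_def
      using f BD that field_differentiable_at_within unfolding sep_holo_def by blast
    have Z0: "f q = 0" if "q \<in> Z" for q using that interior_subset by (auto simp: Z_def)
    have eB: "ball u1 e \<subseteq> ball u0 r" "ball v1 e \<subseteq> ball v0 r"
      using e by (auto simp: subset_eq) (metis dist_self less_imp_le mem_cball)+
    \<comment> \<open>Two one-variable continuations: first in \<open>s\<close> for \<open>t\<close>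
      near \<open>v1\<close>, then in \<open>t\<close> for every \<open>s\<close>, so that
      \<open>f\<close> vanishes on the whole bidisc.\<close>
    have 1: "f (s, t) = 0" if "s \<in> ball u0 r" "t \<in> ball v1 e" for s t
      by (rule analytic_continuation_open[of "ball u1 e" "ball u0 r" "\<lambda>s. f (s,t)" "\<lambda>_. 0"])
        (use that e eB hu Z0 in \<open>auto simp: subset_eq\<close>)
    have 2: "f (s, t) = 0" if "s \<in> ball u0 r" "t \<in> ball v0 r" for s t
      by (rule analytic_continuation_open[of "ball v1 e" "ball v0 r" "\<lambda>t. f (s,t)" "\<lambda>_. 0"])
        (use that e eB hv 1 in \<open>auto simp: subset_eq\<close>)
    have "?B \<subseteq> Z" unfolding Z_def using oB BD 2 by (intro interior_maximal) auto
    then show False using q(2) qe r(1) by (metis SigmaI centre_in_ball subsetD)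
  qed
  then show ?thesis using p interior_subset[of "{p \<in> D. f p = 0}"] by (auto simp: Z_def)
qed

section \<open>Closure properties and differentiation rules\<close>

lemma sep_holo_const: "open D \<Longrightarrow> sep_holo D (\<lambda>p. k)"
  and sep_holo_add: "sep_holo D f \<Longrightarrow> sep_holo D g \<Longrightarrow> sep_holo D (\<lambda>p. f p + g p)"
  and sep_holo_diff: "sep_holo D f \<Longrightarrow> sep_holo D g \<Longrightarrow> sep_holo D (\<lambda>p. f p - g p)"
  and sep_holo_mult: "sep_holo D f \<Longrightarrow> sep_holo D g \<Longrightarrow> sep_holo D (\<lambda>p. f p * g p)"
  and sep_holo_divide: "sep_holo D f \<Longrightarrow> sep_holo D g \<Longrightarrow> (\<And>p. p \<in> D \<Longrightarrow> g p \<noteq> 0) \<Longrightarrow> sep_holo D (\<lambda>p. f p / g p)"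
  by (auto simp: sep_holo_def intro!: continuous_intros field_differentiable_add field_differentiable_diff
      field_differentiable_mult field_differentiable_divide)

lemma sep_holo_sum: "open D \<Longrightarrow> (\<And>i. i \<in> A \<Longrightarrow> sep_holo D (f i)) \<Longrightarrow> sep_holo D (\<lambda>p. \<Sum>i\<in>A. f i p)"
  by (induction A rule: infinite_finite_induct) (auto intro: sep_holo_const sep_holo_add)

lemma sep_holo_subset: "sep_holo D f \<Longrightarrow> open B \<Longrightarrow> B \<subseteq> D \<Longrightarrow> sep_holo B f"
  by (auto simp: sep_holo_def intro: continuous_on_subset)

lemma sep_holo_minus: "sep_holo D f \<Longrightarrow> sep_holo D (\<lambda>p. - f p)"
  by (auto simp: sep_holo_def intro!: continuous_intros field_differentiable_minus)

lemma sep_holo_fd: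
  assumes "sep_holo D f" "p \<in> D"
  shows "(\<lambda>s. f (s, snd p)) field_differentiable at (fst p)"
    "(\<lambda>t. f (fst p, t)) field_differentiable at (snd p)"
  using assms by (auto simp: sep_holo_def)

lemma Du_const [simp]: "Du (\<lambda>p. k) p = 0" and Dv_const [simp]: "Dv (\<lambda>p. k) p = 0"
  by (simp_all add: Du_def Dv_def)

lemma Du_Dv_add:
  assumes "sep_holo D f" "sep_holo D g" "p \<in> D"
  shows "Du (\<lambda>p. f p + g p) p = Du f p + Du g p" "Dv (\<lambda>p. f p + g p) p = Dv f p + Dv g p"
  using sep_holo_fd[OF assms(1,3)] sep_holo_fd[OF assms(2,3)] by (simp_all add: Du_def Dv_def)

lemma Du_Dv_diff:
  assumes "sep_holo D f" "sep_holo D g" "p \<in> D"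
  shows "Du (\<lambda>p. f p - g p) p = Du f p - Du g p" "Dv (\<lambda>p. f p - g p) p = Dv f p - Dv g p"
  using sep_holo_fd[OF assms(1,3)] sep_holo_fd[OF assms(2,3)] by (simp_all add: Du_def Dv_def)

lemma Du_Dv_mult:
  assumes "sep_holo D f" "sep_holo D g" "p \<in> D"
  shows "Du (\<lambda>p. f p * g p) p = f p * Du g p + Du f p * g p" "Dv (\<lambda>p. f p * g p) p = f p * Dv g p + Dv f p * g p"
  using sep_holo_fd[OF assms(1,3)] sep_holo_fd[OF assms(2,3)] by (simp_all add: Du_def Dv_def)

lemma Du_Dv_divide:
  assumes "sep_holo D f" "sep_holo D g" "p \<in> D" "g p \<noteq> 0"
  shows "Du (\<lambda>p. f p / g p) p = (Du f p * g p - f p * Du g p) / (g p)^2"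
    "Dv (\<lambda>p. f p / g p) p = (Dv f p * g p - f p * Dv g p) / (g p)^2"
  using sep_holo_fd[OF assms(1,3)] sep_holo_fd[OF assms(2,3)] assms(4) by (simp_all add: Du_def Dv_def)

lemma Du_Dv_cong:
  assumes D: "open D" "p \<in> D" and eq: "\<And>p. p \<in> D \<Longrightarrow> f p = g p"
  shows "Du f p = Du g p" "Dv f p = Dv g p"
proof -
  obtain r where r: "r > 0" "cball (fst p) r \<times> cball (snd p) r \<subseteq> D"
    using D open_prod_ballE[of D "fst p" "snd p"] by auto
  have "\<forall>\<^sub>F s in nhds (fst p). s \<in> ball (fst p) r" "\<forall>\<^sub>F s in nhds (snd p). s \<in> ball (snd p) r"
    using r by (intro eventually_nhds_in_open; simp)+
  then have "\<forall>\<^sub>F s in nhds (fst p). f (s, snd p) = g (s, snd p)"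
    "\<forall>\<^sub>F s in nhds (snd p). f (fst p, s) = g (fst p, s)"
    using r eq by (auto elim!: eventually_mono simp: subset_eq)
  then show "Du f p = Du g p" "Dv f p = Dv g p"
    unfolding Du_def Dv_def by (auto intro!: deriv_cong_ev)
qed

lemma Du_Dv_zero_constant:
  assumes f: "sep_holo (ball c r) f" and z: "\<And>p. p \<in> ball c r \<Longrightarrow> Du f p = 0 \<and> Dv f p = 0"
    and p: "p \<in> ball c r" "p' \<in> ball c r"
  shows "f p = f p'"
proof -
  have "(f has_derivative (\<lambda>h. 0)) (at q within ball c r)" if "q \<in> ball c r" for q
    using sep_holo_imp_holo2[OF f that] z[OF that] by (simp add: case_prod_unfold has_derivative_at_withinI)
  then show ?thesis
    using has_derivative_zero_unique[OF convex_ball[of c r], of f p p'] p by simp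
qed

section \<open>Zero sets and implicit functions\<close>

text \<open>For nonzero \<open>c\<close> the triangular derivative of \<open>(f, h)\<close> at the
  origin is invertible, so the image of \<open>U\<close> contains \<open>(0, e)\<close> for some
  real \<open>e > 0\<close>; this contradicts the vanishing of \<open>h\<close> on
  \<open>f = 0\<close>.\<close>

lemma zero_set_derivative_aux:
  fixes f h :: "complex \<times> complex \<Rightarrow> complex"
  assumes U: "open U" "(0,0) \<in> U" and cont: "continuous_on U f" "continuous_on U h"
    and df: "(f has_derivative (\<lambda>(s,t). a * s)) (at (0,0))" and a: "a \<noteq> 0"
    and dh: "(h has_derivative (\<lambda>(s,t). b * s + c * t)) (at (0,0))"
    and zero: "f (0,0) = 0" "\<And>q. q \<in> U \<Longrightarrow> f q = 0 \<Longrightarrow> h q = 0"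
  shows "c = 0"
proof (rule ccontr)
  assume c: "c \<noteq> 0"
  let ?\<Phi> = "\<lambda>q. (f q, h q)"
  have "?\<Phi> (0,0) \<in> interior (?\<Phi> ` U)"
  proof (rule sussmann_open_mapping[where S = U and x = "(0,0)" and
        g' = "\<lambda>(z,w). (z / a, (w - b * (z / a)) / c)"])
    show "continuous_on U ?\<Phi>" using cont by (intro continuous_on_Pair)
    show "(?\<Phi> has_derivative (\<lambda>q. ((case q of (s,t) \<Rightarrow> a * s), (case q of (s,t) \<Rightarrow> b * s + c * t)))) (at (0,0))"
      by (intro has_derivative_Pair df dh)
    show "bounded_linear (\<lambda>(z,w). (z / a, (w - b * (z / a)) / c))"
      unfolding case_prod_unfold
      by (intro bounded_linear_Pair bounded_linear_divide[THEN bounded_linear_compose]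
          bounded_linear_sub bounded_linear_mult_right[THEN bounded_linear_compose]
          bounded_linear_fst bounded_linear_snd)
    show "(\<lambda>q. ((case q of (s,t) \<Rightarrow> a * s), (case q of (s,t) \<Rightarrow> b * s + c * t))) \<circ> (\<lambda>(z,w). (z / a, (w - b * (z / a)) / c)) = id"
      using a c by (auto simp: fun_eq_iff field_simps)
  qed (use U in \<open>auto simp: interior_open\<close>)
  moreover have h0: "h (0,0) = 0" using U zero by blast
  ultimately have "(0,0) \<in> interior (?\<Phi> ` U)" using zero by simp
  then obtain e where e: "e > 0" "cball (0,0) e \<subseteq> ?\<Phi> ` U"
    using mem_interior_cball by blast
  have "(0, of_real e) \<in> cball (0, 0::complex) e"
    using e by (simp add: dist_Pair_Pair)
  then obtain q where "q \<in> U" "f q = 0" "h q = of_real e" using e(2) by force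
  then show False using zero(2)[of q] e(1) by simp
qed

text \<open>If \<open>c \<noteq> 0\<close>, then \<open>(F, H)\<close> would be an open map near \<open>q\<close>, so \<open>H\<close> would take non-zero values on \<open>F = 0\<close>.\<close>
lemma zero_set_derivative:
  fixes F H :: "'a::real_normed_vector \<Rightarrow> complex"
  assumes U: "open U" "q \<in> U" and cont: "continuous_on U F" "continuous_on U H"
    and dF: "(F has_derivative F') (at q)" and dH: "(H has_derivative H') (at q)"
    and zero: "F q = 0" "\<And>y. y \<in> U \<Longrightarrow> F y = 0 \<Longrightarrow> H y = 0"
    and L: "bounded_linear L" "\<And>s t. F' (L (s,t)) = a * s" "\<And>s t. H' (L (s,t)) = b * s + c * t"
    and a: "a \<noteq> 0"
  shows "c = 0"
proof -
  interpret L: bounded_linear L by (rule L)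
  let ?l = "\<lambda>z. q + L z"
  have dl: "(?l has_derivative L) (at z)" for z
    using L.has_derivative[OF has_derivative_ident] by (auto intro!: derivative_eq_intros)
  have cl: "continuous_on A ?l" for A
    by (intro continuous_intros L.continuous_on)
  have FL: "(\<lambda>z. F' (L z)) = (\<lambda>(s,t). a * s)" and HL: "(\<lambda>z. H' (L z)) = (\<lambda>(s,t). b * s + c * t)"
    using L by auto
  have l0: "?l (0,0) = q" by (simp add: L.zero[unfolded zero_prod_def])
  have opn: "open (?l -` U)" using cl[of UNIV] U by (simp add: open_vimage)
  show ?thesis
  proof (rule zero_set_derivative_aux[where U = "?l -` U" and f = "\<lambda>z. F (?l z)" and h = "\<lambda>z. H (?l z)"])
    show "continuous_on (?l -` U) (\<lambda>z. F (?l z))" "continuous_on (?l -` U) (\<lambda>z. H (?l z))"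
      by (rule continuous_on_compose2[OF _ cl]; use cont in auto)+
    show "((\<lambda>z. F (?l z)) has_derivative (\<lambda>(s, t). a * s)) (at (0, 0))"
      using diff_chain_at[OF dl[of "(0,0)"], of F F'] dF FL by (simp add: l0 o_def)
    show "((\<lambda>z. H (?l z)) has_derivative (\<lambda>(s, t). b * s + c * t)) (at (0, 0))"
      using diff_chain_at[OF dl[of "(0,0)"], of H H'] dH HL by (simp add: l0 o_def)
  qed (use U zero a l0 opn in auto)
qed

text \<open>The existence half of the implicit function theorem: the map \<open>(F, snd)\<close> has
  an invertible derivative at \<open>(s0, y0)\<close>, so its image contains every
  \<open>(0, y)\<close> with \<open>y\<close> near \<open>y0\<close>.\<close>

lemma solve_for_parameter:
  fixes F :: "complex \<times> 'b::euclidean_space \<Rightarrow> complex"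
  assumes U: "open U" "(s0,y0) \<in> U" and cont: "continuous_on U F"
    and dF: "(F has_derivative (\<lambda>(h,k). a * h + A k)) (at (s0,y0))" and a: "a \<noteq> 0"
    and zero: "F (s0,y0) = 0"
  shows "\<exists>e>0. \<forall>y\<in>ball y0 e. \<exists>s. (s,y) \<in> U \<and> F (s,y) = 0"
proof -
  let ?\<Phi> = "\<lambda>q. (F q, snd q)"
  have A: "bounded_linear A"
    using bounded_linear_compose[OF has_derivative_bounded_linear[OF dF] bounded_linear_Pair[OF bounded_linear_zero bounded_linear_ident]]
    by simp
  have "?\<Phi> (s0,y0) \<in> interior (?\<Phi> ` U)"
  proof (rule sussmann_open_mapping[where S = U and x = "(s0,y0)" and g' = "\<lambda>(z,k). ((z - A k) / a, k)"])
    show "continuous_on U ?\<Phi>" by (intro continuous_intros cont)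
    show "(?\<Phi> has_derivative (\<lambda>q. ((case q of (h,k) \<Rightarrow> a * h + A k), snd q))) (at (s0,y0))"
      by (intro has_derivative_Pair dF has_derivative_snd has_derivative_ident)
    show "bounded_linear (\<lambda>(z,k). ((z - A k) / a, k))"
      unfolding case_prod_unfold
      by (intro bounded_linear_Pair bounded_linear_divide[THEN bounded_linear_compose]
          bounded_linear_sub A[THEN bounded_linear_compose] bounded_linear_fst bounded_linear_snd)
    show "(\<lambda>q. ((case q of (h,k) \<Rightarrow> a * h + A k), snd q)) \<circ> (\<lambda>(z,k). ((z - A k) / a, k)) = id"
      using a by (auto simp: fun_eq_iff field_simps)
  qed (use U in \<open>auto simp: interior_open\<close>)
  then obtain e where e: "e > 0" "cball (0,y0) e \<subseteq> ?\<Phi> ` U"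
    using mem_interior_cball zero by (metis snd_conv)
  show ?thesis
  proof (intro exI[of _ e] conjI ballI e)
    fix y assume "y \<in> ball y0 e"
    then have "(0,y) \<in> cball (0::complex,y0) e" by (simp add: dist_Pair_Pair)
    then show "\<exists>s. (s,y) \<in> U \<and> F (s,y) = 0" using e(2) by force
  qed
qed

text \<open>Existence is \<open>solve_for_parameter\<close>; uniqueness holds because the partial
  derivative \<open>a\<close> stays close to its value at the centre; differentiability is that of
  the local inverse of \<open>(F, snd)\<close>.\<close>

lemma implicit_function:
  fixes F :: "complex \<times> 'b::euclidean_space \<Rightarrow> complex"
  assumes U: "open U" "(s0,y0) \<in> U"
    and dF: "\<And>q. q \<in> U \<Longrightarrow> (F has_derivative (\<lambda>(h,k). a q * h + A q k)) (at q)"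
    and a: "continuous_on U a" "a (s0,y0) \<noteq> 0"
    and zero: "F (s0,y0) = 0"
  obtains e d \<psi> where "e > 0" "d > 0" "ball s0 e \<times> ball y0 d \<subseteq> U"
    "\<And>y. y \<in> ball y0 d \<Longrightarrow> \<psi> y \<in> ball s0 e \<and> F (\<psi> y, y) = 0"
    "\<And>s y. s \<in> ball s0 e \<Longrightarrow> y \<in> ball y0 d \<Longrightarrow> F (s,y) = 0 \<Longrightarrow> s = \<psi> y"
    "\<And>y. y \<in> ball y0 d \<Longrightarrow> (\<psi> has_derivative (\<lambda>k. - A (\<psi> y, y) k / a (\<psi> y, y))) (at y)"
proof -
  define a0 where "a0 = a (s0,y0)"
  have a0: "a0 \<noteq> 0" using a by (simp add: a0_def)
  have contF: "continuous_on U F"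
    using dF has_derivative_continuous continuous_at_imp_continuous_on by blast
  have "open {q \<in> U. norm (a q - a0) < norm a0 / 2}"
  proof -
    have "open (U \<inter> (\<lambda>q. norm (a q - a0)) -` {..<norm a0 / 2})"
      using a U by (intro continuous_open_preimage continuous_intros) auto
    then show ?thesis by (simp add: vimage_def Int_def)
  qed
  moreover have "(s0,y0) \<in> {q \<in> U. norm (a q - a0) < norm a0 / 2}"
    using U a0 by (simp add: a0_def)
  ultimately obtain S Y where SY: "open S" "open Y" "(s0,y0) \<in> S \<times> Y"
    "S \<times> Y \<subseteq> {q \<in> U. norm (a q - a0) < norm a0 / 2}"
    by (rule open_prod_elim)
  obtain e where e: "e > 0" "ball s0 e \<subseteq> S" using SY open_contains_ball by blast
  obtain d1 where d1: "d1 > 0" "ball y0 d1 \<subseteq> Y" using SY open_contains_ball by blast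
  let ?B = "ball s0 e \<times> ball y0 d1"
  have oB: "open ?B" by (simp add: open_Times)
  have BU: "?B \<subseteq> U" and near: "\<And>q. q \<in> ?B \<Longrightarrow> norm (a q - a0) \<le> norm a0 / 2"
    using SY(4) e(2) d1(2) by force+
  \<comment> \<open>In \<open>s\<close>, the difference of \<open>F\<close> and the linear function
    with slope \<open>a0\<close> has Lipschitz constant \<open>norm a0 / 2\<close>, too small to
    cancel the linear part.\<close>
  have uniq: "s = s'" if "s \<in> ball s0 e" "s' \<in> ball s0 e" "y \<in> ball y0 d1" "F (s,y) = F (s',y)" for s s' y
  proof (rule ccontr)
    assume ne: "s \<noteq> s'"
    have "((\<lambda>s. F (s, y) - a0 * s) has_field_derivative (a (z,y) - a0)) (at z within ball s0 e)"
      if z: "z \<in> ball s0 e" for z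
    proof -
      have "(z,y) \<in> U" using z \<open>y \<in> ball y0 d1\<close> BU by auto
      have pr: "((\<lambda>s. (s, y)) has_derivative (\<lambda>h. (h, 0))) (at z)"
        by (auto intro!: derivative_eq_intros)
      have "A (z,y) 0 = 0"
      proof -
        have "bounded_linear (\<lambda>(h,k). a (z,y) * h + A (z,y) k)"
          using dF[OF \<open>(z,y) \<in> U\<close>] has_derivative_bounded_linear by blast
        from linear_0[OF bounded_linear.linear[OF this]] show ?thesis by (simp add: zero_prod_def)
      qed
      then have "((\<lambda>s. F (s, y)) has_field_derivative a (z,y)) (at z)"
        using diff_chain_at[OF pr dF[OF \<open>(z,y) \<in> U\<close>]] by (simp add: has_field_derivative_def o_def)
      then show ?thesis
        by (intro DERIV_diff[OF has_field_derivative_at_within DERIV_cmult_Id])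
    qed
    then have "norm ((F (s, y) - a0 * s) - (F (s', y) - a0 * s')) \<le> norm a0 / 2 * norm (s - s')"
      using near that by (intro field_differentiable_bound[OF convex_ball[of s0 e]]) auto
    then have "norm a0 * norm (s - s') \<le> norm a0 / 2 * norm (s - s')"
      using that(4) by (simp add: norm_mult[symmetric] right_diff_distrib norm_minus_commute)
    then show False using a0 ne by simp
  qed
  let ?\<Phi> = "\<lambda>q. (F q, snd q)"
  have inj: "inj_on ?\<Phi> ?B" using uniq by (auto simp: inj_on_def)
  have contB: "continuous_on ?B F" using contF BU continuous_on_subset by blast
  have "(s0,y0) \<in> ?B" using e d1 by auto
  obtain d2 where d2: "d2 > 0" "\<And>y. y \<in> ball y0 d2 \<Longrightarrow> \<exists>s. (s,y) \<in> ?B \<and> F (s,y) = 0"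
    using solve_for_parameter[OF oB \<open>(s0,y0) \<in> ?B\<close> contB dF[OF U(2)] a(2) zero] by blast
  define d where "d = min d1 d2"
  define \<psi> where "\<psi> y = fst (inv_into ?B ?\<Phi> (0,y))" for y
  have root: "\<psi> y = s" if "s \<in> ball s0 e" "y \<in> ball y0 d1" "F (s,y) = 0" for s y
  proof -
    have "inv_into ?B ?\<Phi> (?\<Phi> (s,y)) = (s,y)" using that by (intro inv_into_f_f inj) auto
    then show ?thesis using that by (simp add: \<psi>_def)
  qed
  have ex: "\<psi> y \<in> ball s0 e \<and> F (\<psi> y, y) = 0" if "y \<in> ball y0 d" for y
  proof -
    have "y \<in> ball y0 d2" "y \<in> ball y0 d1" using that by (auto simp: d_def)
    then obtain s where "s \<in> ball s0 e" "F (s,y) = 0" using d2(2) by blast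
    then show ?thesis using root[of s y] \<open>y \<in> ball y0 d1\<close> by simp
  qed
  have der: "(\<psi> has_derivative (\<lambda>k. - A (\<psi> y, y) k / a (\<psi> y, y))) (at y)" if y: "y \<in> ball y0 d" for y
  proof -
    let ?q = "(\<psi> y, y)"
    have q: "?q \<in> ?B" using ex[OF y] y by (auto simp: d_def)
    have aq: "a ?q \<noteq> 0" using near[OF q] a0 by (auto simp: norm_minus_commute)
    have A: "bounded_linear (A ?q)"
      using bounded_linear_compose[OF has_derivative_bounded_linear[OF dF] bounded_linear_Pair[OF bounded_linear_zero bounded_linear_ident]] q BU
      by force
    have "(inv_into ?B ?\<Phi> has_derivative (\<lambda>(z,k). ((z - A ?q k) / a ?q, k))) (at (?\<Phi> ?q))"
    proof (rule has_derivative_inverse_strong[OF oB q])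
      show "continuous_on ?B ?\<Phi>" by (intro continuous_intros contB)
      show "inv_into ?B ?\<Phi> (?\<Phi> x) = x" if "x \<in> ?B" for x
        using that by (intro inv_into_f_f inj)
      show "(?\<Phi> has_derivative (\<lambda>p. ((case p of (h,k) \<Rightarrow> a ?q * h + A ?q k), snd p))) (at ?q)"
        using q BU by (intro has_derivative_Pair dF has_derivative_snd has_derivative_ident) auto
      show "(\<lambda>p. ((case p of (h,k) \<Rightarrow> a ?q * h + A ?q k), snd p)) \<circ> (\<lambda>(z,k). ((z - A ?q k) / a ?q, k)) = id"
        using aq by (auto simp: fun_eq_iff field_simps)
    qed
    then have 1: "(inv_into ?B ?\<Phi> has_derivative (\<lambda>(z,k). ((z - A ?q k) / a ?q, k))) (at (0,y))"
      using ex[OF y] by simp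
    have 2: "((\<lambda>y. (0::complex, y)) has_derivative (\<lambda>k. (0,k))) (at y)"
      by (auto intro!: derivative_eq_intros)
    show ?thesis
      using has_derivative_fst[OF diff_chain_at[OF 2 1]] by (simp add: \<psi>_def[abs_def] o_def)
  qed
  show ?thesis
  proof (rule that[of e d \<psi>])
    show "ball s0 e \<times> ball y0 d \<subseteq> U" using BU by (auto simp: d_def)
    show "s = \<psi> y" if "s \<in> ball s0 e" "y \<in> ball y0 d" "F (s,y) = 0" for s y
      using root[of s y] that by (simp add: d_def)
  qed (use e d1 d2 ex der in \<open>auto simp: d_def\<close>)
qed

section \<open>Complex bilinear vector algebra\<close>

lemma bdot_3: "bdot x y = x$1 * y$1 + x$2 * y$2 + x$3 * y$3" for x y :: "complex^3"
  by (simp add: bdot_def sum_3)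

lemma cross3_nth [simp]:
  "cross3 x y $ 1 = x$2 * y$3 - x$3 * y$2"
  "cross3 x y $ 2 = x$3 * y$1 - x$1 * y$3"
  "cross3 x y $ 3 = x$1 * y$2 - x$2 * y$1"
  by (simp_all add: cross3_def)

lemma bdot_linear [simp]:
  "bdot (x + y) z = bdot x z + bdot y z" "bdot z (x + y) = bdot z x + bdot z y"
  "bdot (x - y) z = bdot x z - bdot y z" "bdot z (x - y) = bdot z x - bdot z y"
  "bdot (c *s x) z = c * bdot x z" "bdot z (c *s x) = c * bdot z x"
  "bdot 0 z = 0" "bdot z 0 = 0"
  by (simp_all add: bdot_def sum.distrib sum_subtractf sum_distrib_left algebra_simps)

lemma bdot_minus [simp]: "bdot (- x) z = - bdot x z" "bdot z (- x) = - bdot z x"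
  by (simp_all add: bdot_def sum_negf)

lemma bdot_commute: "bdot x y = bdot y x"
  by (simp add: bdot_def mult.commute)

lemma bdot_all_eqD: "(\<And>k. bdot x k = bdot y k) \<Longrightarrow> x = y" for x y :: "complex^'n"
proof -
  assume h: "\<And>k. bdot x k = bdot y k"
  have "bdot z (axis i 1) = z $ i" for z :: "complex^'n" and i
    by (simp add: bdot_def axis_def if_distrib cong: if_cong)
  then show "x = y" using h by (metis vec_eq_iff)
qed

lemma bounded_bilinear_bdot: "bounded_bilinear (bdot :: complex^'n \<Rightarrow> _)"
proof -
  have "bilinear (bdot :: complex^'n \<Rightarrow> complex^'n \<Rightarrow> complex)"
    unfolding bilinear_def
    by (auto intro!: linearI simp: bdot_def scaleR_sum_right algebra_simps sum.distrib)
  then show ?thesis by (simp add: bilinear_conv_bounded_bilinear)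
qed

lemma bounded_bilinear_cross3: "bounded_bilinear cross3"
proof -
  have "bilinear cross3"
    unfolding bilinear_def
    by (auto intro!: linearI simp: vec_eq_iff forall_3 algebra_simps)
  then show ?thesis by (simp add: bilinear_conv_bounded_bilinear)
qed

lemma bounded_bilinear_smult: "bounded_bilinear ((*s) :: complex \<Rightarrow> complex^'n \<Rightarrow> _)"
proof -
  have "bilinear ((*s) :: complex \<Rightarrow> complex^'n \<Rightarrow> _)"
    unfolding bilinear_def
    by (auto intro!: linearI simp: vec_eq_iff algebra_simps)
  then show ?thesis by (simp add: bilinear_conv_bounded_bilinear)
qed

definition det3 :: "complex^3 \<Rightarrow> complex^3 \<Rightarrow> complex^3 \<Rightarrow> complex" where
  "det3 a b c = bdot a (cross3 b c)"

lemma det3_linear [simp]: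
  "det3 (x + y) z w = det3 x z w + det3 y z w" "det3 z (x + y) w = det3 z x w + det3 z y w"
  "det3 z w (x + y) = det3 z w x + det3 z w y"
  "det3 (x - y) z w = det3 x z w - det3 y z w" "det3 z (x - y) w = det3 z x w - det3 z y w"
  "det3 z w (x - y) = det3 z w x - det3 z w y"
  "det3 (c *s x) z w = c * det3 x z w" "det3 z (c *s x) w = c * det3 z x w"
  "det3 z w (c *s x) = c * det3 z w x"
  "det3 (- x) z w = - det3 x z w" "det3 z (- x) w = - det3 z x w" "det3 z w (- x) = - det3 z w x"
  "det3 0 z w = 0" "det3 z 0 w = 0" "det3 z w 0 = 0"
  "det3 x x z = 0" "det3 x z x = 0" "det3 z x x = 0"
  by (simp_all add: det3_def bdot_3 algebra_simps)

lemma det3_perm: "det3 a b c = det3 b c a" "det3 a b c = - det3 a c b"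
  by (simp_all add: det3_def bdot_3 algebra_simps)

text \<open>Multiplicativity of the determinant: the right side is the determinant of the Gram
  matrix of the two triples.\<close>

lemma det3_mult_gram:
  "det3 a b c * det3 a' b' c' =
     bdot a a' * (bdot b b' * bdot c c' - bdot b c' * bdot c b')
   - bdot a b' * (bdot b a' * bdot c c' - bdot b c' * bdot c a')
   + bdot a c' * (bdot b a' * bdot c b' - bdot b b' * bdot c a')"
  unfolding det3_def bdot_3 cross3_nth by algebra

text \<open>Up to the factor \<open>det3 a b c\<close>, the cross products are the basis dual to
  \<open>a\<close>, \<open>b\<close>, \<open>c\<close>.\<close>

lemma det3_expand:
  "det3 a b c *s v = bdot v a *s cross3 b c + bdot v b *s cross3 c a + bdot v c *s cross3 a b"
  unfolding det3_def bdot_3 vec_eq_iff forall_3 vector_add_component vector_smult_component cross3_nth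
  by (intro conjI; algebra)

lemma det3_orthogonal_zero:
  assumes "det3 a b c \<noteq> 0" "bdot v a = 0" "bdot v b = 0" "bdot v c = 0"
  shows "v = 0"
  using det3_expand[of a b c v] assms by simp

lemma det3_cramer:
  "det3 a b c *s v = det3 v b c *s a + det3 a v c *s b + det3 a b v *s c"
  unfolding det3_def bdot_3 vec_eq_iff forall_3 vector_add_component vector_smult_component cross3_nth
  by (intro conjI; algebra)

lemma cross3_cross3: "cross3 a (cross3 b c) = bdot a c *s b - bdot a b *s c"
  by (simp add: vec_eq_iff forall_3 bdot_3 algebra_simps)

lemma cross3_cross3_left: "cross3 (cross3 a b) c = bdot a c *s b - bdot b c *s a"
  by (simp add: vec_eq_iff forall_3 bdot_3 algebra_simps)

lemma bdot_cross3_cross3: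
  "bdot (cross3 a b) (cross3 c d) = bdot a c * bdot b d - bdot a d * bdot b c"
  by (simp add: bdot_3 algebra_simps)

lemma cross3_zero_parallel:
  assumes "cross3 a b = 0" "a \<noteq> 0"
  obtains k where "b = k *s a"
proof -
  obtain i where i: "a $ i \<noteq> 0" using assms(2) by (auto simp: vec_eq_iff)
  have *: "a $ i * b $ j = b $ i * a $ j" for i j
    using assms(1) exhaust_3[of i] exhaust_3[of j]
    by (auto simp: vec_eq_iff forall_3 algebra_simps)
  have "b = (b $ i / a $ i) *s a"
    using i *[of i] by (simp add: vec_eq_iff field_simps)
  then show ?thesis using that by blast
qed

lemma cross3_skew: "cross3 a b = - cross3 b a" "cross3 a a = 0"
  by (simp_all add: vec_eq_iff forall_3)

lemma cross3_linear [simp]: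
  "cross3 (x + y) z = cross3 x z + cross3 y z" "cross3 z (x + y) = cross3 z x + cross3 z y"
  "cross3 (x - y) z = cross3 x z - cross3 y z" "cross3 z (x - y) = cross3 z x - cross3 z y"
  "cross3 (c *s x) z = c *s cross3 x z" "cross3 z (c *s x) = c *s cross3 z x"
  "cross3 (- x) z = - cross3 x z" "cross3 z (- x) = - cross3 z x"
  "cross3 0 z = 0" "cross3 z 0 = 0"
  by (simp_all add: vec_eq_iff forall_3 algebra_simps)

text \<open>The double product \<open>n \<times> (n \<times> z) = (n \<cdot> z) n - z\<close>
  recovers \<open>z\<close> from its normal component once \<open>n \<times> z = 0\<close>; here
  \<open>z = v \<times> w\<close>.\<close>

lemma normal_component:
  assumes "bdot n n = 1" "bdot n v = 0" "bdot n w = 0"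
  shows "cross3 v w = det3 n v w *s n"
proof -
  have "cross3 n (cross3 v w) = 0" using assms by (simp add: cross3_cross3)
  moreover have "cross3 n (cross3 n (cross3 v w)) = det3 n v w *s n - cross3 v w"
    unfolding det3_def using assms(1) by (subst cross3_cross3) simp
  ultimately show ?thesis by simp
qed

lemma tangent_parallel:
  assumes "bdot n n = 1" "bdot n v = 0" "bdot n w = 0" "det3 n v w = 0" "v \<noteq> 0"
  obtains k where "w = k *s v"
  using cross3_zero_parallel[of v w] normal_component[OF assms(1-3)] assms(4,5) by auto

text \<open>Cramer's rule: the coefficient of \<open>n\<close> is \<open>det3 z v w\<close>, which
  vanishes because \<open>v \<times> w\<close> is a multiple of \<open>n\<close>.\<close>

lemma tangent_basis:
  assumes "bdot n n = 1" "bdot n v = 0" "bdot n w = 0" "det3 n v w \<noteq> 0" "bdot n z = 0"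
  obtains \<alpha> \<beta> where "z = \<alpha> *s v + \<beta> *s w"
proof -
  have "det3 z v w = 0"
    unfolding det3_def[of z] by (subst normal_component[OF assms(1-3)]) (simp add: assms(5) bdot_commute[of z])
  then have "det3 n v w *s z = det3 n z w *s v + det3 n v z *s w"
    using det3_cramer[of n v w z] by simp
  then have "z = (det3 n z w / det3 n v w) *s v + (det3 n v z / det3 n v w) *s w"
    using assms(4) by (simp add: vec_eq_iff field_simps)
  then show ?thesis using that by blast
qed

section \<open>Holomorphic vector-valued maps and their product rules\<close>

definition holov :: "(complex \<times> complex) set \<Rightarrow> (complex \<times> complex \<Rightarrow> complex^3) \<Rightarrow> bool" where
  "holov D x \<longleftrightarrow> (\<forall>i. sep_holo D (\<lambda>p. x p $ i))"

lemma holov_open: "holov D x \<Longrightarrow> open D"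
  by (simp add: holov_def sep_holo_def)

lemma Pu_nth [simp]: "Pu x p $ i = Du (\<lambda>p. x p $ i) p"
  and Pv_nth [simp]: "Pv x p $ i = Dv (\<lambda>p. x p $ i) p"
  by (simp_all add: Pu_def Pv_def Du_def Dv_def)

lemma holov_Pu: "holov D x \<Longrightarrow> holov D (Pu x)"
  and holov_Pv: "holov D x \<Longrightarrow> holov D (Pv x)"
  by (simp_all add: holov_def sep_holo_Du sep_holo_Dv)

lemma Pv_Pu_commute:
  assumes "holov D x" "p \<in> D"
  shows "Pv (Pu x) p = Pu (Pv x) p"
  using assms Dv_Du_commute by (simp add: vec_eq_iff holov_def) blast

lemma holov_cross3: "holov D x \<Longrightarrow> holov D y \<Longrightarrow> holov D (\<lambda>p. cross3 (x p) (y p))"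
  by (auto simp: holov_def forall_3 intro!: sep_holo_diff sep_holo_mult)

lemma sep_holo_bdot: "holov D x \<Longrightarrow> holov D y \<Longrightarrow> sep_holo D (\<lambda>p. bdot (x p) (y p))"
  by (auto simp: holov_def bdot_3 intro!: sep_holo_add sep_holo_mult)

lemma holov_const: "open D \<Longrightarrow> holov D (\<lambda>p. k)"
  by (simp add: holov_def sep_holo_const)

lemma holov_subset: "holov D x \<Longrightarrow> open B \<Longrightarrow> B \<subseteq> D \<Longrightarrow> holov B x"
  using sep_holo_subset unfolding holov_def by blast

lemma Pu_const [simp]: "Pu (\<lambda>p. k) p = 0" "Pv (\<lambda>p. k) p = 0"
  by (simp_all add: vec_eq_iff)

lemma Du_Dv_bdot:
  assumes x: "holov D x" and y: "holov D y" and p: "p \<in> D"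
  shows "Du (\<lambda>p. bdot (x p) (y p)) p = bdot (x p) (Pu y p) + bdot (Pu x p) (y p)"
    "Dv (\<lambda>p. bdot (x p) (y p)) p = bdot (x p) (Pv y p) + bdot (Pv x p) (y p)"
proof -
  have s: "sep_holo D (\<lambda>p. x p $ i)" "sep_holo D (\<lambda>p. y p $ i)" for i
    using x y by (auto simp: holov_def)
  show "Du (\<lambda>p. bdot (x p) (y p)) p = bdot (x p) (Pu y p) + bdot (Pu x p) (y p)"
    "Dv (\<lambda>p. bdot (x p) (y p)) p = bdot (x p) (Pv y p) + bdot (Pv x p) (y p)"
    by (simp_all add: bdot_3 Du_Dv_add[OF _ _ p] Du_Dv_mult[OF _ _ p] sep_holo_add sep_holo_mult s)
qed

lemma Pu_Pv_cross3:
  assumes x: "holov D x" and y: "holov D y" and p: "p \<in> D"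
  shows "Pu (\<lambda>p. cross3 (x p) (y p)) p = cross3 (x p) (Pu y p) + cross3 (Pu x p) (y p)"
    "Pv (\<lambda>p. cross3 (x p) (y p)) p = cross3 (x p) (Pv y p) + cross3 (Pv x p) (y p)"
proof -
  have s: "sep_holo D (\<lambda>p. x p $ i)" "sep_holo D (\<lambda>p. y p $ i)" for i
    using x y by (auto simp: holov_def)
  show "Pu (\<lambda>p. cross3 (x p) (y p)) p = cross3 (x p) (Pu y p) + cross3 (Pu x p) (y p)"
    "Pv (\<lambda>p. cross3 (x p) (y p)) p = cross3 (x p) (Pv y p) + cross3 (Pv x p) (y p)"
    by (simp_all add: vec_eq_iff forall_3 Du_Dv_diff[OF _ _ p] Du_Dv_mult[OF _ _ p] sep_holo_mult s)
qed

section \<open>Differentiation on pairs of surfaces\<close>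

text \<open>The differential of \<open>x\<close> at \<open>p\<close>, applied to the complex tangent
  vector \<open>h\<close>.\<close>

definition dvec :: "(complex \<times> complex \<Rightarrow> complex^3) \<Rightarrow> complex \<times> complex \<Rightarrow> complex \<times> complex \<Rightarrow> complex^3" where
  "dvec x p h = fst h *s Pu x p + snd h *s Pv x p"

lemma holov_has_derivative:
  assumes x: "holov D x" and p: "p \<in> D"
  shows "(x has_derivative dvec x p) (at p)"
proof -
  have "((\<lambda>p. \<Sum>i\<in>UNIV. x p $ i *s axis i 1) has_derivative
     (\<lambda>h. \<Sum>i\<in>UNIV. (case h of (h,k) \<Rightarrow> Du (\<lambda>p. x p $ i) p * h + Dv (\<lambda>p. x p $ i) p * k) *s axis i 1)) (at p)"
  proof (rule has_derivative_sum)
    fix i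
    have "((\<lambda>p. x p $ i) has_derivative (\<lambda>(h,k). Du (\<lambda>p. x p $ i) p * h + Dv (\<lambda>p. x p $ i) p * k)) (at p)"
      using x p sep_holo_imp_holo2 unfolding holov_def by blast
    from bounded_bilinear.FDERIV[OF bounded_bilinear_smult this has_derivative_const[of "axis i (1::complex)"]]
    show "((\<lambda>p. x p $ i *s axis i 1) has_derivative
      (\<lambda>h. (case h of (h,k) \<Rightarrow> Du (\<lambda>p. x p $ i) p * h + Dv (\<lambda>p. x p $ i) p * k) *s (axis i 1 :: complex^3))) (at p)"
      by simp
  qed
  moreover have "(\<Sum>i\<in>UNIV. (case h of (h,k) \<Rightarrow> Du (\<lambda>p. x p $ i) p * h + Dv (\<lambda>p. x p $ i) p * k) *s axis i 1) = dvec x p h" for h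
    using basis_expansion[of "dvec x p h"]
    by (simp add: dvec_def case_prod_unfold mult.commute)
  ultimately show ?thesis by (simp add: basis_expansion)
qed

section \<open>Complex differentials on the parameter space of pairs of points\<close>

type_synonym cc = "(complex \<times> complex) \<times> (complex \<times> complex)"

definition cscale :: "complex \<Rightarrow> cc \<Rightarrow> cc" where
  "cscale c \<xi> = ((c * fst (fst \<xi>), c * snd (fst \<xi>)), (c * fst (snd \<xi>), c * snd (snd \<xi>)))"

text \<open>Additivity is part of \<open>has_derivative\<close>; homogeneity under
  \<open>cscale\<close> makes the real Frechet derivative complex linear.\<close>

definition cder :: "(cc \<Rightarrow> complex) \<Rightarrow> (cc \<Rightarrow> complex) \<Rightarrow> cc \<Rightarrow> bool" where
  "cder H H' q \<longleftrightarrow> (H has_derivative H') (at q) \<and> (\<forall>c \<xi>. H' (cscale c \<xi>) = c * H' \<xi>)"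

definition vder :: "(cc \<Rightarrow> complex^3) \<Rightarrow> (cc \<Rightarrow> complex^3) \<Rightarrow> cc \<Rightarrow> bool" where
  "vder X X' q \<longleftrightarrow> (X has_derivative X') (at q) \<and> (\<forall>c \<xi>. X' (cscale c \<xi>) = c *s X' \<xi>)"

lemma cder_eq: "cder H H' q \<Longrightarrow> (\<And>\<xi>. H' \<xi> = G \<xi>) \<Longrightarrow> cder H G q"
  by (metis ext)

lemma vder_const: "vder (\<lambda>q. k) (\<lambda>\<xi>. 0) q" and cder_const: "cder (\<lambda>q. z) (\<lambda>\<xi>. 0) q"
  by (simp_all add: vder_def cder_def)

lemma vder_fst: "holov D x \<Longrightarrow> fst q \<in> D \<Longrightarrow> vder (\<lambda>q. x (fst q)) (\<lambda>\<xi>. dvec x (fst q) (fst \<xi>)) q"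
  unfolding vder_def
  using has_derivative_compose[OF has_derivative_fst[OF has_derivative_ident] holov_has_derivative[of D x "fst q"], of UNIV]
  by (auto simp: dvec_def cscale_def vec_eq_iff algebra_simps)

lemma vder_snd: "holov D x \<Longrightarrow> snd q \<in> D \<Longrightarrow> vder (\<lambda>q. x (snd q)) (\<lambda>\<xi>. dvec x (snd q) (snd \<xi>)) q"
  unfolding vder_def
  using has_derivative_compose[OF has_derivative_snd[OF has_derivative_ident] holov_has_derivative[of D x "snd q"], of UNIV]
  by (auto simp: dvec_def cscale_def vec_eq_iff algebra_simps)

lemma vder_diff: "vder X X' q \<Longrightarrow> vder Y Y' q \<Longrightarrow> vder (\<lambda>q. X q - Y q) (\<lambda>\<xi>. X' \<xi> - Y' \<xi>) q"
  by (auto simp: vder_def vec_eq_iff algebra_simps intro: has_derivative_diff)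

lemma cder_add: "cder X X' q \<Longrightarrow> cder Y Y' q \<Longrightarrow> cder (\<lambda>q. X q + Y q) (\<lambda>\<xi>. X' \<xi> + Y' \<xi>) q"
  by (auto simp: cder_def algebra_simps intro: has_derivative_add)

lemma cder_diff: "cder X X' q \<Longrightarrow> cder Y Y' q \<Longrightarrow> cder (\<lambda>q. X q - Y q) (\<lambda>\<xi>. X' \<xi> - Y' \<xi>) q"
  by (auto simp: cder_def algebra_simps intro: has_derivative_diff)

lemma cder_mult: "cder X X' q \<Longrightarrow> cder Y Y' q \<Longrightarrow> cder (\<lambda>q. X q * Y q) (\<lambda>\<xi>. X q * Y' \<xi> + X' \<xi> * Y q) q"
  by (auto simp: cder_def algebra_simps intro!: bounded_bilinear.FDERIV[OF bounded_bilinear_mult])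

lemma cder_bdot: "vder X X' q \<Longrightarrow> vder Y Y' q \<Longrightarrow>
    cder (\<lambda>q. bdot (X q) (Y q)) (\<lambda>\<xi>. bdot (X q) (Y' \<xi>) + bdot (X' \<xi>) (Y q)) q"
  by (auto simp: cder_def vder_def algebra_simps intro!: bounded_bilinear.FDERIV[OF bounded_bilinear_bdot])

lemma vder_cross3: "vder X X' q \<Longrightarrow> vder Y Y' q \<Longrightarrow>
    vder (\<lambda>q. cross3 (X q) (Y q)) (\<lambda>\<xi>. cross3 (X q) (Y' \<xi>) + cross3 (X' \<xi>) (Y q)) q"
  by (auto simp: vder_def vector_add_ldistrib intro!: bounded_bilinear.FDERIV[OF bounded_bilinear_cross3])

lemma vder_smult: "cder X X' q \<Longrightarrow> vder Y Y' q \<Longrightarrow>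
    vder (\<lambda>q. X q *s Y q) (\<lambda>\<xi>. X q *s Y' \<xi> + X' \<xi> *s Y q) q"
  by (auto simp: vder_def cder_def vec_eq_iff algebra_simps intro!: bounded_bilinear.FDERIV[OF bounded_bilinear_smult])

lemma cder_det3: "vder X X' q \<Longrightarrow> vder Y Y' q \<Longrightarrow> vder Z Z' q \<Longrightarrow>
    cder (\<lambda>q. det3 (X q) (Y q) (Z q)) (\<lambda>\<xi>. det3 (X' \<xi>) (Y q) (Z q) + det3 (X q) (Y' \<xi>) (Z q) + det3 (X q) (Y q) (Z' \<xi>)) q"
  unfolding det3_def by (rule cder_eq[OF cder_bdot[OF _ vder_cross3]]) auto

text \<open>Restriction to the complex plane spanned by the transversal vector \<open>\<eta>\<close>
  and the tangent vector \<open>\<xi>\<close> reduces this to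
  \<open>zero_set_derivative\<close>.\<close>

lemma cder_zero_set:
  assumes U: "open U" "q \<in> U"
    and dF: "\<And>q. q \<in> U \<Longrightarrow> cder F (F' q) q" and dH: "\<And>q. q \<in> U \<Longrightarrow> cder H (H' q) q"
    and zero: "F q = 0" "\<And>y. y \<in> U \<Longrightarrow> F y = 0 \<Longrightarrow> H y = 0"
    and \<eta>: "F' q \<eta> \<noteq> 0" and \<xi>: "F' q \<xi> = 0"
  shows "H' q \<xi> = 0"
proof -
  let ?L = "\<lambda>(s,t). cscale s \<eta> + cscale t \<xi>"
  have lin: "linear (F' q)" "linear (H' q)"
    using dF[OF U(2)] dH[OF U(2)] by (auto simp: cder_def dest: has_derivative_bounded_linear bounded_linear.linear)
  have sc: "F' q (cscale c \<zeta>) = c * F' q \<zeta>" "H' q (cscale c \<zeta>) = c * H' q \<zeta>" for c \<zeta>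
    using dF[OF U(2)] dH[OF U(2)] unfolding cder_def by blast+
  have "bounded_linear ?L"
    unfolding linear_conv_bounded_linear[symmetric]
    by (auto intro!: linearI simp: cscale_def algebra_simps scaleR_conv_of_real)
  moreover have "F' q (?L (s,t)) = F' q \<eta> * s" for s t
    using \<xi> by (simp add: linear_add[OF lin(1)] sc)
  moreover have "H' q (?L (s,t)) = H' q \<eta> * s + H' q \<xi> * t" for s t
    by (simp add: linear_add[OF lin(2)] sc)
  moreover have "continuous_on U F" "continuous_on U H"
    using dF dH unfolding cder_def
    by (meson continuous_at_imp_continuous_on has_derivative_continuous)+
  moreover have "(F has_derivative F' q) (at q)" "(H has_derivative H' q) (at q)"
    using dF[OF U(2)] dH[OF U(2)] unfolding cder_def by blast+
  ultimately show ?thesis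
    using zero_set_derivative[OF U, of F H "F' q" "H' q" ?L] zero \<eta> by blast
qed

lemma cder_continuous: "(\<And>q. q \<in> A \<Longrightarrow> \<exists>H'. cder H H' q) \<Longrightarrow> continuous_on A H"
  unfolding cder_def by (meson continuous_at_imp_continuous_on has_derivative_continuous)

section \<open>The parameter curves are straight\<close>

lemma Pu_swap: "Pu (y \<circ> prod.swap) = Pv y \<circ> prod.swap"
  and Pv_swap: "Pv (y \<circ> prod.swap) = Pu y \<circ> prod.swap"
  by (simp_all add: fun_eq_iff Pu_def Pv_def)

lemma holov_swap: "holov D y \<Longrightarrow> holov (prod.swap ` D) (y \<circ> prod.swap)"
  unfolding holov_def using sep_holo_swap by (fastforce simp: o_def)

lemma continuous_on_swap: "continuous_on A (prod.swap :: complex \<times> complex \<Rightarrow> _)"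
  by (simp add: prod.swap_def continuous_on_Pair continuous_on_fst continuous_on_snd)

text \<open>The data of the theorem with \<open>y\<close> for \<open>x\<^sub>z\<close>. The
  integrability condition is multiplied out into vectors, and nonzero curvature is expressed through
  the pairing of \<open>dx\<close> with \<open>dN\<close>. As a locale it can be instantiated again
  with the two parameters of \<open>y\<close> interchanged.\<close>

locale tangential_pair =
  fixes x N y :: "complex \<times> complex \<Rightarrow> complex^3" and D0 D1 :: "(complex \<times> complex) set"
  assumes hx: "holov D0 x" and hN: "holov D0 N" and hy: "holov D1 y"
    and D0: "connected D0" and D1: "connected D1"
    and NN: "p \<in> D0 \<Longrightarrow> bdot (N p) (N p) = 1"
    and Nxu: "p \<in> D0 \<Longrightarrow> bdot (N p) (Pu x p) = 0"
    and Nxv: "p \<in> D0 \<Longrightarrow> bdot (N p) (Pv x p) = 0"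
    and NNu: "p \<in> D0 \<Longrightarrow> bdot (N p) (Pu N p) = 0"
    and NNv: "p \<in> D0 \<Longrightarrow> bdot (N p) (Pv N p) = 0"
    and II_sym: "p \<in> D0 \<Longrightarrow> bdot (Pu x p) (Pv N p) = bdot (Pv x p) (Pu N p)"
    and II_nondeg: "p \<in> D0 \<Longrightarrow>
      bdot (Pu x p) (Pu N p) * bdot (Pv x p) (Pv N p) - (bdot (Pu x p) (Pv N p))^2 \<noteq> 0"
    and reg: "p \<in> D1 \<Longrightarrow> cross3 (Pu y p) (Pv y p) \<noteq> 0"
    and S_ex: "\<exists>p\<in>D0. \<exists>p'\<in>D1. bdot (y p' - x p) (N p) = 0"
    and S_nondeg: "p \<in> D0 \<Longrightarrow> p' \<in> D1 \<Longrightarrow> bdot (y p' - x p) (N p) = 0 \<Longrightarrow>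
      bdot (Pu y p') (N p) \<noteq> 0 \<and> bdot (Pv y p') (N p) \<noteq> 0"
    and integrable: "p \<in> D0 \<Longrightarrow> p' \<in> D1 \<Longrightarrow> bdot (y p' - x p) (N p) = 0 \<Longrightarrow>
      bdot (Pv y p') (N p) *s Pu y p' + bdot (Pu y p') (N p) *s Pv y p'
        - (2 * bdot (Pu y p') (N p) * bdot (Pv y p') (N p)) *s N p
      = bdot (Pu (Pv y) p') (N p) *s (y p' - x p)"
begin

section \<open>The tangency set \<open>F = 0\<close> and its tangent directions\<close>

definition V :: "cc \<Rightarrow> complex^3" where "V q = y (snd q) - x (fst q)"
definition F :: "cc \<Rightarrow> complex" where "F q = bdot (V q) (N (fst q))"
definition a :: "cc \<Rightarrow> complex" where "a q = bdot (Pu y (snd q)) (N (fst q))"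
definition b :: "cc \<Rightarrow> complex" where "b q = bdot (Pv y (snd q)) (N (fst q))"
definition c :: "cc \<Rightarrow> complex" where "c q = bdot (Pu (Pv y) (snd q)) (N (fst q))"

text \<open>Pairing the integrability condition with an arbitrary vector \<open>k\<close> makes it
  scalar, ready for differentiation along the tangency set.\<close>

lemma S_facts:
  assumes "q \<in> D0 \<times> D1" "F q = 0"
  shows "a q \<noteq> 0" "b q \<noteq> 0"
    "b q * bdot (Pu y (snd q)) k + a q * bdot (Pv y (snd q)) k - 2 * a q * b q * bdot (N (fst q)) k
       = c q * bdot (V q) k"
proof -
  have q: "fst q \<in> D0" "snd q \<in> D1" using assms by auto
  show "a q \<noteq> 0" "b q \<noteq> 0"
    using S_nondeg[OF q] assms by (auto simp: F_def V_def a_def b_def)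
  show "b q * bdot (Pu y (snd q)) k + a q * bdot (Pv y (snd q)) k - 2 * a q * b q * bdot (N (fst q)) k
       = c q * bdot (V q) k"
    using arg_cong[OF integrable[OF q], of "\<lambda>v. bdot v k"] assms
    by (simp add: F_def V_def a_def b_def c_def right_diff_distrib)
qed

lemma openD: "open D0" "open D1" "open (D0 \<times> D1)"
  using holov_open[OF hx] holov_open[OF hy] by (auto simp: open_Times)

text \<open>By the Gram formula the product of the two determinants is the determinant of the second
  fundamental form, since \<open>N\<close> is a unit vector orthogonal to all four
  derivatives.\<close>

lemma detN: "p \<in> D0 \<Longrightarrow> det3 (N p) (Pu N p) (Pv N p) \<noteq> 0"
  and detx: "p \<in> D0 \<Longrightarrow> det3 (N p) (Pu x p) (Pv x p) \<noteq> 0"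
proof -
  assume p: "p \<in> D0"
  have "det3 (N p) (Pu N p) (Pv N p) * det3 (N p) (Pu x p) (Pv x p) \<noteq> 0"
    unfolding det3_mult_gram
    using NN[OF p] Nxu[OF p] Nxv[OF p] NNu[OF p] NNv[OF p] II_sym[OF p] II_nondeg[OF p]
    by (simp add: bdot_commute[of "Pu N p"] bdot_commute[of "Pv N p"] power2_eq_square)
  then show "det3 (N p) (Pu N p) (Pv N p) \<noteq> 0" "det3 (N p) (Pu x p) (Pv x p) \<noteq> 0" by auto
qed

lemma dN_tangent [simp]: "p \<in> D0 \<Longrightarrow> bdot (N p) (dvec N p h) = 0"
  and dx_tangent [simp]: "p \<in> D0 \<Longrightarrow> bdot (N p) (dvec x p h) = 0"
  by (simp_all add: dvec_def NNu NNv Nxu Nxv)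

lemma dN_dx_sym: "p \<in> D0 \<Longrightarrow> bdot (dvec x p h) (dvec N p k) = bdot (dvec x p k) (dvec N p h)"
  using II_sym by (simp add: dvec_def algebra_simps)

lemma vders:
  assumes "q \<in> D0 \<times> D1"
  shows "vder V (\<lambda>\<xi>. dvec y (snd q) (snd \<xi>) - dvec x (fst q) (fst \<xi>)) q"
    "vder (\<lambda>q. N (fst q)) (\<lambda>\<xi>. dvec N (fst q) (fst \<xi>)) q"
    "vder (\<lambda>q. Pu y (snd q)) (\<lambda>\<xi>. dvec (Pu y) (snd q) (snd \<xi>)) q"
    "vder (\<lambda>q. Pv y (snd q)) (\<lambda>\<xi>. dvec (Pv y) (snd q) (snd \<xi>)) q"
    "vder (\<lambda>q. Pu (Pv y) (snd q)) (\<lambda>\<xi>. dvec (Pu (Pv y)) (snd q) (snd \<xi>)) q"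
    "vder (\<lambda>q. Pu N (fst q)) (\<lambda>\<xi>. dvec (Pu N) (fst q) (fst \<xi>)) q"
    "vder (\<lambda>q. Pv N (fst q)) (\<lambda>\<xi>. dvec (Pv N) (fst q) (fst \<xi>)) q"
    "vder (\<lambda>q. Pu x (fst q)) (\<lambda>\<xi>. dvec (Pu x) (fst q) (fst \<xi>)) q"
    "vder (\<lambda>q. Pv x (fst q)) (\<lambda>\<xi>. dvec (Pv x) (fst q) (fst \<xi>)) q"
  unfolding V_def[abs_def] using assms hx hN hy
  by (auto intro!: vder_diff vder_fst vder_snd holov_Pu holov_Pv)

text \<open>The differential of \<open>F\<close>; the contribution of \<open>dx\<close> drops out
  because it is orthogonal to \<open>N\<close>.\<close>

definition F' :: "cc \<Rightarrow> cc \<Rightarrow> complex" where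
  "F' q \<xi> = bdot (V q) (dvec N (fst q) (fst \<xi>)) + fst (snd \<xi>) * a q + snd (snd \<xi>) * b q"

lemma F_der: "q \<in> D0 \<times> D1 \<Longrightarrow> cder F (F' q) q"
  unfolding F_def[abs_def]
  by (rule cder_eq[OF cder_bdot[OF vders(1,2)]])
     (auto simp: F'_def bdot_commute[of _ "N _"] a_def b_def dvec_def Nxu Nxv)

text \<open>Differentiation along the tangency set: an identity holding there may be differentiated
  in every direction annihilated by \<open>F'\<close>. The first parameter direction of
  \<open>y\<close> is transversal because \<open>a\<close> does not vanish.\<close>

lemma on_S:
  assumes "open U" "q \<in> U" "U \<subseteq> D0 \<times> D1" "F q = 0"
    and "\<And>q. q \<in> U \<Longrightarrow> cder H (H' q) q" "\<And>y. y \<in> U \<Longrightarrow> F y = 0 \<Longrightarrow> H y = 0"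
    and "F' q \<xi> = 0"
  shows "H' q \<xi> = 0"
proof (rule cder_zero_set[OF assms(1,2)])
  show "cder F (F' q) q" if "q \<in> U" for q using that assms F_der by blast
  show "F' q ((0,0),(1,0)) \<noteq> 0"
    using S_facts(1)[of q] assms by (auto simp: F'_def dvec_def)
qed (use assms in blast)+

lemma V_tangent: "F q = 0 \<Longrightarrow> bdot (N (fst q)) (V q) = 0"
  by (simp add: F_def bdot_commute)

text \<open>The chord is orthogonal to \<open>N\<close>; were it also orthogonal to both derivatives
  of \<open>N\<close>, it would vanish, as these three vectors are independent.\<close>

lemma dN_V_nonzero:
  assumes "q \<in> D0 \<times> D1" "F q = 0" "V q \<noteq> 0"
  shows "bdot (V q) (Pu N (fst q)) \<noteq> 0 \<or> bdot (V q) (Pv N (fst q)) \<noteq> 0"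
  using det3_orthogonal_zero[OF detN, of "fst q" "V q"] assms by (auto simp: F_def)

text \<open>The tangent direction of \<open>x\<close> conjugate to the chord.\<close>
definition \<delta> :: "cc \<Rightarrow> complex \<times> complex" where
  "\<delta> q = (bdot (V q) (Pv N (fst q)), - bdot (V q) (Pu N (fst q)))"

text \<open>Expand \<open>V \<times> (N\<^sub>u \<times> N\<^sub>v)\<close> and use that
  \<open>N\<^sub>u \<times> N\<^sub>v\<close> is a multiple of \<open>N\<close>.\<close>

lemma dN_\<delta>:
  assumes "q \<in> D0 \<times> D1" "F q = 0"
  shows "dvec N (fst q) (\<delta> q) = det3 (N (fst q)) (Pu N (fst q)) (Pv N (fst q)) *s cross3 (V q) (N (fst q))"
proof -
  have p: "fst q \<in> D0" using assms by auto
  have "dvec N (fst q) (\<delta> q) = cross3 (V q) (cross3 (Pu N (fst q)) (Pv N (fst q)))"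
    unfolding cross3_cross3 by (simp add: dvec_def \<delta>_def vec_eq_iff)
  then show ?thesis using normal_component[OF NN NNu NNv] p by simp
qed

lemma V_dN_\<delta> [simp]: "bdot (V q) (dvec N (fst q) (\<delta> q)) = 0"
  by (simp add: dvec_def \<delta>_def)

text \<open>To first order the point of \<open>x\<close> may thus move along
  \<open>\<delta> q\<close> within the tangency set while the point of \<open>y\<close> stays
  fixed.\<close>

lemma F'_\<delta> [simp]: "F' q (\<delta> q, (0,0)) = 0"
  by (simp add: F'_def)

text \<open>Two derivatives of the integrability condition, with the roles of pairing vector and
  direction exchanged, are subtracted; only terms with the second derivative of \<open>y\<close> in
  \<open>u\<close> survive.\<close>

lemma coplanar:
  assumes q: "q \<in> D0 \<times> D1" "F q = 0"
  shows "bdot (V q) (cross3 (Pu (Pu y) (snd q)) (Pu y (snd q))) = 0"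
proof (cases "V q = 0")
  case False
  have p: "fst q \<in> D0" "snd q \<in> D1" using q by auto
  \<comment> \<open>This choice of \<open>\<zeta>\<close> makes \<open>(\<zeta>, (1, 0))\<close>
    tangent to the tangency set.\<close>
  obtain \<zeta> where \<zeta>: "bdot (V q) (dvec N (fst q) \<zeta>) = - a q"
  proof -
    let ?e = "bdot (V q) (Pu N (fst q))" and ?f = "bdot (V q) (Pv N (fst q))"
    consider "?e \<noteq> 0" | "?f \<noteq> 0" using dN_V_nonzero[OF q False] by auto
    then show ?thesis
    proof cases
      case 1 then show ?thesis using that[of "(- a q / ?e, 0)"] by (simp add: dvec_def)
    next
      case 2 then show ?thesis using that[of "(0, - a q / ?f)"] by (simp add: dvec_def)
    qed
  qed
  let ?H = "\<lambda>k q. bdot (Pv y (snd q)) (N (fst q)) * bdot (Pu y (snd q)) k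
      + bdot (Pu y (snd q)) (N (fst q)) * bdot (Pv y (snd q)) k
      - bdot (Pu y (snd q)) (N (fst q)) * bdot (Pv y (snd q)) (N (fst q)) * (2 * bdot (N (fst q)) k)
      - bdot (Pu (Pv y) (snd q)) (N (fst q)) * bdot (V q) k"
  have H0: "?H k q = 0" if "q \<in> D0 \<times> D1" "F q = 0" for k q
    using S_facts(3)[OF that, of k] by (simp add: a_def b_def c_def algebra_simps)
  define H' where "H' k q \<xi> = 
       (bdot (dvec (Pv y) (snd q) (snd \<xi>)) (N (fst q)) + bdot (Pv y (snd q)) (dvec N (fst q) (fst \<xi>))) * bdot (Pu y (snd q)) k
     + b q * bdot (dvec (Pu y) (snd q) (snd \<xi>)) k
     + (bdot (dvec (Pu y) (snd q) (snd \<xi>)) (N (fst q)) + bdot (Pu y (snd q)) (dvec N (fst q) (fst \<xi>))) * bdot (Pv y (snd q)) k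
     + a q * bdot (dvec (Pv y) (snd q) (snd \<xi>)) k
     - ((bdot (dvec (Pu y) (snd q) (snd \<xi>)) (N (fst q)) + bdot (Pu y (snd q)) (dvec N (fst q) (fst \<xi>))) * b q
       + a q * (bdot (dvec (Pv y) (snd q) (snd \<xi>)) (N (fst q)) + bdot (Pv y (snd q)) (dvec N (fst q) (fst \<xi>)))) * (2 * bdot (N (fst q)) k)
     - 2 * a q * b q * bdot (dvec N (fst q) (fst \<xi>)) k
     - (bdot (dvec (Pu (Pv y)) (snd q) (snd \<xi>)) (N (fst q)) + bdot (Pu (Pv y) (snd q)) (dvec N (fst q) (fst \<xi>))) * bdot (V q) k
     - c q * (bdot (dvec y (snd q) (snd \<xi>)) k - bdot (dvec x (fst q) (fst \<xi>)) k)" for k q \<xi>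
  have Hd: "cder (?H k) (H' k q) q" if q: "q \<in> D0 \<times> D1" for k q
  proof (rule cder_eq[OF cder_diff[OF cder_diff[OF cder_add[OF
        cder_mult[OF cder_bdot[OF vders(4,2)] cder_bdot[OF vders(3) vder_const]]
        cder_mult[OF cder_bdot[OF vders(3,2)] cder_bdot[OF vders(4) vder_const]]]
        cder_mult[OF cder_mult[OF cder_bdot[OF vders(3,2)] cder_bdot[OF vders(4,2)]] 
           cder_mult[OF cder_const cder_bdot[OF vders(2) vder_const]]]]
        cder_mult[OF cder_bdot[OF vders(5,2)] cder_bdot[OF vders(1) vder_const]]]])
  qed (use q in \<open>auto simp: H'_def a_def b_def c_def algebra_simps\<close>)
  define dN where "dN = dvec N (fst q) (\<delta> q)"
  define ZN where "ZN = dvec N (fst q) \<zeta>"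
  define dX where "dX = dvec x (fst q) (\<delta> q)"
  define ZX where "ZX = dvec x (fst q) \<zeta>"
  \<comment> \<open>First derivative: pair with \<open>dN\<close>, move along
    \<open>(\<zeta>, (1, 0))\<close>. Second derivative: pair with \<open>ZN\<close>, move along
    \<open>(\<delta> q, (0, 0))\<close>.\<close>
  have e1: "H' dN q (\<zeta>, (1,0)) = 0"
    by (rule on_S[OF openD(3) q(1) order_refl q(2), where H = "?H dN"])
       (use Hd H0 \<zeta> in \<open>auto simp: F'_def\<close>)
  have e2: "H' ZN q (\<delta> q, (0,0)) = 0"
    by (rule on_S[OF openD(3) q(1) order_refl q(2), where H = "?H ZN"])
       (use Hd H0 in auto)
  have z: "bdot (N (fst q)) dN = 0" "bdot (N (fst q)) ZN = 0" "bdot (V q) dN = 0" "bdot (V q) ZN = - a q"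
    "bdot ZX dN = bdot dX ZN"
    using p \<zeta> dN_dx_sym by (auto simp: dN_def ZN_def ZX_def dX_def)
  have c: "bdot (Pv (Pu y) (snd q)) k = bdot (Pu (Pv y) (snd q)) k" for k
    using Pv_Pu_commute[OF hy p(2)] by simp
  \<comment> \<open>In the difference of \<open>e1\<close> and \<open>e2\<close> the terms symmetric
    in \<open>dN\<close> and \<open>ZN\<close> cancel, as do those with \<open>c q\<close> by
    \<open>bdot ZX dN = bdot dX ZN\<close>, and the mixed derivatives of \<open>y\<close> cancel by
    \<open>bdot (V q) ZN = - a q\<close>.\<close>
  have "bdot (Pu (Pu y) (snd q)) dN * b q + bdot (Pv y (snd q)) dN * bdot (Pu (Pu y) (snd q)) (N (fst q)) = 0"
    using e1 e2 z
    unfolding H'_def fst_conv snd_conv dN_def[symmetric] ZN_def[symmetric] dX_def[symmetric] ZX_def[symmetric]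
    unfolding dvec_def fst_conv snd_conv
    by (simp add: c_def[symmetric] bdot_commute[of dN ZN] algebra_simps) algebra
  moreover have "b q * bdot (Pu y (snd q)) dN + a q * bdot (Pv y (snd q)) dN = 0"
    using S_facts(3)[OF q, of dN] z by simp
  ultimately have "b q * (a q * bdot (Pu (Pu y) (snd q)) dN - bdot (Pu (Pu y) (snd q)) (N (fst q)) * bdot (Pu y (snd q)) dN) = 0"
    by algebra
  then have *: "a q * bdot (Pu (Pu y) (snd q)) dN = bdot (Pu (Pu y) (snd q)) (N (fst q)) * bdot (Pu y (snd q)) dN"
    using S_facts(2)[OF q] by simp
  let ?d = "det3 (N (fst q)) (Pu N (fst q)) (Pv N (fst q))"
  \<comment> \<open>The chord is, up to a nonzero factor, the cross product of \<open>dN\<close> and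
    \<open>N\<close>, so the relation just proved becomes a vanishing triple product.\<close>
  have "cross3 dN (N (fst q)) = ?d *s (- V q)"
    unfolding dN_def dN_\<delta>[OF q] cross3_linear cross3_cross3_left
    using NN[OF p(1)] V_tangent[OF q(2)] by (simp add: bdot_commute)
  then have "?d * bdot (V q) (cross3 (Pu (Pu y) (snd q)) (Pu y (snd q))) =
      - bdot (cross3 dN (N (fst q))) (cross3 (Pu (Pu y) (snd q)) (Pu y (snd q)))"
    by simp
  also have "\<dots> = 0"
    using * unfolding bdot_cross3_cross3 by (simp add: a_def bdot_commute algebra_simps)
  finally show ?thesis using detN[OF p(1)] by simp
qed simp

text \<open>If the chord vanished on the tangency set near \<open>q\<close>, then
  \<open>V q = 0\<close> would make every displacement of \<open>x\<close> tangent to that set, and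
  differentiating \<open>V\<close> would give a vanishing derivative of \<open>x\<close>.\<close>

lemma exists_V_nonzero:
  assumes U: "open U" "q \<in> U" "U \<subseteq> D0 \<times> D1" and Fq: "F q = 0"
  shows "\<exists>q\<in>U. F q = 0 \<and> V q \<noteq> 0"
proof (rule ccontr)
  assume "\<not> ?thesis"
  then have V0: "V q = 0" if "q \<in> U" "F q = 0" for q using that by blast
  have p: "fst q \<in> D0" using U by auto
  have "bdot (Pu x (fst q)) k = bdot 0 k" for k
  proof -
    let ?H' = "\<lambda>q \<xi>. bdot (V q) 0 + bdot (dvec y (snd q) (snd \<xi>) - dvec x (fst q) (fst \<xi>)) k"
    have "?H' q ((1,0),(0,0)) = 0"
    proof (rule on_S[OF U Fq, where H = "\<lambda>q. bdot (V q) k" and H' = ?H' and \<xi> = "((1,0),(0,0))"])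
      show "cder (\<lambda>q. bdot (V q) k) (?H' q) q" if "q \<in> U" for q
        using that U by (intro cder_bdot vders vder_const) auto
    qed (use U Fq V0 in \<open>auto simp: F'_def\<close>)
    then show ?thesis by (simp add: dvec_def)
  qed
  then have "Pu x (fst q) = 0" by (rule bdot_all_eqD)
  then show False using detx[OF p] by simp
qed

text \<open>For a nonzero chord some direction \<open>e\<close> in the parameters of
  \<open>x\<close> satisfies \<open>V \<cdot> dN(e) \<noteq> 0\<close>; the equation
  \<open>F = 0\<close> is solved for the displacement along \<open>e\<close>, with the point of
  \<open>y\<close> free.\<close>

lemma project_D1:
  assumes U: "open U" "q \<in> U" "U \<subseteq> D0 \<times> D1" and Fq: "F q = 0" and V: "V q \<noteq> 0"
  shows "\<exists>e>0. \<forall>p\<in>ball (snd q) e. \<exists>p0. (p0,p) \<in> U \<and> F (p0,p) = 0"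
proof -
  have q: "q \<in> D0 \<times> D1" using U by auto
  obtain e where e: "bdot (V q) (dvec N (fst q) e) \<noteq> 0"
  proof -
    consider "bdot (V q) (Pu N (fst q)) \<noteq> 0" | "bdot (V q) (Pv N (fst q)) \<noteq> 0"
      using dN_V_nonzero[OF q Fq V] by auto
    then show ?thesis
      by cases (use that[of "(1,0)"] that[of "(0,1)"] in \<open>auto simp: dvec_def\<close>)
  qed
  let ?J = "\<lambda>z. (fst q + (fst z * fst e, fst z * snd e), snd z)"
  let ?J' = "\<lambda>z. ((fst z * fst e, fst z * snd e), snd z)"
  have J: "(?J has_derivative ?J') (at z)" for z
    by (auto intro!: derivative_eq_intros)
  have Jc: "continuous_on A ?J" for A by (intro continuous_intros)
  have Jq: "?J (0, snd q) = q" by (simp add: zero_prod_def[symmetric])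
  let ?U = "?J -` U"
  have "\<exists>r>0. \<forall>p\<in>ball (snd q) r. \<exists>s. (s,p) \<in> ?U \<and> F (?J (s,p)) = 0"
  proof (rule solve_for_parameter)
    show "open ?U" by (rule open_vimage[OF U(1) Jc])
    have "continuous_on U F"
      using F_der U unfolding cder_def
      by (meson continuous_at_imp_continuous_on has_derivative_continuous subsetD)
    then show "continuous_on ?U (\<lambda>z. F (?J z))"
      by (rule continuous_on_compose2[OF _ Jc]) auto
    have "(F has_derivative F' q) (at (?J (0, snd q)))"
      using F_der[OF q] unfolding Jq cder_def by blast
    moreover have eq: "F' q \<circ> ?J' = (\<lambda>(h,k). bdot (V q) (dvec N (fst q) e) * h + (fst k * a q + snd k * b q))"
      by (auto simp: fun_eq_iff F'_def dvec_def algebra_simps)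
    ultimately have "(F \<circ> ?J has_derivative (\<lambda>(h,k). bdot (V q) (dvec N (fst q) e) * h + (fst k * a q + snd k * b q))) (at (0, snd q))"
      using diff_chain_at[OF J] by (simp only: eq[symmetric])
    then show "((\<lambda>z. F (?J z)) has_derivative (\<lambda>(h,k). bdot (V q) (dvec N (fst q) e) * h + (fst k * a q + snd k * b q))) (at (0, snd q))"
      by (simp only: o_def)
  qed (use U Jq Fq e in auto)
  then show ?thesis by fastforce
qed

text \<open>As \<open>a\<close> does not vanish, \<open>F = 0\<close> is solved for the first
  parameter of \<open>y\<close>, with its second parameter fixed and the point of \<open>x\<close>
  free.\<close>

lemma project_D0:
  assumes U: "open U" "q \<in> U" "U \<subseteq> D0 \<times> D1" and Fq: "F q = 0"
  shows "\<exists>e>0. \<forall>p\<in>ball (fst q) e. \<exists>p1. (p,p1) \<in> U \<and> F (p,p1) = 0"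
proof -
  have q: "q \<in> D0 \<times> D1" using U by auto
  let ?J = "\<lambda>z. (snd z, (fst z, snd (snd q)))"
  let ?J' = "\<lambda>z. (snd z, (fst z, 0))"
  have J: "(?J has_derivative ?J') (at z)" for z
    by (auto intro!: derivative_eq_intros)
  have Jc: "continuous_on A ?J" for A by (intro continuous_intros)
  have Jq: "?J (fst (snd q), fst q) = q" by simp
  let ?U = "?J -` U"
  have "\<exists>r>0. \<forall>p\<in>ball (fst q) r. \<exists>s. (s,p) \<in> ?U \<and> F (?J (s,p)) = 0"
  proof (rule solve_for_parameter)
    show "open ?U" by (rule open_vimage[OF U(1) Jc])
    have "continuous_on U F"
      using F_der U unfolding cder_def
      by (meson continuous_at_imp_continuous_on has_derivative_continuous subsetD)
    then show "continuous_on ?U (\<lambda>z. F (?J z))"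
      by (rule continuous_on_compose2[OF _ Jc]) auto
    have "(F has_derivative F' q) (at (?J (fst (snd q), fst q)))"
      using F_der[OF q] unfolding Jq cder_def by blast
    moreover have eq: "F' q \<circ> ?J' = (\<lambda>(h,k). a q * h + bdot (V q) (dvec N (fst q) k))"
      by (auto simp: fun_eq_iff F'_def algebra_simps)
    ultimately have "(F \<circ> ?J has_derivative (\<lambda>(h,k). a q * h + bdot (V q) (dvec N (fst q) k))) (at (fst (snd q), fst q))"
      using diff_chain_at[OF J] by (simp only: eq[symmetric])
    then show "((\<lambda>z. F (?J z)) has_derivative (\<lambda>(h,k). a q * h + bdot (V q) (dvec N (fst q) k))) (at (fst (snd q), fst q))"
      by (simp only: o_def)
  qed (use U Jq Fq S_facts(1)[OF q Fq] in auto)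
  then show ?thesis by fastforce
qed

lemma ruled_u:
  assumes "p \<in> D1" shows "cross3 (Pu (Pu y) p) (Pu y p) = 0"
proof (rule ccontr)
  assume m0: "cross3 (Pu (Pu y) p) (Pu y p) \<noteq> 0"
  define m where "m p = cross3 (Pu (Pu y) p) (Pu y p)" for p
  have hm: "holov D1 m" unfolding m_def[abs_def] by (intro holov_cross3 holov_Pu hy)
  define U0 where "U0 = {q \<in> D0 \<times> D1. V q \<noteq> 0}"
  define U where "U = {q \<in> D0 \<times> D1. m (snd q) \<noteq> 0 \<and> V q \<noteq> 0}"
  have contV: "continuous_on (D0 \<times> D1) V"
    using vders(1) unfolding vder_def
    by (meson continuous_at_imp_continuous_on has_derivative_continuous)
  have contm: "continuous_on (D0 \<times> D1) (\<lambda>q. m (snd q))"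
  proof (rule continuous_at_imp_continuous_on, rule ballI)
    fix q assume "q \<in> D0 \<times> D1"
    then have "snd q \<in> D1" by auto
    then show "isCont (\<lambda>q. m (snd q)) q"
      using vder_snd[OF hm] has_derivative_continuous unfolding vder_def by blast
  qed
  have oU0: "open U0"
  proof -
    have "U0 = (D0 \<times> D1) \<inter> V -` (- {0})" by (auto simp: U0_def)
    then show ?thesis using contV openD(3) by (auto intro: continuous_open_preimage)
  qed
  have oU: "open U"
  proof -
    have "U = U0 \<inter> ((D0 \<times> D1) \<inter> (\<lambda>q. m (snd q)) -` (- {0}))" by (auto simp: U0_def U_def)
    moreover have "open ((D0 \<times> D1) \<inter> (\<lambda>q. m (snd q)) -` (- {0}))"
      using contm openD(3) by (rule continuous_open_preimage) auto
    ultimately show ?thesis using oU0 by (simp add: open_Int)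
  qed
  have US: "U0 \<subseteq> D0 \<times> D1" "U \<subseteq> D0 \<times> D1" by (auto simp: U0_def U_def)
  \<comment> \<open>Otherwise \<open>m\<close> vanishes wherever a nonzero chord exists; such points
    of \<open>y\<close> fill a ball by \<open>project_D1\<close>, and the identity theorem
    propagates \<open>m = 0\<close> to \<open>D1\<close>.\<close>
  have "\<exists>q\<in>U. F q = 0"
  proof (rule ccontr)
    assume non: "\<not> ?thesis"
    obtain q0 where "q0 \<in> D0 \<times> D1" "F q0 = 0" using S_ex by (force simp: F_def V_def)
    then obtain q1 where q1: "q1 \<in> U0" "F q1 = 0"
      using exists_V_nonzero[OF openD(3) _ order_refl] unfolding U0_def by blast
    then have "V q1 \<noteq> 0" by (simp add: U0_def)
    then obtain e where e: "e > 0" "\<forall>p\<in>ball (snd q1) e. \<exists>p0. (p0,p) \<in> U0 \<and> F (p0,p) = 0"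
      using project_D1[OF oU0 q1(1) US(1) q1(2)] by blast
    have z: "p \<in> D1" "m p = 0" if pb: "p \<in> ball (snd q1) e" for p
    proof -
      obtain p0 where p0: "(p0,p) \<in> U0" "F (p0,p) = 0" using e(2) pb by blast
      then show "p \<in> D1" by (auto simp: U0_def)
      have "(p0,p) \<notin> U" using non p0(2) by blast
      then show "m p = 0" using p0(1) by (simp add: U_def U0_def)
    qed
    have "m p $ i = 0" for i
    proof (rule sep_holo_identity[of D1 "\<lambda>p. m p $ i" "ball (snd q1) e"])
      show "sep_holo D1 (\<lambda>p. m p $ i)" using hm by (simp add: holov_def)
    qed (use D1 z e assms in auto)
    then show False using m0 by (simp add: m_def vec_eq_iff)
  qed
  then obtain q where q: "q \<in> U" "F q = 0" by blast
  have UD: "q \<in> D0 \<times> D1" "fst q \<in> D0" "snd q \<in> D1" "V q \<noteq> 0" "m (snd q) \<noteq> 0" if "q \<in> U" for q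
    using that by (auto simp: U_def)
  \<comment> \<open>A linear map with values in the tangent plane of \<open>x\<close>. At the chord
    it gives the displacement of \<open>x\<close> along \<open>\<delta>\<close>; its linearity in
    \<open>v\<close> permits polarisation in \<open>ii\<close>.\<close>
  define L where "L q v = bdot v (Pv N (fst q)) *s Pu x (fst q) - bdot v (Pu N (fst q)) *s Pv x (fst q)"
    for q :: cc and v
  have L: "dvec x (fst q) (\<delta> q) = L q (V q)" for q
    by (simp add: dvec_def \<delta>_def L_def vec_eq_iff)
  have LN: "bdot (N (fst q)) (L q v) = 0" if "q \<in> U" for q v
    using Nxu Nxv UD[OF that] by (simp add: L_def)
  text \<open>The chord is an asymptotic direction: otherwise it spans the tangent plane of \<open>x\<close> together
    with its conjugate direction, and \<open>m\<close>, orthogonal to both, would be normal to \<open>x\<close>.\<close>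
  have i: "cross3 (V q) (L q (V q)) = 0" if q: "q \<in> U" "F q = 0" for q
  proof -
    note D = UD[OF q(1)]
    let ?H' = "\<lambda>q \<xi>. bdot (V q) (dvec m (snd q) (snd \<xi>)) + bdot (dvec y (snd q) (snd \<xi>) - dvec x (fst q) (fst \<xi>)) (m (snd q))"
    have "?H' q (\<delta> q,(0,0)) = 0"
    proof (rule on_S[OF openD(3) D(1) order_refl q(2), where H = "\<lambda>q. bdot (V q) (m (snd q))"
        and H' = ?H' and \<xi> = "(\<delta> q,(0,0))"])
      show "cder (\<lambda>q. bdot (V q) (m (snd q))) (?H' q) q" if "q \<in> D0 \<times> D1" for q
        using that by (intro cder_bdot vders vder_snd[OF hm]) auto
      show "bdot (V q) (m (snd q)) = 0" if "q \<in> D0 \<times> D1" "F q = 0" for q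
        using coplanar[OF that] by (simp add: m_def)
    qed simp
    then have 1: "bdot (m (snd q)) (L q (V q)) = 0"
      by (simp add: dvec_def[of _ _ "(0,0)"] L bdot_commute)
    have 2: "bdot (m (snd q)) (V q) = 0" using coplanar[OF D(1) q(2)] by (simp add: m_def bdot_commute)
    have n: "cross3 (V q) (L q (V q)) = det3 (N (fst q)) (V q) (L q (V q)) *s N (fst q)"
      using NN D V_tangent q LN by (intro normal_component) auto
    have "cross3 (m (snd q)) (cross3 (V q) (L q (V q))) = 0"
      using 1 2 by (simp add: cross3_cross3)
    then have or: "det3 (N (fst q)) (V q) (L q (V q)) = 0 \<or> cross3 (m (snd q)) (N (fst q)) = 0"
      unfolding n by simp
    have "cross3 (m (snd q)) (N (fst q)) \<noteq> 0"
    proof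
      assume "cross3 (m (snd q)) (N (fst q)) = 0"
      then have "cross3 (N (fst q)) (m (snd q)) = 0" by (simp add: cross3_skew(1)[of "N (fst q)"])
      moreover have "N (fst q) \<noteq> 0" using NN[OF D(2)] by auto
      ultimately obtain k where k: "m (snd q) = k *s N (fst q)" using cross3_zero_parallel by blast
      have "bdot (m (snd q)) (Pu y (snd q)) = 0"
        by (simp add: m_def bdot_3 algebra_simps)
      then have "k = 0" using k S_facts(1)[OF D(1) q(2)] by (simp add: a_def bdot_commute)
      then show False using k D(5) by simp
    qed
    then show ?thesis using or n by simp
  qed
  \<comment> \<open>The chord is an eigenvector with nonzero eigenvalue:
    \<open>L q (V q) = 0\<close> would make the chord orthogonal to both derivatives of
    \<open>N\<close>.\<close>
  have i': "\<exists>k. k \<noteq> 0 \<and> L q (V q) = k *s V q" if q: "q \<in> U" "F q = 0" for q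
  proof -
    note D = UD[OF q(1)]
    obtain k where k: "L q (V q) = k *s V q" using cross3_zero_parallel[OF i[OF q] D(4)] by blast
    have "k \<noteq> 0"
    proof
      assume "k = 0"
      then have "det3 (N (fst q)) (L q (V q)) (Pu x (fst q)) = 0" "det3 (N (fst q)) (L q (V q)) (Pv x (fst q)) = 0"
        using k by simp_all
      then have "bdot (V q) (Pv N (fst q)) = 0" "bdot (V q) (Pu N (fst q)) = 0"
        using detx[OF D(2)] det3_perm(2)[of "N (fst q)" "Pv x (fst q)" "Pu x (fst q)"] by (simp_all add: L_def)
      then show False using dN_V_nonzero[OF D(1) q(2) D(4)] by simp
    qed
    then show ?thesis using k by blast
  qed
  \<comment> \<open>The asymptotic condition is differentiated with \<open>x\<close> fixed and
    \<open>y\<close> moving by \<open>t\<close>, its tangent vector orthogonal to \<open>N\<close>.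
    Hence \<open>t\<close> is parallel to the chord, and together with the integrability condition
    so is the tangential part of \<open>Pu y\<close>.\<close>
  have ii: "det3 (N (fst q)) (Pu y (snd q)) (V q) = 0" if q: "q \<in> U" "F q = 0" for q
  proof -
    note D = UD[OF q(1)]
    define t where "t = dvec y (snd q) (b q, - a q)"
    have tN: "bdot (N (fst q)) t = 0" by (simp add: t_def dvec_def a_def b_def bdot_commute[of "N (fst q)"])
    let ?H' = "\<lambda>q \<xi>. det3 (dvec N (fst q) (fst \<xi>)) (V q) (L q (V q)) +
        det3 (N (fst q)) (dvec y (snd q) (snd \<xi>) - dvec x (fst q) (fst \<xi>)) (L q (V q)) +
        det3 (N (fst q)) (V q)
           ((bdot (V q) (Pv N (fst q)) *s dvec (Pu x) (fst q) (fst \<xi>) +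
            (bdot (V q) (dvec (Pv N) (fst q) (fst \<xi>)) + bdot (dvec y (snd q) (snd \<xi>) - dvec x (fst q) (fst \<xi>)) (Pv N (fst q))) *s Pu x (fst q)) -
           (bdot (V q) (Pu N (fst q)) *s dvec (Pv x) (fst q) (fst \<xi>) +
            (bdot (V q) (dvec (Pu N) (fst q) (fst \<xi>)) + bdot (dvec y (snd q) (snd \<xi>) - dvec x (fst q) (fst \<xi>)) (Pu N (fst q))) *s Pv x (fst q)))"
    have "?H' q ((0,0),(b q, - a q)) = 0"
    proof (rule on_S[OF oU q(1) US(2) q(2), where H = "\<lambda>q. det3 (N (fst q)) (V q) (L q (V q))"
        and H' = ?H' and \<xi> = "((0,0),(b q, - a q))"])
      show "cder (\<lambda>q. det3 (N (fst q)) (V q) (L q (V q))) (?H' q) q" if "q \<in> U" for q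
        unfolding L_def using UD(1)[OF that]
        by (intro cder_det3 vder_diff vder_smult cder_bdot vders)
      show "det3 (N (fst q)) (V q) (L q (V q)) = 0" if "q \<in> U" "F q = 0" for q
        using i[OF that] by (simp add: det3_def)
    qed (simp add: F'_def dvec_def)
    then have 1: "det3 (N (fst q)) t (L q (V q)) + det3 (N (fst q)) (V q) (L q t) = 0"
      by (simp add: t_def[symmetric] dvec_def[of _ _ "(0,0)"] L_def)
    \<comment> \<open>The form \<open>det3 N v (L w)\<close> on the tangent plane is a multiple of
      the second fundamental form, hence symmetric.\<close>
    have sym: "det3 (N (fst q)) (V q) (L q t) = det3 (N (fst q)) t (L q (V q))"
    proof -
      obtain \<alpha> \<beta> where 1: "V q = \<alpha> *s Pu x (fst q) + \<beta> *s Pv x (fst q)"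
        using tangent_basis[OF NN Nxu Nxv detx V_tangent[OF q(2)]] D(2) by blast
      obtain \<alpha>' \<beta>' where 2: "t = \<alpha>' *s Pu x (fst q) + \<beta>' *s Pv x (fst q)"
        using tangent_basis[OF NN Nxu Nxv detx tN] D(2) by blast
      show ?thesis
        unfolding 1 2 L_def using II_sym[OF D(2)] det3_perm(2)[of "N (fst q)" "Pv x (fst q)" "Pu x (fst q)"]
        by (simp add: algebra_simps)
    qed
    have "det3 (N (fst q)) t (L q (V q)) = 0" using 1 sym by simp
    then have "det3 (N (fst q)) t (V q) = 0" using i'[OF q] by auto
    then have 2: "b q * det3 (N (fst q)) (Pu y (snd q)) (V q) - a q * det3 (N (fst q)) (Pv y (snd q)) (V q) = 0"
      by (simp add: t_def dvec_def)
    have "bdot z (cross3 (V q) (N (fst q))) = det3 (N (fst q)) z (V q)" for z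
      using det3_perm(1) by (simp add: det3_def)
    then have "b q * det3 (N (fst q)) (Pu y (snd q)) (V q) + a q * det3 (N (fst q)) (Pv y (snd q)) (V q) = 0"
      using S_facts(3)[OF D(1) q(2), of "cross3 (V q) (N (fst q))"] by simp
    then have "2 * b q * det3 (N (fst q)) (Pu y (snd q)) (V q) = 0" using 2 by algebra
    then show ?thesis using S_facts(2)[OF D(1) q(2)] by simp
  qed
  \<comment> \<open>Differentiation of \<open>ii\<close> along \<open>\<delta> q\<close>: the chord
    changes by a multiple of itself, so only the derivative of \<open>N\<close> contributes, and it
    is proportional to \<open>V \<times> N\<close>.\<close>
  have iii: "bdot (V q) (V q) = 0" if q: "q \<in> U" "F q = 0" for q
  proof -
    note D = UD[OF q(1)]
    let ?H' = "\<lambda>q \<xi>. det3 (dvec N (fst q) (fst \<xi>)) (Pu y (snd q)) (V q) +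
        det3 (N (fst q)) (dvec (Pu y) (snd q) (snd \<xi>)) (V q) +
        det3 (N (fst q)) (Pu y (snd q)) (dvec y (snd q) (snd \<xi>) - dvec x (fst q) (fst \<xi>))"
    have "?H' q (\<delta> q,(0,0)) = 0"
    proof (rule on_S[OF oU q(1) US(2) q(2), where H = "\<lambda>q. det3 (N (fst q)) (Pu y (snd q)) (V q)"
        and H' = ?H' and \<xi> = "(\<delta> q,(0,0))"])
      show "cder (\<lambda>q. det3 (N (fst q)) (Pu y (snd q)) (V q)) (?H' q) q" if "q \<in> U" for q
        using UD(1)[OF that] by (intro cder_det3 vders)
    qed (use ii in auto)
    moreover obtain k where "L q (V q) = k *s V q" using i'[OF q] by blast
    ultimately have "det3 (dvec N (fst q) (\<delta> q)) (Pu y (snd q)) (V q) = 0"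
      using ii[OF q] by (simp add: dvec_def[of _ _ "(0,0)"] L)
    then have "det3 (cross3 (V q) (N (fst q))) (Pu y (snd q)) (V q) = 0"
      using dN_\<delta>[OF D(1) q(2)] detN[OF D(2)] by simp
    then have "a q * bdot (V q) (V q) = 0"
      unfolding det3_def bdot_cross3_cross3 using V_tangent[OF q(2)]
      by (auto simp: a_def bdot_commute)
    then show ?thesis using S_facts(1)[OF D(1) q(2)] by simp
  qed
  note D = UD[OF q(1)]
  \<comment> \<open>By \<open>ii\<close>, \<open>Pu y\<close> is a combination of \<open>N\<close>
    and the chord, both orthogonal to the isotropic chord.\<close>
  have yuV: "bdot (V q) (Pu y (snd q)) = 0"
  proof -
    have "det3 (N (fst q)) (V q) (Pu y (snd q) - a q *s N (fst q)) = 0"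
      using ii[OF q] det3_perm(2)[of "N (fst q)" "V q"] by simp
    moreover have "bdot (N (fst q)) (Pu y (snd q) - a q *s N (fst q)) = 0"
      using NN[OF D(2)] by (simp add: a_def bdot_commute)
    ultimately obtain k where "Pu y (snd q) - a q *s N (fst q) = k *s V q"
      using tangent_parallel[OF NN[OF D(2)] V_tangent[OF q(2)]] D(4) by blast
    then have "bdot (V q) (Pu y (snd q) - a q *s N (fst q)) = k * bdot (V q) (V q)" by simp
    then show ?thesis using iii[OF q] V_tangent[OF q(2)] by (simp add: bdot_commute)
  qed
  \<comment> \<open>Differentiate \<open>V \<cdot> V = 0\<close> along an arbitrary displacement
    \<open>\<zeta>\<close> of \<open>x\<close>, corrected by the multiple \<open>h\<close> of the
    first direction of \<open>y\<close> that keeps it tangent to \<open>F = 0\<close>.\<close>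
  have "bdot (V q) (dvec x (fst q) \<zeta>) = 0" for \<zeta>
  proof -
    define h where "h = - bdot (V q) (dvec N (fst q) \<zeta>) / a q"
    let ?H' = "\<lambda>q \<xi>. bdot (V q) (dvec y (snd q) (snd \<xi>) - dvec x (fst q) (fst \<xi>)) +
        bdot (dvec y (snd q) (snd \<xi>) - dvec x (fst q) (fst \<xi>)) (V q)"
    have "?H' q (\<zeta>,(h,0)) = 0"
    proof (rule on_S[OF oU q(1) US(2) q(2), where H = "\<lambda>q. bdot (V q) (V q)"
        and H' = ?H' and \<xi> = "(\<zeta>,(h,0))"])
      show "cder (\<lambda>q. bdot (V q) (V q)) (?H' q) q" if "q \<in> U" for q
        using UD(1)[OF that] by (intro cder_bdot vders)
      show "F' q (\<zeta>,(h,0)) = 0" using S_facts(1)[OF D(1) q(2)] by (simp add: F'_def h_def)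
    qed (use iii in auto)
    then show ?thesis
      using yuV by (simp add: bdot_commute[of _ "V q"] dvec_def[of y])
  qed
  from this[of "(1,0)"] this[of "(0,1)"]
  have "bdot (V q) (Pu x (fst q)) = 0" "bdot (V q) (Pv x (fst q)) = 0" by (simp_all add: dvec_def)
  then have "V q = 0"
    using det3_orthogonal_zero[OF detx[OF D(2)]] q(2) by (simp add: F_def)
  then show False using D(4) by simp
qed

text \<open>The hypotheses are symmetric in the two parameters of \<open>y\<close>, up to the sign
  of \<open>cross3\<close> and equality of mixed partials; this transfers \<open>ruled_u\<close> to
  the other family.\<close>

lemma swapped: "tangential_pair x N (y \<circ> prod.swap) D0 (prod.swap ` D1)"
proof
  show "holov (prod.swap ` D1) (y \<circ> prod.swap)" by (rule holov_swap[OF hy])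
  show "connected (prod.swap ` D1)" by (rule connected_continuous_image[OF continuous_on_swap D1])
  show "cross3 (Pu (y \<circ> prod.swap) p) (Pv (y \<circ> prod.swap) p) \<noteq> 0" if "p \<in> prod.swap ` D1" for p
  proof -
    have "prod.swap p \<in> D1" using that by auto
    from reg[OF this] show ?thesis
      using cross3_skew(1)[of "Pv y (prod.swap p)" "Pu y (prod.swap p)"] by (simp add: Pu_swap Pv_swap)
  qed
  show "\<exists>p\<in>D0. \<exists>p'\<in>prod.swap ` D1. bdot ((y \<circ> prod.swap) p' - x p) (N p) = 0"
    using S_ex by fastforce
  fix p p' assume p: "p \<in> D0" "p' \<in> prod.swap ` D1" "bdot ((y \<circ> prod.swap) p' - x p) (N p) = 0"
  then have p': "prod.swap p' \<in> D1" "bdot (y (prod.swap p') - x p) (N p) = 0" by auto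
  show "bdot (Pu (y \<circ> prod.swap) p') (N p) \<noteq> 0 \<and> bdot (Pv (y \<circ> prod.swap) p') (N p) \<noteq> 0"
    using S_nondeg[OF p(1) p'] by (simp add: Pu_swap Pv_swap)
  show "bdot (Pv (y \<circ> prod.swap) p') (N p) *s Pu (y \<circ> prod.swap) p' + bdot (Pu (y \<circ> prod.swap) p') (N p) *s Pv (y \<circ> prod.swap) p'
        - (2 * bdot (Pu (y \<circ> prod.swap) p') (N p) * bdot (Pv (y \<circ> prod.swap) p') (N p)) *s N p
      = bdot (Pu (Pv (y \<circ> prod.swap)) p') (N p) *s ((y \<circ> prod.swap) p' - x p)"
    using integrable[OF p(1) p'] Pv_Pu_commute[OF hy p'(1)]
    by (simp add: Pu_swap Pv_swap add.commute mult.commute mult.left_commute)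
qed (use hx hN D0 NN Nxu Nxv NNu NNv II_sym II_nondeg in auto)

lemma ruled_v:
  assumes "p \<in> D1" shows "cross3 (Pv (Pv y) p) (Pv y p) = 0"
  using tangential_pair.ruled_u[OF swapped, of "prod.swap p"] assms by (simp add: Pu_swap)

lemma ruled_scalars:
  assumes "p \<in> D1"
  obtains \<rho> \<sigma> where "Pu (Pu y) p = \<rho> *s Pu y p" "Pv (Pv y) p = \<sigma> *s Pv y p"
proof -
  have "Pu y p \<noteq> 0" "Pv y p \<noteq> 0" using reg[OF assms] by auto
  moreover have "cross3 (Pu y p) (Pu (Pu y) p) = 0" "cross3 (Pv y p) (Pv (Pv y) p) = 0"
    using ruled_u[OF assms] ruled_v[OF assms] cross3_skew(1) by (metis neg_0_equal_iff_equal)+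
  ultimately show ?thesis using that cross3_zero_parallel by metis
qed

section \<open>The product \<open>a b\<close> depends only on the point of \<open>y\<close>\<close>

definition K' :: "cc \<Rightarrow> cc \<Rightarrow> complex" where
  "K' q \<xi> = a q * (bdot (Pv y (snd q)) (dvec N (fst q) (fst \<xi>)) + bdot (dvec (Pv y) (snd q) (snd \<xi>)) (N (fst q)))
     + (bdot (Pu y (snd q)) (dvec N (fst q) (fst \<xi>)) + bdot (dvec (Pu y) (snd q) (snd \<xi>)) (N (fst q))) * b q"

lemma K_der: "q \<in> D0 \<times> D1 \<Longrightarrow> cder (\<lambda>q. a q * b q) (K' q) q"
  unfolding a_def[abs_def] b_def[abs_def]
  by (rule cder_eq[OF cder_mult[OF cder_bdot[OF vders(3,2)] cder_bdot[OF vders(4,2)]]])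
     (auto simp: K'_def a_def b_def)

text \<open>The integrability condition turns the \<open>dN\<close> terms into
  \<open>c (V \<cdot> dN)\<close>, and tangency replaces \<open>V \<cdot> dN\<close> by
  \<open>- (a du + b dv)\<close>; this cancels the terms from the mixed derivative of
  \<open>y\<close>.\<close>

lemma K'_on_S:
  assumes q: "q \<in> D0 \<times> D1" "F q = 0" and \<xi>: "F' q \<xi> = 0"
    and \<rho>: "Pu (Pu y) (snd q) = \<rho> *s Pu y (snd q)" "Pv (Pv y) (snd q) = \<sigma> *s Pv y (snd q)"
  shows "K' q \<xi> = \<rho> * (a q * b q) * fst (snd \<xi>) + \<sigma> * (a q * b q) * snd (snd \<xi>)"
proof -
  have p: "fst q \<in> D0" "snd q \<in> D1" using q by auto
  define dN where "dN = dvec N (fst q) (fst \<xi>)"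
  have "bdot (N (fst q)) dN = 0" using p by (simp add: dN_def)
  then have 1: "b q * bdot (Pu y (snd q)) dN + a q * bdot (Pv y (snd q)) dN = c q * bdot (V q) dN"
    using S_facts(3)[OF q, of dN] by simp
  have 2: "bdot (V q) dN + fst (snd \<xi>) * a q + snd (snd \<xi>) * b q = 0"
    using \<xi> by (simp add: F'_def dN_def)
  have 3: "bdot (dvec (Pv y) (snd q) (snd \<xi>)) (N (fst q)) = fst (snd \<xi>) * c q + snd (snd \<xi>) * (\<sigma> * b q)"
    "bdot (dvec (Pu y) (snd q) (snd \<xi>)) (N (fst q)) = fst (snd \<xi>) * (\<rho> * a q) + snd (snd \<xi>) * c q"
    using Pv_Pu_commute[OF hy p(2)] \<rho> by (simp_all add: dvec_def c_def a_def b_def)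
  show ?thesis
    unfolding K'_def dN_def[symmetric] 3 using 1 2 by algebra
qed

text \<open>Near a point with nonzero chord the tangency set is a graph over one parameter of
  \<open>x\<close> and both parameters of \<open>y\<close>. By \<open>K'_on_S\<close> the product
  \<open>a b\<close> is constant in the former, and its logarithmic derivatives in the latter are
  the factors of \<open>ruled_scalars\<close>.\<close>

lemma first_integral:
  obtains qs U r g where "qs \<in> D0 \<times> D1" "F qs = 0" "open U" "qs \<in> U" "U \<subseteq> D0 \<times> D1" "r > 0"
    "ball (snd qs) r \<subseteq> D1" "sep_holo (ball (snd qs) r) g"
    "\<And>p. p \<in> ball (snd qs) r \<Longrightarrow> g p \<noteq> 0"
    "\<And>p. p \<in> ball (snd qs) r \<Longrightarrow> Pu (Pu y) p = (Du g p / g p) *s Pu y p"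
    "\<And>p. p \<in> ball (snd qs) r \<Longrightarrow> Pv (Pv y) p = (Dv g p / g p) *s Pv y p"
    "\<And>q. q \<in> U \<Longrightarrow> snd q \<in> ball (snd qs) r"
    "\<And>q. q \<in> U \<Longrightarrow> F q = 0 \<Longrightarrow> a q * b q = g (snd q)"
proof -
  obtain q0 where "q0 \<in> D0 \<times> D1" "F q0 = 0" using S_ex by (force simp: F_def V_def)
  then obtain qs where qs: "qs \<in> D0 \<times> D1" "F qs = 0" "V qs \<noteq> 0"
    using exists_V_nonzero[OF openD(3) _ order_refl] by blast
  \<comment> \<open>The two coordinate directions of \<open>x\<close>, ordered so that
    \<open>F\<close> has a nonzero derivative along \<open>e\<close>.\<close>
  obtain e e' :: "complex \<times> complex" where ee: "(e = (1,0) \<and> e' = (0,1)) \<or> (e = (0,1) \<and> e' = (1,0))"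
    and e: "bdot (V qs) (dvec N (fst qs) e) \<noteq> 0"
  proof -
    consider "bdot (V qs) (Pu N (fst qs)) \<noteq> 0" | "bdot (V qs) (Pv N (fst qs)) \<noteq> 0"
      using dN_V_nonzero[OF qs] by auto
    then show ?thesis
      by cases (use that[of "(1,0)" "(0,1)"] that[of "(0,1)" "(1,0)"] in \<open>auto simp: dvec_def\<close>)
  qed
  \<comment> \<open>\<open>J\<close> places the displacement along \<open>e\<close> first, as the
    unknown of the implicit function theorem; \<open>I\<close> is its inverse.\<close>
  define J where "J z = ((fst (fst qs) + (fst z * fst e + fst (snd z) * fst e'),
      snd (fst qs) + (fst z * snd e + fst (snd z) * snd e')), snd (snd z))" for z :: "complex \<times> complex \<times> complex \<times> complex"
  define J' where "J' z = ((fst z * fst e + fst (snd z) * fst e',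
      fst z * snd e + fst (snd z) * snd e'), snd (snd z))" for z :: "complex \<times> complex \<times> complex \<times> complex"
  define I where "I q = ((fst (fst q) - fst (fst qs)) * fst e + (snd (fst q) - snd (fst qs)) * snd e,
      (fst (fst q) - fst (fst qs)) * fst e' + (snd (fst q) - snd (fst qs)) * snd e', snd q)" for q :: cc
  have JI: "J (I q) = q" for q using ee by (auto simp: J_def I_def)
  have Jd: "(J has_derivative J') (at z)" for z
    unfolding J_def[abs_def] J'_def[abs_def] by (auto intro!: derivative_eq_intros)
  have Jc: "continuous_on A J" for A unfolding J_def by (intro continuous_intros)
  have Ic: "continuous_on A I" for A unfolding I_def by (intro continuous_intros)
  have Iqs: "I qs = (0, 0, snd qs)" by (simp add: I_def)
  let ?W = "J -` (D0 \<times> D1)"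
  have oW: "open ?W" by (rule open_vimage[OF openD(3) Jc])
  have inW: "(0, 0, snd qs) \<in> ?W" using JI[of qs] qs by (simp add: Iqs)
  let ?a = "\<lambda>z. bdot (V (J z)) (dvec N (fst (J z)) e)"
  let ?A = "\<lambda>z k. F' (J z) (J' (0, k))"
  have Fd: "((\<lambda>z. F (J z)) has_derivative (\<lambda>(h,k). ?a z * h + ?A z k)) (at z)" if z: "z \<in> ?W" for z
  proof -
    have "(F has_derivative F' (J z)) (at (J z))" using F_der[of "J z"] z unfolding cder_def by blast
    from diff_chain_at[OF Jd this] have 1: "(F \<circ> J has_derivative F' (J z) \<circ> J') (at z)" .
    have "F' (J z) \<circ> J' = (\<lambda>(h,k). ?a z * h + ?A z k)"
      by (auto simp: fun_eq_iff F'_def J'_def dvec_def algebra_simps)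
    then show ?thesis using 1 by (simp add: o_def)
  qed
  have ac: "continuous_on ?W ?a"
  proof (rule continuous_on_compose2[OF _ Jc])
    have eq: "bdot (V q) (dvec N (fst q) e) = bdot (V q) (Pu N (fst q)) * fst e + bdot (V q) (Pv N (fst q)) * snd e" for q
      by (simp add: dvec_def)
    show "continuous_on (D0 \<times> D1) (\<lambda>q. bdot (V q) (dvec N (fst q) e))"
      unfolding eq
      by (intro continuous_intros cder_continuous) (use cder_bdot[OF vders(1,6)] cder_bdot[OF vders(1,7)] in blast)+
  qed auto
  obtain \<epsilon> d \<psi> where \<epsilon>: "\<epsilon> > 0" "d > 0" "ball 0 \<epsilon> \<times> ball (0, snd qs) d \<subseteq> ?W"
    and \<psi>: "\<And>z. z \<in> ball (0, snd qs) d \<Longrightarrow> \<psi> z \<in> ball 0 \<epsilon> \<and> F (J (\<psi> z, z)) = 0"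
    and uniq: "\<And>s z. s \<in> ball 0 \<epsilon> \<Longrightarrow> z \<in> ball (0, snd qs) d \<Longrightarrow> F (J (s, z)) = 0 \<Longrightarrow> s = \<psi> z"
    and d\<psi>: "\<And>z. z \<in> ball (0, snd qs) d \<Longrightarrow> (\<psi> has_derivative (\<lambda>k. - ?A (\<psi> z, z) k / ?a (\<psi> z, z))) (at z)"
  proof (rule implicit_function[of ?W 0 "(0, snd qs)" "\<lambda>z. F (J z)" ?a ?A])
    show "?a (0, 0, snd qs) \<noteq> 0" using e JI[of qs] by (simp add: Iqs)
    show "F (J (0, 0, snd qs)) = 0" using qs JI[of qs] by (simp add: Iqs)
  qed (use oW inW Fd ac in blast)+
  \<comment> \<open>The product \<open>a b\<close> read off on the graph of
    \<open>\<psi>\<close>.\<close>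
  define k where "k z = a (J (\<psi> z, z)) * b (J (\<psi> z, z))" for z
  have JW: "J (\<psi> z, z) \<in> D0 \<times> D1" "F (J (\<psi> z, z)) = 0" if "z \<in> ball (0, snd qs) d" for z
    using \<psi>[OF that] \<epsilon>(3) that by blast+
  have sndJ: "snd (J (s, z)) = snd z" for s z by (simp add: J_def)
  have kd: "(k has_derivative (\<lambda>h. \<rho> * k z * fst (snd h) + \<sigma> * k z * snd (snd h))) (at z)"
    if z: "z \<in> ball (0, snd qs) d"
      and \<rho>: "Pu (Pu y) (snd z) = \<rho> *s Pu y (snd z)" "Pv (Pv y) (snd z) = \<sigma> *s Pv y (snd z)"
    for z \<rho> \<sigma>
  proof -
    let ?q = "J (\<psi> z, z)" and ?\<psi>' = "\<lambda>k. - ?A (\<psi> z, z) k / ?a (\<psi> z, z)"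
    note q = JW[OF z]
    have "((\<lambda>z. (\<psi> z, z)) has_derivative (\<lambda>h. (?\<psi>' h, h))) (at z)"
      by (intro has_derivative_Pair d\<psi>[OF z] has_derivative_ident)
    from diff_chain_at[OF this Jd]
    have Jz: "((\<lambda>z. J (\<psi> z, z)) has_derivative (\<lambda>h. J' (?\<psi>' h, h))) (at z)" by (simp add: o_def)
    have "((\<lambda>z. F (J (\<psi> z, z))) has_derivative (\<lambda>h. F' ?q (J' (?\<psi>' h, h)))) (at z)"
      using diff_chain_at[OF Jz, of F "F' ?q"] F_der[OF q(1)] unfolding cder_def o_def by blast
    \<comment> \<open>\<open>F\<close> vanishes identically on the graph, so displacements along the
      graph are annihilated by \<open>F'\<close> and \<open>K'_on_S\<close> applies to them.\<close>
    moreover have "((\<lambda>z. F (J (\<psi> z, z))) has_derivative (\<lambda>h. 0)) (at z)"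
      by (rule has_derivative_transform_within_open[OF has_derivative_const[of 0] open_ball z])
         (use JW in auto)
    ultimately have "(\<lambda>h. F' ?q (J' (?\<psi>' h, h))) = (\<lambda>h. 0)"
      by (rule has_derivative_unique)
    then have F0: "F' ?q (J' (?\<psi>' h, h)) = 0" for h by metis
    have "((\<lambda>z. a (J (\<psi> z, z)) * b (J (\<psi> z, z))) has_derivative (\<lambda>h. K' ?q (J' (?\<psi>' h, h)))) (at z)"
      using diff_chain_at[OF Jz, of "\<lambda>q. a q * b q" "K' ?q"] K_der[OF q(1)] unfolding cder_def o_def by blast
    moreover have "K' ?q (J' (?\<psi>' h, h)) = \<rho> * k z * fst (snd h) + \<sigma> * k z * snd (snd h)" for h
      using K'_on_S[OF q F0[of h], of \<rho> \<sigma>] \<rho> by (simp add: sndJ k_def J'_def)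
    ultimately show ?thesis by (simp add: k_def[abs_def])
  qed
  define r where "r = d / 2"
  have r: "r > 0" using \<epsilon> by (simp add: r_def)
  have box: "(t, p) \<in> ball (0, snd qs) d" if "t \<in> ball 0 r" "p \<in> ball (snd qs) r" for t :: complex and p
  proof -
    have "dist (0, snd qs) (t, p) \<le> dist 0 t + dist (snd qs) p"
      by (simp add: dist_Pair_Pair sqrt_sum_squares_le_sum)
    then show ?thesis using that by (simp add: r_def)
  qed
  have rD: "p \<in> D1" if "p \<in> ball (snd qs) r" for p
    using JW(1)[OF box[of 0 p]] that r sndJ by (simp add: mem_Times_iff)
  \<comment> \<open>The derivative of \<open>k\<close> has no component in the remaining parameter
    \<open>t\<close> of \<open>x\<close>.\<close>
  have kt: "k (t, p) = k (0, p)" if t: "t \<in> ball 0 r" and p: "p \<in> ball (snd qs) r" for t p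
  proof -
    obtain \<rho> \<sigma> where \<rho>: "Pu (Pu y) p = \<rho> *s Pu y p" "Pv (Pv y) p = \<sigma> *s Pv y p"
      using ruled_scalars[OF rD[OF p]] by blast
    have "((\<lambda>t. k (t, p)) has_derivative (\<lambda>h. 0)) (at s within ball 0 r)" if s: "s \<in> ball 0 r" for s
    proof -
      have "((\<lambda>t. (t, p)) has_derivative (\<lambda>h. (h, 0))) (at s)"
        by (auto intro!: derivative_eq_intros)
      from diff_chain_at[OF this kd[OF box[OF s p], of \<rho> \<sigma>]] \<rho>
      have "((\<lambda>t. k (t, p)) has_derivative (\<lambda>h. 0)) (at s)" by (simp add: o_def)
      then show ?thesis by (rule has_derivative_at_withinI)
    qed
    then show ?thesis
      using has_derivative_zero_unique[OF convex_ball[of 0 r], of "\<lambda>t. k (t,p)" t 0] t r by simp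
  qed
  define g where "g p = k (0, p)" for p
  have gd: "(g has_derivative (\<lambda>(h,l). \<rho> * g p * h + \<sigma> * g p * l)) (at p)"
    if p: "p \<in> ball (snd qs) r" and \<rho>: "Pu (Pu y) p = \<rho> *s Pu y p" "Pv (Pv y) p = \<sigma> *s Pv y p" for p \<rho> \<sigma>
  proof -
    have "((\<lambda>p. (0::complex, p)) has_derivative (\<lambda>h. (0, h))) (at p)"
      by (auto intro!: derivative_eq_intros)
    from diff_chain_at[OF this kd[OF box[of 0 p], of \<rho> \<sigma>]] p r \<rho>
    show ?thesis by (simp add: o_def g_def[abs_def] case_prod_unfold)
  qed
  have gh: "sep_holo (ball (snd qs) r) g"
    unfolding holo2_iff_sep_holo[symmetric] holo2_def
  proof (intro conjI ballI open_ball)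
    fix p assume p: "p \<in> ball (snd qs) r"
    obtain \<rho> \<sigma> where "Pu (Pu y) p = \<rho> *s Pu y p" "Pv (Pv y) p = \<sigma> *s Pv y p"
      using ruled_scalars[OF rD[OF p]] by blast
    from gd[OF p this] show "\<exists>a b. (g has_derivative (\<lambda>(h, k). a * h + b * k)) (at p)" by blast
  qed
  have g0: "g p \<noteq> 0" if p: "p \<in> ball (snd qs) r" for p
    using S_facts(1,2)[OF JW[OF box[of 0 p]]] p r by (simp add: g_def k_def)
  have g\<rho>: "Pu (Pu y) p = (Du g p / g p) *s Pu y p" "Pv (Pv y) p = (Dv g p / g p) *s Pv y p"
    if p: "p \<in> ball (snd qs) r" for p
  proof -
    obtain \<rho> \<sigma> where \<rho>: "Pu (Pu y) p = \<rho> *s Pu y p" "Pv (Pv y) p = \<sigma> *s Pv y p"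
      using ruled_scalars[OF rD[OF p]] by blast
    have "(g has_derivative (\<lambda>(h,l). \<rho> * g p * h + \<sigma> * g p * l)) (at (fst p, snd p))"
      using gd[OF p \<rho>] by simp
    from holo2_slices[OF this] have "Du g p = \<rho> * g p" "Dv g p = \<sigma> * g p"
      by (simp_all add: Du_def Dv_def DERIV_imp_deriv)
    then show "Pu (Pu y) p = (Du g p / g p) *s Pu y p" "Pv (Pv y) p = (Dv g p / g p) *s Pv y p"
      using \<rho> g0[OF p] by simp_all
  qed
  \<comment> \<open>In this neighbourhood uniqueness of the root puts every point of
    \<open>F = 0\<close> on the graph of \<open>\<psi>\<close>.\<close>
  define U where "U = I -` (ball 0 \<epsilon> \<times> ball 0 r \<times> ball (snd qs) r)"
  have UI: "fst (I q) \<in> ball 0 \<epsilon>" "fst (snd (I q)) \<in> ball 0 r" "snd q \<in> ball (snd qs) r"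
    "snd (I q) \<in> ball (0, snd qs) d" if "q \<in> U" for q
  proof -
    show 1: "fst (I q) \<in> ball 0 \<epsilon>" "fst (snd (I q)) \<in> ball 0 r" "snd q \<in> ball (snd qs) r"
      using that by (auto simp: U_def I_def)
    show "snd (I q) \<in> ball (0, snd qs) d" using box[OF 1(2,3)] by (simp add: I_def)
  qed
  show ?thesis
  proof (rule that[of qs U r g])
    show "open U" unfolding U_def by (intro open_vimage Ic open_Times open_ball)
    show "qs \<in> U" using \<epsilon> r by (simp add: U_def Iqs)
    show "U \<subseteq> D0 \<times> D1"
    proof
      fix q assume "q \<in> U"
      then have "(fst (I q), snd (I q)) \<in> ?W" using UI \<epsilon>(3) by blast
      then show "q \<in> D0 \<times> D1" by (simp add: JI)
    qed
    show "a q * b q = g (snd q)" if q: "q \<in> U" "F q = 0" for q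
    proof -
      have "fst (I q) = \<psi> (snd (I q))"
        using UI[OF q(1)] q(2) by (intro uniq) (simp_all add: JI)
      then have "a q * b q = k (snd (I q))" by (simp add: k_def JI) (metis JI prod.collapse)
      also have "\<dots> = k (0, snd q)" using kt[OF UI(2,3)[OF q(1)]] by (simp add: I_def)
      finally show ?thesis by (simp add: g_def)
    qed
    show "ball (snd qs) r \<subseteq> D1" using rD by auto
  qed (use qs r gh g0 g\<rho> UI in blast)+
qed

end

section \<open>The dual matrix of a doubly ruled surface\<close>

text \<open>Homogeneous coordinates of a direction, that is of a point at infinity; derivatives of
  \<open>hom\<close> have this form.\<close>

definition hom0 :: "complex^3 \<Rightarrow> complex^4" where
  "hom0 x = (\<chi> i. if i = 1 then x$1 else if i = 2 then x$2 else if i = 3 then x$3 else 0)"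

lemma hom_nth [simp]: "hom x $ 1 = x $ 1" "hom x $ 2 = x $ 2" "hom x $ 3 = x $ 3" "hom x $ 4 = 1"
  "hom0 x $ 1 = x $ 1" "hom0 x $ 2 = x $ 2" "hom0 x $ 3 = x $ 3" "hom0 x $ 4 = 0"
  by (simp_all add: hom_def hom0_def)

lemma sep_holo_hom:
  assumes y: "holov D y"
  shows "sep_holo D (\<lambda>p. hom (y p) $ i)" and "sep_holo D (\<lambda>p. hom0 (y p) $ i)"
  using exhaust_4[of i] y sep_holo_const[OF holov_open[OF y]] by (auto simp: holov_def)

lemma Du_hom: "Du (\<lambda>p. hom (y p) $ i) p = hom0 (Pu y p) $ i" "Dv (\<lambda>p. hom (y p) $ i) p = hom0 (Pv y p) $ i"
  "Du (\<lambda>p. hom0 (y p) $ i) p = hom0 (Pu y p) $ i" "Dv (\<lambda>p. hom0 (y p) $ i) p = hom0 (Pv y p) $ i"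
  using exhaust_4[of i] by auto

lemma hom0_smult: "hom0 (k *s x) $ i = k * hom0 x $ i"
  using exhaust_4[of i] by auto

text \<open>For \<open>y\<close> with both families of parameter curves straight, this is (up to scale) the dual
  matrix of the doubly ruled quadric through \<open>y\<close>; the summand with \<open>l\<close> absorbs the projective
  normalisation of the homogeneous coordinates \<open>(y, 1)\<close>.\<close>
definition dual_entry ::
  "(complex \<times> complex \<Rightarrow> complex^3) \<Rightarrow> (complex \<times> complex \<Rightarrow> complex) \<Rightarrow> complex \<Rightarrow> complex \<times> complex \<Rightarrow> 4 \<Rightarrow> 4 \<Rightarrow> complex"
  where "dual_entry y g l p i j =
      (hom (y p) $ i * hom0 (Pu (Pv y) p) $ j + hom (y p) $ j * hom0 (Pu (Pv y) p) $ i
       - hom0 (Pu y p) $ i * hom0 (Pv y p) $ j - hom0 (Pu y p) $ j * hom0 (Pv y p) $ i) / g p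
      - l * (hom (y p) $ i * hom (y p) $ j)"

text \<open>With \<open>R\<close> the matrix \<open>X X\<^sup>T\<close> and \<open>Q\<close> the
  quotient of \<open>X \<odot> X\<^sub>u\<^sub>v - X\<^sub>u \<odot> X\<^sub>v\<close> by
  \<open>g\<close>, one has \<open>dQ = L dR\<close>. Equality of mixed partials forces
  \<open>L\<close> to be a constant \<open>l\<close>, so \<open>Q - l R\<close> is constant.\<close>

lemma ruled_dual_matrix_constant:
  fixes y :: "complex \<times> complex \<Rightarrow> complex^3"
  assumes r: "r > 0" and y: "holov (ball p0 r) y" and g: "sep_holo (ball p0 r) g"
    and g0: "\<And>p. p \<in> ball p0 r \<Longrightarrow> g p \<noteq> 0"
    and uu: "\<And>p. p \<in> ball p0 r \<Longrightarrow> Pu (Pu y) p = (Du g p / g p) *s Pu y p"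
    and vv: "\<And>p. p \<in> ball p0 r \<Longrightarrow> Pv (Pv y) p = (Dv g p / g p) *s Pv y p"
    and reg: "\<And>p. p \<in> ball p0 r \<Longrightarrow> cross3 (Pu y p) (Pv y p) \<noteq> 0"
  shows "\<exists>(M::complex^4^4) l. \<forall>p\<in>ball p0 r. \<forall>i j. M $ i $ j = dual_entry y g l p i j"
proof -
  let ?D = "ball p0 r"
  define X A B W where "X i p = hom (y p) $ i" and "A i p = hom0 (Pu y p) $ i"
    and "B i p = hom0 (Pv y p) $ i" and "W i p = hom0 (Pu (Pv y) p) $ i" for i p
  define \<rho> \<sigma> where "\<rho> p = Du g p / g p" and "\<sigma> p = Dv g p / g p" for p
  have s: "sep_holo ?D (X i)" "sep_holo ?D (A i)" "sep_holo ?D (B i)" "sep_holo ?D (W i)" for i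
    unfolding X_def A_def B_def W_def
    by (intro sep_holo_hom holov_Pu holov_Pv y)+
  have s\<rho>: "sep_holo ?D \<rho>" "sep_holo ?D \<sigma>"
    unfolding \<rho>_def \<sigma>_def using g g0 by (intro sep_holo_divide sep_holo_Du sep_holo_Dv; simp)+
  have X: "Du (X i) p = A i p" "Dv (X i) p = B i p" for i p
    unfolding X_def A_def B_def by (rule Du_hom)+
  have A: "Du (A i) p = \<rho> p * A i p" "Dv (A i) p = W i p" if "p \<in> ?D" for i p
    using uu[OF that] Pv_Pu_commute[OF y that]
    unfolding A_def W_def by (simp_all add: Du_hom hom0_smult \<rho>_def)
  have B: "Du (B i) p = W i p" "Dv (B i) p = \<sigma> p * B i p" if "p \<in> ?D" for i p
    using vv[OF that] unfolding B_def W_def by (simp_all add: Du_hom hom0_smult \<sigma>_def)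
  \<comment> \<open>Commuting derivatives of \<open>A\<close> and \<open>B\<close> expresses the
    third derivatives of \<open>y\<close> by lower ones.\<close>
  have W: "Du (W i) p = Dv \<rho> p * A i p + \<rho> p * W i p" "Dv (W i) p = Du \<sigma> p * B i p + \<sigma> p * W i p"
    if p: "p \<in> ?D" for i p
  proof -
    have "Du (W i) p = Du (Dv (A i)) p" by (rule Du_Dv_cong[OF open_ball p]) (simp add: A)
    also have "\<dots> = Dv (Du (A i)) p" using Dv_Du_commute[OF s(2) p] by simp
    also have "\<dots> = Dv (\<lambda>p. \<rho> p * A i p) p" by (rule Du_Dv_cong[OF open_ball p]) (simp add: A)
    also have "\<dots> = Dv \<rho> p * A i p + \<rho> p * W i p" using Du_Dv_mult[OF s\<rho>(1) s(2) p] A[OF p] by simp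
    finally show "Du (W i) p = Dv \<rho> p * A i p + \<rho> p * W i p" .
    have "Dv (W i) p = Dv (Du (B i)) p" by (rule Du_Dv_cong[OF open_ball p]) (simp add: B)
    also have "\<dots> = Du (Dv (B i)) p" using Dv_Du_commute[OF s(3) p] by simp
    also have "\<dots> = Du (\<lambda>p. \<sigma> p * B i p) p" by (rule Du_Dv_cong[OF open_ball p]) (simp add: B)
    also have "\<dots> = Du \<sigma> p * B i p + \<sigma> p * W i p" using Du_Dv_mult[OF s\<rho>(2) s(3) p] B[OF p] by simp
    finally show "Dv (W i) p = Du \<sigma> p * B i p + \<sigma> p * W i p" .
  qed
  have \<rho>\<sigma>: "Dv \<rho> p = Du \<sigma> p" if p: "p \<in> ?D" for p
    unfolding \<rho>_def \<sigma>_def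
    using Du_Dv_divide[OF sep_holo_Du[OF g] g p g0[OF p]] Du_Dv_divide[OF sep_holo_Dv[OF g] g p g0[OF p]]
      Dv_Du_commute[OF g p] by (simp add: mult.commute)
  \<comment> \<open>The mixed second derivative of the logarithm of \<open>g\<close>, divided by
    \<open>g\<close>.\<close>
  define L where "L p = Dv \<rho> p / g p" for p
  have sL: "sep_holo ?D L" unfolding L_def using g g0 s\<rho> by (intro sep_holo_divide sep_holo_Dv; simp)
  define R where "R i j p = X i p * X j p" for i j p
  have sR: "sep_holo ?D (R i j)" for i j unfolding R_def by (intro sep_holo_mult s)
  define T where "T i j p = X i p * W j p + X j p * W i p - A i p * B j p - A j p * B i p" for i j p
  have sT: "sep_holo ?D (T i j)" for i j
    unfolding T_def by (intro sep_holo_diff sep_holo_add sep_holo_mult s)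
  define Q where "Q i j p = T i j p / g p" for i j p
  have sQ: "sep_holo ?D (Q i j)" for i j unfolding Q_def using g0 by (intro sep_holo_divide sT g; simp)
  have R: "Du (R i j) p = X i p * A j p + X j p * A i p" "Dv (R i j) p = X i p * B j p + X j p * B i p"
    if "p \<in> ?D" for i j p
    unfolding R_def Du_Dv_mult[OF s(1) s(1) that] X by simp_all
  have T: "Du (T i j) p = \<rho> p * T i j p + Dv \<rho> p * Du (R i j) p"
    "Dv (T i j) p = \<sigma> p * T i j p + Du \<sigma> p * Dv (R i j) p" if p: "p \<in> ?D" for i j p
    unfolding R[OF p] T_def
    by (simp_all add: Du_Dv_diff[OF _ _ p] Du_Dv_add[OF _ _ p] Du_Dv_mult[OF _ _ p]
        sep_holo_diff sep_holo_add sep_holo_mult s X A[OF p] B[OF p] W[OF p] algebra_simps)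
  have Q: "Du (Q i j) p = L p * Du (R i j) p" "Dv (Q i j) p = L p * Dv (R i j) p" if p: "p \<in> ?D" for i j p
    unfolding Q_def Du_Dv_divide[OF sT g p g0[OF p]] T[OF p] L_def
    using g0[OF p] \<rho>\<sigma>[OF p]
    by (simp_all add: \<rho>_def \<sigma>_def field_simps power2_eq_square)
  have L0: "Du L p = 0 \<and> Dv L p = 0" if p: "p \<in> ?D" for p
  proof -
    \<comment> \<open>Compare the two mixed derivatives of \<open>Q\<close>; the second derivatives
      of \<open>R\<close> cancel.\<close>
    have 1: "Dv L p * Du (R i j) p = Du L p * Dv (R i j) p" for i j
    proof -
      have "Dv (Du (Q i j)) p = Dv (\<lambda>p. L p * Du (R i j) p) p"
        by (rule Du_Dv_cong[OF open_ball p]) (simp add: Q)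
      moreover have "Du (Dv (Q i j)) p = Du (\<lambda>p. L p * Dv (R i j) p) p"
        by (rule Du_Dv_cong[OF open_ball p]) (simp add: Q)
      ultimately show ?thesis
        using Dv_Du_commute[OF sQ p, of i j] Dv_Du_commute[OF sR p, of i j]
        by (simp add: Du_Dv_mult[OF sL sep_holo_Du[OF sR] p] Du_Dv_mult[OF sL sep_holo_Dv[OF sR] p])
    qed
    \<comment> \<open>The fourth coordinate of \<open>X\<close> is 1, so the last column of
      \<open>R\<close> is \<open>X\<close> itself.\<close>
    have "Dv L p * A i p = Du L p * B i p" for i
      using 1[of i 4] unfolding R[OF p] by (simp add: X_def A_def B_def)
    from this[of 1] this[of 2] this[of 3]
    have 2: "Dv L p *s Pu y p = Du L p *s Pv y p"
      by (simp add: A_def B_def vec_eq_iff forall_3)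
    have "Dv L p *s cross3 (Pu y p) (Pv y p) = 0" "Du L p *s cross3 (Pu y p) (Pv y p) = 0"
      using arg_cong[OF 2, of "\<lambda>z. cross3 z (Pv y p)"] arg_cong[OF 2, of "cross3 (Pu y p)"]
      by (simp_all add: cross3_skew(2))
    then show ?thesis using reg[OF p] by simp
  qed
  define l where "l = L p0"
  have Ll: "L p = l" if "p \<in> ?D" for p
    unfolding l_def using Du_Dv_zero_constant[OF sL L0 that] r by simp
  define M :: "complex^4^4" where "M = (\<chi> i j. Q i j p0 - l * R i j p0)"
  have "M $ i $ j = Q i j p - l * R i j p" if p: "p \<in> ?D" for i j p
  proof -
    have "Q i j p - l * R i j p = Q i j p0 - l * R i j p0"
    proof (rule Du_Dv_zero_constant[of p0 r "\<lambda>p. Q i j p - l * R i j p"])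
      show "sep_holo ?D (\<lambda>p. Q i j p - l * R i j p)"
        by (intro sep_holo_diff sep_holo_mult sep_holo_const sQ sR) simp
      show "Du (\<lambda>p. Q i j p - l * R i j p) p = 0 \<and> Dv (\<lambda>p. Q i j p - l * R i j p) p = 0" if p: "p \<in> ?D" for p
        by (simp add: Du_Dv_diff[OF sQ sep_holo_mult[OF sep_holo_const[OF open_ball] sR] p]
            Du_Dv_mult[OF sep_holo_const[OF open_ball] sR p] Q[OF p] Ll[OF p])
    qed (use p r in auto)
    then show ?thesis by (simp add: M_def)
  qed
  then show ?thesis
    unfolding Q_def T_def R_def X_def A_def B_def W_def dual_entry_def[symmetric] by blast
qed

section \<open>Action of dual matrices on plane coordinates\<close>

lemma sym_rank2_matrix_vector:
  fixes M :: "complex^4^4"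
  assumes "\<And>i j. M $ i $ j = (X$i * W$j + X$j * W$i - A$i * B$j - A$j * B$i) / g - l * (X$i * X$j)"
  shows "M *v \<eta> = (1/g) *s (bdot W \<eta> *s X + bdot X \<eta> *s W - bdot B \<eta> *s A - bdot A \<eta> *s B)
    - (l * bdot X \<eta>) *s X"
proof -
  have "(M *v \<eta>) $ i = ((1/g) *s (bdot W \<eta> *s X + bdot X \<eta> *s W - bdot B \<eta> *s A - bdot A \<eta> *s B)
    - (l * bdot X \<eta>) *s X) $ i" for i
    by (simp add: matrix_vector_mult_def assms bdot_def sum_4 algebra_simps divide_inverse)
  then show ?thesis by (simp add: vec_eq_iff)
qed

text \<open>Dual homogeneous coordinates of the plane of points \<open>z\<close> with
  \<open>bdot z n = d\<close>.\<close>

definition cov :: "complex^3 \<Rightarrow> complex \<Rightarrow> complex^4" where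
  "cov n d = (\<chi> i. if i = 1 then n$1 else if i = 2 then n$2 else if i = 3 then n$3 else - d)"

lemma cov_nth [simp]: "cov n d $ 1 = n $ 1" "cov n d $ 2 = n $ 2" "cov n d $ 3 = n $ 3" "cov n d $ 4 = - d"
  by (simp_all add: cov_def)

lemma bdot_cov [simp]: "bdot (hom z) (cov n d) = bdot z n - d" "bdot (hom0 z) (cov n d) = bdot z n"
  "bdot (cov n d) (hom z) = bdot z n - d"
  by (simp_all add: bdot_def sum_3 sum_4 mult.commute)

lemma cov_eq: "\<omega> = cov (\<chi> i. if i = 1 then \<omega>$1 else if i = 2 then \<omega>$2 else \<omega>$3) (- \<omega>$4)"
  by (simp add: vec_eq_iff forall_4)

lemma cov_eq_0_iff: "cov n d = 0 \<longleftrightarrow> n = 0 \<and> d = 0"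
  by (auto simp: vec_eq_iff forall_3 forall_4)

lemma hom0_eq_0_iff: "hom0 n = 0 \<longleftrightarrow> n = 0"
  by (auto simp: vec_eq_iff forall_3 forall_4)

lemma Ediag_cov: "Ediag *v cov n d = hom0 n"
  by (simp add: vec_eq_iff forall_4 matrix_vector_mult_def sum_4 Ediag_def)

lemma sep_holo_cov:
  assumes "holov D n" "sep_holo D d" shows "sep_holo D (\<lambda>p. cov (n p) (d p) $ i)"
  using exhaust_4[of i] assms sep_holo_minus[OF assms(2)] by (auto simp: holov_def)

lemma bdot_symmetric_matrix:
  fixes P :: "complex^'n^'n"
  assumes "transpose P = P" shows "bdot u (P *v w) = bdot (P *v u) w"
proof -
  have P: "P $ i $ j = P $ j $ i" for i j
    using assms by (metis transpose_def vec_lambda_beta)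
  have "bdot u (P *v w) = (\<Sum>i\<in>UNIV. \<Sum>j\<in>UNIV. u$i * (P$i$j * w$j))"
    by (simp add: bdot_def matrix_vector_mult_def sum_distrib_left)
  also have "\<dots> = (\<Sum>j\<in>UNIV. \<Sum>i\<in>UNIV. u$i * (P$i$j * w$j))" by (rule sum.swap)
  also have "\<dots> = bdot (P *v u) w"
    unfolding bdot_def matrix_vector_mult_def
    by (simp add: sum_distrib_right sum_distrib_left P[of _ j for j] mult_ac)
  finally show ?thesis .
qed

lemma det_zero_kernel:
  fixes P :: "complex^'n^'n"
  shows "det P = 0 \<longleftrightarrow> (\<exists>\<omega>. \<omega> \<noteq> 0 \<and> P *v \<omega> = 0)"
  using invertible_det_nz[of P] invertible_left_inverse[of P] matrix_left_invertible_ker[of P] by blast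

lemma matrix_inv_mult:
  fixes P :: "complex^'n^'n"
  assumes "det P \<noteq> 0" shows "P ** matrix_inv P = mat 1" "matrix_inv P ** P = mat 1"
proof -
  have "\<exists>A'. P ** A' = mat 1 \<and> A' ** P = mat 1"
    using assms invertible_det_nz[of P] by (auto simp: invertible_def)
  from someI_ex[OF this] show "P ** matrix_inv P = mat 1" "matrix_inv P ** P = mat 1"
    by (simp_all add: matrix_inv_def)
qed

lemma matrix_inv_eqI:
  fixes P :: "complex^'n^'n"
  assumes "P ** Q = mat 1" shows "matrix_inv P = Q"
proof -
  have "det P \<noteq> 0" using assms det_mul[of P Q] by auto
  then have "matrix_inv P ** P = mat 1" by (rule matrix_inv_mult)
  then have "matrix_inv P ** (P ** Q) = Q" by (simp add: matrix_mul_assoc)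
  then show ?thesis using assms by simp
qed

lemma nondeg_quadric_matrix_inv:
  assumes P: "transpose P = P" "det P \<noteq> 0"
  shows "nondeg_quadric (matrix_inv P)" "matrix_inv (matrix_inv P) = P"
proof -
  note i = matrix_inv_mult[OF P(2)]
  show "matrix_inv (matrix_inv P) = P" by (rule matrix_inv_eqI[OF i(2)])
  have "P ** transpose (matrix_inv P) = mat 1"
    using arg_cong[OF i(2), of transpose] P(1) by (simp add: matrix_transpose_mul)
  then have "matrix_inv P = transpose (matrix_inv P)" by (rule matrix_inv_eqI)
  moreover have "det (matrix_inv P) \<noteq> 0" using i(1) det_mul[of P "matrix_inv P"] by auto
  ultimately show "nondeg_quadric (matrix_inv P)" by (simp add: nondeg_quadric_def)
qed

text \<open>A plane through \<open>x\<close> whose pole with respect to the dual matrix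
  \<open>P\<close> is \<open>x\<close> is tangent to the quadric of \<open>P\<^sup>-\<^sup>1\<close>
  there: that inverse sends \<open>hom x\<close> to a multiple of \<open>\<omega>\<close>, which
  annihilates \<open>hom x\<close>.\<close>

lemma point_on_dual_quadric:
  assumes P: "det P \<noteq> 0" and \<omega>: "P *v \<omega> = k *s hom x" "\<omega> \<noteq> 0" "bdot (hom x) \<omega> = 0"
  shows "x \<in> quadric_pts (matrix_inv P)"
proof -
  have "k \<noteq> 0"
  proof
    assume "k = 0"
    then have "P *v \<omega> = 0" using \<omega>(1) by simp
    then show False using \<omega>(2) P det_zero_kernel[of P] by blast
  qed
  have "k *s (matrix_inv P *v hom x) = matrix_inv P *v (P *v \<omega>)"
    unfolding \<omega>(1) by (simp add: matrix_vector_mult_def vec_eq_iff sum_distrib_left mult.left_commute)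
  also have "\<dots> = \<omega>" using matrix_inv_mult[OF P] by (simp add: matrix_vector_mul_assoc)
  finally have "bdot (hom x) (k *s (matrix_inv P *v hom x)) = 0" using \<omega>(3) by (simp only:)
  then have "k * bdot (hom x) (matrix_inv P *v hom x) = 0" by simp
  then show ?thesis using \<open>k \<noteq> 0\<close> by (simp add: quadric_pts_def)
qed

section \<open>Confocality\<close>

context tangential_pair begin

lemma second_fundamental_form:
  assumes p: "p \<in> D0"
  shows "bdot (N p) (Pu (Pu x) p) = - bdot (Pu x p) (Pu N p)"
    "bdot (N p) (Pu (Pv x) p) = - bdot (Pu x p) (Pv N p)"
    "bdot (N p) (Pv (Pv x) p) = - bdot (Pv x p) (Pv N p)"
proof -
  have u: "Du (\<lambda>p. bdot (N p) (Pu x p)) p = Du (\<lambda>p. 0) p" "Dv (\<lambda>p. bdot (N p) (Pv x p)) p = Dv (\<lambda>p. 0) p"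
     "Du (\<lambda>p. bdot (N p) (Pv x p)) p = Du (\<lambda>p. 0) p"
    by (rule Du_Dv_cong[OF openD(1) p]; simp add: Nxu Nxv)+
  then show "bdot (N p) (Pu (Pu x) p) = - bdot (Pu x p) (Pu N p)"
    "bdot (N p) (Pu (Pv x) p) = - bdot (Pu x p) (Pv N p)"
    "bdot (N p) (Pv (Pv x) p) = - bdot (Pv x p) (Pv N p)"
    using Du_Dv_bdot[OF hN holov_Pu[OF hx] p] Du_Dv_bdot[OF hN holov_Pv[OF hx] p] II_sym[OF p]
    by (simp_all add: eq_neg_iff_add_eq_0 bdot_commute[of "Pu N p"] bdot_commute[of "Pv N p"])
qed

text \<open>First derivatives of the plane equation make its normal a multiple of \<open>N\<close>,
  and second derivatives make this multiple of the second fundamental form vanish.\<close>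

lemma not_in_plane:
  assumes A: "open A" "A \<subseteq> D0" "A \<noteq> {}" and z: "\<And>p. p \<in> A \<Longrightarrow> bdot \<omega> (hom (x p)) = 0"
  shows "\<omega> = 0"
proof -
  obtain w d where w: "\<omega> = cov w d" using cov_eq by blast
  obtain p where p: "p \<in> A" using A by blast
  have pD: "p \<in> D0" using p A by auto
  have hxA: "holov A x" using holov_subset[OF hx A(1,2)] .
  note hw = holov_const[OF A(1), of w]
  have 0: "bdot w (x p) = d" if "p \<in> A" for p using z[OF that] by (simp add: w bdot_commute)
  have 1: "bdot w (Pu x p) = 0" "bdot w (Pv x p) = 0" if "p \<in> A" for p
    using Du_Dv_bdot[OF hw hxA that] Du_Dv_cong[OF A(1) that, of "\<lambda>p. bdot w (x p)" "\<lambda>p. d"] 0 by simp_all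
  have 2: "bdot w (Pu (Pu x) p) = 0" "bdot w (Pu (Pv x) p) = 0" "bdot w (Pv (Pv x) p) = 0"
    using Du_Dv_bdot[OF hw holov_Pu[OF hxA] p] Du_Dv_bdot[OF hw holov_Pv[OF hxA] p]
      Du_Dv_cong[OF A(1) p, of "\<lambda>p. bdot w (Pu x p)" "\<lambda>p. 0"]
      Du_Dv_cong[OF A(1) p, of "\<lambda>p. bdot w (Pv x p)" "\<lambda>p. 0"] 1 by simp_all
  define k where "k = bdot w (N p)"
  have "w - k *s N p = 0"
    by (rule det3_orthogonal_zero[OF detx[OF pD]])
       (use 1[OF p] NN[OF pD] Nxu[OF pD] Nxv[OF pD] in \<open>simp_all add: k_def\<close>)
  then have wk: "w = k *s N p" by simp
  have "k = 0"
    using 2 II_nondeg[OF pD] unfolding wk by (auto simp: second_fundamental_form[OF pD])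
  then have "w = 0" using wk by simp
  then show ?thesis using 0[OF p] w by (simp add: cov_eq_0_iff)
qed

text \<open>The tangent planes of \<open>x\<close> have no common point, even at infinity:
  differentiation shows \<open>w + d x\<close> orthogonal to \<open>N\<close> and its derivatives,
  so it vanishes and nonzero \<open>d\<close> would make \<open>x\<close> constant.\<close>

lemma not_linear_dual:
  assumes z: "\<And>p. p \<in> D0 \<Longrightarrow> bdot \<omega> (cov (N p) (bdot (N p) (x p))) = 0"
  shows "\<omega> = 0"
proof -
  obtain w d where w: "\<omega> = cov w d" using cov_eq by blast
  obtain p where pD: "p \<in> D0" using S_ex by blast
  note hw = holov_const[OF openD(1), of w]
  have 0: "bdot w (N p) + d * bdot (N p) (x p) = 0" if "p \<in> D0" for p
    using z[OF that] unfolding w by (simp add: bdot_def sum_4 sum_3 algebra_simps)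
  have s: "sep_holo D0 (\<lambda>p. bdot w (N p))" "sep_holo D0 (\<lambda>p. bdot (N p) (x p))" "sep_holo D0 (\<lambda>p. d)"
    by (intro sep_holo_bdot hw hN hx sep_holo_const openD)+
  have 1: "w + d *s x p = 0" if p: "p \<in> D0" for p
  proof (rule det3_orthogonal_zero[OF detN[OF p]])
    have "Du (\<lambda>p. bdot w (N p) + d * bdot (N p) (x p)) p = 0" "Dv (\<lambda>p. bdot w (N p) + d * bdot (N p) (x p)) p = 0"
      using Du_Dv_cong[OF openD(1) p, of "\<lambda>p. bdot w (N p) + d * bdot (N p) (x p)" "\<lambda>p. 0"] 0 by simp_all
    then show "bdot (w + d *s x p) (Pu N p) = 0" "bdot (w + d *s x p) (Pv N p) = 0"
      using Nxu[OF p] Nxv[OF p]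
      by (simp_all add: Du_Dv_add[OF s(1) sep_holo_mult[OF s(3) s(2)] p] Du_Dv_mult[OF s(3) s(2) p]
          Du_Dv_bdot[OF hw hN p] Du_Dv_bdot[OF hN hx p] bdot_commute)
    show "bdot (w + d *s x p) (N p) = 0" using 0[OF p] by (simp add: bdot_commute)
  qed
  have "d = 0"
  proof (rule ccontr)
    assume "d \<noteq> 0"
    then have "x p $ i = - w $ i / d" if "p \<in> D0" for p i
      using 1[OF that] by (simp add: vec_eq_iff field_simps) (metis add.commute eq_neg_iff_add_eq_0 mult.commute)
    then have "Pu x p $ i = 0" for i
      using Du_Dv_cong(1)[OF openD(1) pD, of "\<lambda>p. x p $ i" "\<lambda>p. - w $ i / d"] by simp
    then have "Pu x p = 0" by (simp add: vec_eq_iff)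
    then show False using detx[OF pD] by simp
  qed
  then show ?thesis using 1[OF pD] w by (simp add: cov_eq_0_iff)
qed

lemma confocal_quadrics:
  "\<exists>Q. nondeg_quadric Q \<and> x ` D0 \<subseteq> quadric_pts Q \<and> (\<exists>w. confocal_member Q w (y ` D1))"
proof -
  obtain qs U r g where qs: "qs \<in> D0 \<times> D1" "F qs = 0" and U: "open U" "qs \<in> U" "U \<subseteq> D0 \<times> D1"
    and r: "r > 0" and B: "ball (snd qs) r \<subseteq> D1" and g: "sep_holo (ball (snd qs) r) g"
    "\<And>p. p \<in> ball (snd qs) r \<Longrightarrow> g p \<noteq> 0"
    "\<And>p. p \<in> ball (snd qs) r \<Longrightarrow> Pu (Pu y) p = (Du g p / g p) *s Pu y p"
    "\<And>p. p \<in> ball (snd qs) r \<Longrightarrow> Pv (Pv y) p = (Dv g p / g p) *s Pv y p"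
    and UB: "\<And>q. q \<in> U \<Longrightarrow> snd q \<in> ball (snd qs) r"
    and Ug: "\<And>q. q \<in> U \<Longrightarrow> F q = 0 \<Longrightarrow> a q * b q = g (snd q)"
    using that by (rule first_integral)
  let ?B = "ball (snd qs) r"
  have yB: "holov ?B y" using holov_subset[OF hy open_ball B] .
  have regB: "cross3 (Pu y p) (Pv y p) \<noteq> 0" if "p \<in> ?B" for p using reg B that by blast
  obtain M :: "complex^4^4" and l where "\<forall>p\<in>?B. \<forall>i j. M $ i $ j = dual_entry y g l p i j"
    using ruled_dual_matrix_constant[OF r yB g regB] by blast
  then have M: "M $ i $ j = dual_entry y g l p i j" if "p \<in> ?B" for p i j using that by blast
  have Mv: "M *v \<eta> = (1 / g p) *s (bdot (hom0 (Pu (Pv y) p)) \<eta> *s hom (y p) + bdot (hom (y p)) \<eta> *s hom0 (Pu (Pv y) p)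
      - bdot (hom0 (Pv y p)) \<eta> *s hom0 (Pu y p) - bdot (hom0 (Pu y p)) \<eta> *s hom0 (Pv y p))
      - (l * bdot (hom (y p)) \<eta>) *s hom (y p)" if "p \<in> ?B" for p \<eta>
    by (rule sym_rank2_matrix_vector) (simp only: M[OF that] dual_entry_def)
  have cB: "snd qs \<in> ?B" using r by simp
  define n where "n p = cross3 (Pu y p) (Pv y p)" for p
  define T where "T p = cov (n p) (bdot (n p) (y p))" for p
  have yn: "bdot (Pu y p) (n p) = 0" "bdot (Pv y p) (n p) = 0" for p
    by (simp_all add: n_def bdot_3 algebra_simps)
  \<comment> \<open>\<open>M\<close> sends the tangent plane of \<open>y\<close> to a multiple of
    its point of contact, as a dual matrix should.\<close>
  have MT: "M *v T p = (bdot (Pu (Pv y) p) (n p) / g p) *s hom (y p)" if "p \<in> ?B" for p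
    unfolding Mv[OF that] T_def using yn by (simp add: bdot_commute)
  have T0: "T p \<noteq> 0" "bdot (hom (y p)) (T p) = 0" if "p \<in> ?B" for p
    using regB[OF that] by (simp_all add: T_def n_def cov_eq_0_iff bdot_commute)
  \<comment> \<open>The candidate dual matrix of the quadric through \<open>x\<close>; subtracting 2
    times \<open>Ediag\<close> returns \<open>M\<close>, whence the confocal parameter 2.\<close>
  define P0 where "P0 = M + (\<chi> i j. 2 * Ediag $ i $ j)"
  have P0v: "P0 *v \<eta> = M *v \<eta> + 2 *s (Ediag *v \<eta>)" for \<eta>
    by (simp add: P0_def vec_eq_iff matrix_vector_mult_def sum.distrib sum_distrib_left algebra_simps)
  have P0T: "transpose P0 = P0"
    by (simp add: P0_def vec_eq_iff transpose_def M[OF cB] dual_entry_def Ediag_def mult.commute add.commute)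
  define \<nu> where "\<nu> p = cov (N p) (bdot (N p) (x p))" for p
  \<comment> \<open>The tangent plane \<open>\<nu>\<close> of \<open>x\<close> passes through the
    point of \<open>y\<close>, so the terms with \<open>bdot (hom y) \<nu>\<close> drop out of
    \<open>M \<nu>\<close>; with \<open>a b = g\<close> the rest is the integrability
    condition.\<close>
  have loc: "P0 *v \<nu> (fst q) = (c q / g (snd q)) *s hom (x (fst q))" if q: "q \<in> U" "F q = 0" for q
  proof -
    have qD: "q \<in> D0 \<times> D1" "fst q \<in> D0" "snd q \<in> D1" using q U by auto
    have g0: "g (snd q) \<noteq> 0" using g(2) UB q by blast
    have "bdot (hom (y (snd q))) (\<nu> (fst q)) = 0"
      using q(2) by (simp add: \<nu>_def F_def V_def bdot_commute)
    then have 1: "P0 *v \<nu> (fst q) = (1 / g (snd q)) *s (c q *s hom (y (snd q)) - b q *s hom0 (Pu y (snd q)) - a q *s hom0 (Pv y (snd q)))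
        + 2 *s hom0 (N (fst q))"
      unfolding P0v Mv[OF UB[OF q(1)]] by (simp add: \<nu>_def Ediag_cov a_def b_def c_def)
    have 2: "b q * Pu y (snd q) $ i + a q * Pv y (snd q) $ i - 2 * g (snd q) * N (fst q) $ i
        = c q * (y (snd q) $ i - x (fst q) $ i)" for i
      using arg_cong[OF integrable[OF qD(2,3)], of "\<lambda>v. v $ i"] q(2) unfolding Ug[OF q, symmetric]
      by (simp add: F_def V_def a_def b_def c_def mult.assoc right_diff_distrib del: Pu_nth Pv_nth)
    have 3: "(c q * y (snd q) $ i - b q * Pu y (snd q) $ i - a q * Pv y (snd q) $ i) / g (snd q) + 2 * N (fst q) $ i
        = c q * x (fst q) $ i / g (snd q)" for i
    proof -
      have "c q * y (snd q) $ i - b q * Pu y (snd q) $ i - a q * Pv y (snd q) $ i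
          = c q * x (fst q) $ i - 2 * g (snd q) * N (fst q) $ i" using 2[of i] by algebra
      then show ?thesis using g0 by (simp add: diff_divide_distrib del: Pu_nth Pv_nth)
    qed
    show ?thesis
      unfolding 1 using 3[of 1] 3[of 2] 3[of 3]
      by (simp add: vec_eq_iff forall_4 diff_divide_distrib del: Pu_nth Pv_nth)
  qed
  \<comment> \<open>The factor is read off from the fourth coordinate, where \<open>hom x\<close> is
    1. It is thus holomorphic on \<open>D0\<close>, and the identity theorem applies.\<close>
  define \<tau> where "\<tau> p = (P0 *v \<nu> p) $ 4" for p
  have s\<nu>: "sep_holo D0 (\<lambda>p. \<nu> p $ i)" for i
    unfolding \<nu>_def by (intro sep_holo_cov sep_holo_bdot hN hx)
  have sP: "sep_holo D0 (\<lambda>p. (P0 *v \<nu> p) $ i)" for i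
    unfolding matrix_vector_mult_def vec_lambda_beta
    by (intro sep_holo_sum sep_holo_mult sep_holo_const s\<nu> openD)
  have glob: "P0 *v \<nu> p = \<tau> p *s hom (x p)" if p: "p \<in> D0" for p
  proof -
    obtain e where e: "e > 0" "\<forall>p\<in>ball (fst qs) e. \<exists>p1. (p,p1) \<in> U \<and> F (p,p1) = 0"
      using project_D0[OF U qs(2)] by blast
    have z: "p \<in> D0" "P0 *v \<nu> p = \<tau> p *s hom (x p)" if pb: "p \<in> ball (fst qs) e" for p
    proof -
      obtain p1 where p1: "(p,p1) \<in> U" "F (p,p1) = 0" using e(2) pb by blast
      then show "p \<in> D0" using U by auto
      show "P0 *v \<nu> p = \<tau> p *s hom (x p)" using loc[OF p1] by (simp add: \<tau>_def)
    qed
    have "(P0 *v \<nu> p) $ i - \<tau> p * hom (x p) $ i = 0" for i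
    proof (rule sep_holo_identity[of D0 "\<lambda>p. (P0 *v \<nu> p) $ i - \<tau> p * hom (x p) $ i" "ball (fst qs) e"])
      show "sep_holo D0 (\<lambda>p. (P0 *v \<nu> p) $ i - \<tau> p * hom (x p) $ i)"
        unfolding \<tau>_def by (intro sep_holo_diff sep_holo_mult sP sep_holo_hom hx)
      show "(P0 *v \<nu> p) $ i - \<tau> p * hom (x p) $ i = 0" if "p \<in> ball (fst qs) e" for p
        unfolding z(2)[OF that] by simp
    qed (use D0 z e p in auto)
    then show ?thesis by (simp add: vec_eq_iff)
  qed
  \<comment> \<open>A kernel vector \<open>\<omega>\<close> would put \<open>x\<close> in a plane
    wherever \<open>\<tau>\<close> is nonzero, so \<open>\<tau>\<close> vanishes; then each row of
    \<open>P0\<close> annihilates all tangent planes of \<open>x\<close>, so \<open>P0 = 0\<close>.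
    Applied to the tangent plane of \<open>y\<close> this forces its normal to vanish.\<close>
  have detP0: "det P0 \<noteq> 0"
  proof
    assume "det P0 = 0"
    then obtain \<omega> where \<omega>: "\<omega> \<noteq> 0" "P0 *v \<omega> = 0" using det_zero_kernel by blast
    have t: "\<tau> p * bdot \<omega> (hom (x p)) = 0" if "p \<in> D0" for p
    proof -
      have "\<tau> p * bdot \<omega> (hom (x p)) = bdot \<omega> (P0 *v \<nu> p)" by (simp add: glob[OF that])
      also have "\<dots> = 0" using \<omega> by (simp add: bdot_symmetric_matrix[OF P0T])
      finally show ?thesis .
    qed
    define O1 where "O1 = D0 \<inter> \<tau> -` (- {0})"
    have "open O1"
      unfolding O1_def using sP[of 4] openD(1) unfolding \<tau>_def[symmetric] sep_holo_def
      by (intro continuous_open_preimage) auto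
    then have "O1 = {}"
      using not_in_plane[of O1 \<omega>] t \<omega>(1) by (auto simp: O1_def)
    then have Pz: "P0 *v \<nu> p = 0" if "p \<in> D0" for p
      using glob[OF that] that by (auto simp: O1_def)
    have "(P0 *v \<nu> p) $ i = bdot (P0 $ i) (\<nu> p)" for p i
      by (simp add: matrix_vector_mult_def bdot_def)
    then have "bdot (P0 $ i) (cov (N p) (bdot (N p) (x p))) = 0" if "p \<in> D0" for p i
      using Pz[OF that] by (metis \<nu>_def zero_index)
    then have "P0 $ i = 0" for i using not_linear_dual by blast
    then have "P0 = 0" by (simp add: vec_eq_iff)
    then have "M *v T (snd qs) + 2 *s hom0 (n (snd qs)) = 0"
      using P0v[of "T (snd qs)"] by (simp add: T_def Ediag_cov)
    then have *: "(bdot (Pu (Pv y) (snd qs)) (n (snd qs)) / g (snd qs)) *s hom (y (snd qs)) + 2 *s hom0 (n (snd qs)) = 0"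
      unfolding MT[OF cB] .
    from arg_cong[OF this, of "\<lambda>v::complex^4. v $ 4"]
    have "bdot (Pu (Pv y) (snd qs)) (n (snd qs)) / g (snd qs) = 0" by simp
    with * have "hom0 (n (snd qs)) = 0" by simp
    then show False using regB[OF cB] by (simp add: hom0_eq_0_iff n_def)
  qed
  have x0: "x ` D0 \<subseteq> quadric_pts (matrix_inv P0)"
  proof
    fix z assume "z \<in> x ` D0"
    then obtain p where p: "p \<in> D0" "z = x p" by blast
    have "N p \<noteq> 0" using NN[OF p(1)] by auto
    then show "z \<in> quadric_pts (matrix_inv P0)"
      unfolding p(2) by (intro point_on_dual_quadric[OF detP0 glob[OF p(1)]])
        (simp_all add: \<nu>_def cov_eq_0_iff bdot_commute)
  qed
  have MP: "(\<chi> i j. matrix_inv (matrix_inv P0) $ i $ j - 2 * Ediag $ i $ j) = M"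
    unfolding nondeg_quadric_matrix_inv(2)[OF P0T detP0] by (simp add: P0_def vec_eq_iff)
  have "confocal_member (matrix_inv P0) 2 (y ` D1)"
  proof (cases "det M = 0")
    case False
    have "bdot (hom (y p)) (matrix_inv M *v hom (y p)) = 0" if p: "p \<in> D1" for p
    proof (rule sep_holo_identity[of D1 "\<lambda>p. bdot (hom (y p)) (matrix_inv M *v hom (y p))" ?B])
      show "sep_holo D1 (\<lambda>p. bdot (hom (y p)) (matrix_inv M *v hom (y p)))"
        unfolding bdot_def matrix_vector_mult_def vec_lambda_beta
        by (intro sep_holo_sum sep_holo_mult sep_holo_const sep_holo_hom hy openD)
      show "bdot (hom (y p)) (matrix_inv M *v hom (y p)) = 0" if "p \<in> ?B" for p
        using point_on_dual_quadric[OF False MT[OF that] T0[OF that]] by (simp add: quadric_pts_def)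
    qed (use D1 B cB p in auto)
    then show ?thesis unfolding confocal_member_def MP Let_def using False by (auto simp: quadric_pts_def)
  next
    case True
    then obtain \<eta> where \<eta>: "\<eta> \<noteq> 0" "M *v \<eta> = 0" using det_zero_kernel by blast
    \<comment> \<open>If the mixed derivative of \<open>y\<close> left the tangent plane,
      independence of the three derivatives would make \<open>M\<close> injective: the fourth
      coordinate gives \<open>\<kappa>\<close> in terms of \<open>\<alpha>\<close>, and the others
      force \<open>\<alpha>\<close>, \<open>\<beta>\<close>, \<open>\<gamma>\<close> to
      vanish.\<close>
    have W: "bdot (Pu (Pv y) p) (n p) = 0" if p: "p \<in> ?B" for p
    proof (rule ccontr)
      assume ne: "bdot (Pu (Pv y) p) (n p) \<noteq> 0"
      obtain w d where w: "\<eta> = cov w d" using cov_eq by blast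
      define \<alpha> \<beta> \<gamma> \<kappa> where "\<alpha> = bdot (hom (y p)) \<eta>" and "\<beta> = bdot (Pu y p) w" and "\<gamma> = bdot (Pv y p) w"
        and "\<kappa> = bdot (Pu (Pv y) p) w"
      have 0: "0 = (1 / g p) *s (\<kappa> *s hom (y p) + \<alpha> *s hom0 (Pu (Pv y) p) - \<gamma> *s hom0 (Pu y p) - \<beta> *s hom0 (Pv y p))
         - (l * \<alpha>) *s hom (y p)"
        using Mv[OF p, of \<eta>] \<eta>(2) unfolding \<alpha>_def[symmetric] by (simp add: w \<beta>_def \<gamma>_def \<kappa>_def)
      from arg_cong[OF this, of "\<lambda>v::complex^4. v $ 4"] have 4: "\<kappa> = g p * (l * \<alpha>)"
        using g(2)[OF p] by (simp add: field_simps)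
      have "\<alpha> * Pu (Pv y) p $ i - \<gamma> * Pu y p $ i - \<beta> * Pv y p $ i = 0" if "i \<in> {1,2,3}" for i
        using arg_cong[OF 0, of "\<lambda>v::complex^4. v $ 1"] arg_cong[OF 0, of "\<lambda>v::complex^4. v $ 2"] arg_cong[OF 0, of "\<lambda>v::complex^4. v $ 3"]
          that g(2)[OF p] unfolding 4 by (auto simp: field_simps simp del: Pu_nth Pv_nth)
      then have "\<alpha> *s Pu (Pv y) p - \<gamma> *s Pu y p - \<beta> *s Pv y p = 0"
        by (simp add: vec_eq_iff forall_3 del: Pu_nth Pv_nth)
      then have 5: "bdot (\<alpha> *s Pu (Pv y) p - \<gamma> *s Pu y p - \<beta> *s Pv y p) k = 0"
        "cross3 (Pu y p) (\<alpha> *s Pu (Pv y) p - \<gamma> *s Pu y p - \<beta> *s Pv y p) = 0"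
        "cross3 (\<alpha> *s Pu (Pv y) p - \<gamma> *s Pu y p - \<beta> *s Pv y p) (Pv y p) = 0" for k
        by simp_all
      have \<alpha>0: "\<alpha> = 0" using 5(1)[of "n p"] ne yn by simp
      have "\<beta> = 0" "\<gamma> = 0" using 5(2,3) \<alpha>0 regB[OF p] by (simp_all add: cross3_skew(2))
      moreover have "\<kappa> = 0" using 4 \<alpha>0 by simp
      moreover have "det3 (Pu (Pv y) p) (Pu y p) (Pv y p) \<noteq> 0" using ne by (simp add: det3_def n_def)
      ultimately have "w = 0"
        using det3_orthogonal_zero[of "Pu (Pv y) p" "Pu y p" "Pv y p" w]
        by (simp add: \<beta>_def \<gamma>_def \<kappa>_def bdot_commute[of w])
      then show False using \<alpha>0 \<eta>(1) by (simp add: \<alpha>_def w cov_eq_0_iff)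
    qed
    \<comment> \<open>The plane sought is the tangent plane at the centre; the rest of this case
      shows that it contains all of \<open>y\<close>.\<close>
    define \<pi> where "\<pi> = T (snd qs)"
    have M\<pi>: "M *v \<pi> = 0" using MT[OF cB] W[OF cB] by (simp add: \<pi>_def)
    have hn: "holov D1 n" unfolding n_def[abs_def] by (intro holov_cross3 holov_Pu holov_Pv hy)
    \<comment> \<open>All second derivatives of \<open>y\<close> are now tangential, so the
      derivatives of its normal remain parallel to it.\<close>
    have par: "cross3 (n p) (Pu n p) = 0" "cross3 (n p) (Pv n p) = 0" if p: "p \<in> ?B" for p
    proof -
      have pD: "p \<in> D1" using p B by auto
      have nc: "cross3 (n p) (n p) = 0" by (rule cross3_skew(2))
      have "Pu n p = cross3 (Pu y p) (Pu (Pv y) p) + (Du g p / g p) *s n p"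
        unfolding n_def[abs_def] Pu_Pv_cross3[OF holov_Pu[OF hy] holov_Pv[OF hy] pD] g(3)[OF p] by simp
      then show "cross3 (n p) (Pu n p) = 0"
        using W[OF p] yn[of p] nc by (simp add: cross3_cross3 bdot_commute)
      have "Pv n p = (Dv g p / g p) *s n p + cross3 (Pu (Pv y) p) (Pv y p)"
        unfolding n_def[abs_def] Pu_Pv_cross3[OF holov_Pu[OF hy] holov_Pv[OF hy] pD] g(4)[OF p]
          Pv_Pu_commute[OF hy pD] by simp
      then show "cross3 (n p) (Pv n p) = 0"
        using W[OF p] yn[of p] nc by (simp add: cross3_cross3 bdot_commute)
    qed
    have par': "n p $ i * Pu n p $ j = n p $ j * Pu n p $ i" "n p $ i * Pv n p $ j = n p $ j * Pv n p $ i"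
      if p: "p \<in> ?B" for p i j
      using par[OF p] exhaust_3[of i] exhaust_3[of j] unfolding vec_eq_iff forall_3 cross3_nth
      by (auto simp del: Pu_nth Pv_nth)
    obtain j where j: "n (snd qs) $ j \<noteq> 0" using regB[OF cB] by (auto simp: n_def vec_eq_iff)
    have sn: "sep_holo D1 (\<lambda>p. n p $ i)" for i using hn by (simp add: holov_def)
    have "open (?B \<inter> (\<lambda>p. n p $ j) -` (- {0}))"
      using sep_holo_subset[OF sn open_ball B] unfolding sep_holo_def
      by (intro continuous_open_preimage) auto
    then obtain s where s: "s > 0" "ball (snd qs) s \<subseteq> ?B \<inter> (\<lambda>p. n p $ j) -` (- {0})"
      using cB j open_contains_ball by (metis (no_types, lifting) ComplI IntI singletonD vimageI2)
    let ?B' = "ball (snd qs) s"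
    have B': "p \<in> ?B" "n p $ j \<noteq> 0" if "p \<in> ?B'" for p using s that by auto
    have B'D: "?B' \<subseteq> D1" using s B by blast
    note sn' = sep_holo_subset[OF sn open_ball B'D]
    \<comment> \<open>The direction of the normal is constant, since the ratios of its coordinates
      have zero derivative.\<close>
    have q: "n p $ i / n p $ j = n (snd qs) $ i / n (snd qs) $ j" if p: "p \<in> ?B'" for p i
    proof (rule Du_Dv_zero_constant[of "snd qs" s "\<lambda>p. n p $ i / n p $ j"])
      show "sep_holo ?B' (\<lambda>p. n p $ i / n p $ j)" using B' by (intro sep_holo_divide sn')
      show "Du (\<lambda>p. n p $ i / n p $ j) p = 0 \<and> Dv (\<lambda>p. n p $ i / n p $ j) p = 0" if p: "p \<in> ?B'" for p
        using par'[OF B'(1)[OF p], of i j] unfolding Du_Dv_divide[OF sn' sn' p B'(2)[OF p]]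
        by (simp add: mult.commute)
    qed (use p s in auto)
    have nn: "n (snd qs) = (n (snd qs) $ j / n p $ j) *s n p" if p: "p \<in> ?B'" for p
      using q[OF p] B'(2)[OF p] j by (simp add: vec_eq_iff field_simps)
    have "bdot (n (snd qs)) (Pu y p) = 0 \<and> bdot (n (snd qs)) (Pv y p) = 0" if p: "p \<in> ?B'" for p
      by (subst (1 2) nn[OF p]) (use yn[of p] in \<open>simp add: bdot_commute\<close>)
    moreover have yB': "holov ?B' y" using holov_subset[OF hy open_ball B'D] .
    moreover have "sep_holo ?B' (\<lambda>p. bdot (n (snd qs)) (y p))"
      by (intro sep_holo_bdot holov_const open_ball yB')
    ultimately have const: "bdot (n (snd qs)) (y p) = bdot (n (snd qs)) (y (snd qs))" if p: "p \<in> ?B'" for p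
      using Du_Dv_bdot[OF holov_const[OF open_ball] yB'] s(1)
      by (intro Du_Dv_zero_constant[of "snd qs" s "\<lambda>p. bdot (n (snd qs)) (y p)"] p) auto
    \<comment> \<open>The identity theorem extends the plane equation from the small ball to
      \<open>D1\<close>.\<close>
    have "bdot (n (snd qs)) (y p) - bdot (n (snd qs)) (y (snd qs)) = 0" if p: "p \<in> D1" for p
    proof (rule sep_holo_identity[of D1 "\<lambda>p. bdot (n (snd qs)) (y p) - bdot (n (snd qs)) (y (snd qs))" ?B'])
      show "sep_holo D1 (\<lambda>p. bdot (n (snd qs)) (y p) - bdot (n (snd qs)) (y (snd qs)))"
        by (intro sep_holo_diff sep_holo_bdot holov_const sep_holo_const hy openD)
      show "bdot (n (snd qs)) (y p) - bdot (n (snd qs)) (y (snd qs)) = 0" if "p \<in> ?B'" for p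
        using const[OF that] by (simp only: diff_self)
    qed (use D1 B'D s p in auto)
    then have "\<forall>z\<in>y ` D1. bdot \<pi> (hom z) = 0" by (simp add: \<pi>_def T_def bdot_commute)
    then show ?thesis
      unfolding confocal_member_def MP Let_def using True M\<pi> T0(1)[OF cB] \<pi>_def by blast
  qed
  then show ?thesis using x0 nondeg_quadric_matrix_inv(1)[OF P0T detP0] by blast
qed

end

section \<open>From the curvature and matrix hypotheses to a tangential pair\<close>

theorem theorem2:
  fixes x0 N0 xz :: "complex \<times> complex \<Rightarrow> complex^3"
    and D0 D1 :: "(complex \<times> complex) set"
  assumes surf0: "surface x0 D0"
    and normal0: "unit_normal x0 N0 D0"
    and nondev0: "non_developable x0 N0 D0"
    and surfz: "surface xz D1"
    and neq: "\<not> (D1 = D0 \<and> (\<forall>p\<in>D0. xz p = x0 p))"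
    and S_nonempty: "tangency_set x0 N0 D0 xz D1 \<noteq> {}"
    and S_nondeg: "\<forall>(p0, p1)\<in>tangency_set x0 N0 D0 xz D1.
                     bdot (Pu xz p1) (N0 p0) * bdot (Pv xz p1) (N0 p0) \<noteq> 0"
    and integrability: "\<forall>(p0, p1)\<in>tangency_set x0 N0 D0 xz D1.
        (mat 1 - outer (N0 p0) (N0 p0)) **
          (outer (Pu xz p1) (Pv xz p1) + outer (Pv xz p1) (Pu xz p1)) *v N0 p0
        = bdot (Pu (Pv xz) p1) (N0 p0) *s (xz p1 - x0 p0)"
  shows "(\<forall>p\<in>D1. cross3 (Pu (Pu xz) p) (Pu xz p) = 0 \<and> cross3 (Pv (Pv xz) p) (Pv xz p) = 0)
     \<and> (\<exists>Q. nondeg_quadric Q \<and> x0 ` D0 \<subseteq> quadric_pts Q \<and>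
            (\<exists>w. confocal_member Q w (xz ` D1)))"
proof -
  have hx: "holov D0 x0" and hN: "holov D0 N0" and hy: "holov D1 xz"
    using surf0 normal0 surfz by (simp_all add: surface_def unit_normal_def holov_def holo2_iff_sep_holo)
  note oD = holov_open[OF hx]
  have NN: "bdot (N0 p) (N0 p) = 1" and Nxu: "bdot (N0 p) (Pu x0 p) = 0" and Nxv: "bdot (N0 p) (Pv x0 p) = 0"
    if "p \<in> D0" for p
    using normal0 that by (auto simp: unit_normal_def)
  have NNu: "bdot (N0 p) (Pu N0 p) = 0" and NNv: "bdot (N0 p) (Pv N0 p) = 0" if p: "p \<in> D0" for p
    using Du_Dv_bdot[OF hN hN p] Du_Dv_cong[OF oD p, of "\<lambda>p. bdot (N0 p) (N0 p)" "\<lambda>p. 1"] NN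
    by (simp_all add: bdot_commute[of "Pu N0 p"] bdot_commute[of "Pv N0 p"])
  have II: "bdot (Pu (Pu x0) p) (N0 p) = - bdot (Pu x0 p) (Pu N0 p)"
    "bdot (Pu (Pv x0) p) (N0 p) = - bdot (Pv x0 p) (Pu N0 p)"
    "bdot (Pv (Pu x0) p) (N0 p) = - bdot (Pu x0 p) (Pv N0 p)"
    "bdot (Pv (Pv x0) p) (N0 p) = - bdot (Pv x0 p) (Pv N0 p)" if p: "p \<in> D0" for p
    using Du_Dv_bdot[OF hN holov_Pu[OF hx] p] Du_Dv_bdot[OF hN holov_Pv[OF hx] p]
      Du_Dv_cong[OF oD p, of "\<lambda>p. bdot (N0 p) (Pu x0 p)" "\<lambda>p. 0"]
      Du_Dv_cong[OF oD p, of "\<lambda>p. bdot (N0 p) (Pv x0 p)" "\<lambda>p. 0"] Nxu Nxv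
    by (simp_all add: eq_neg_iff_add_eq_0 bdot_commute[of _ "N0 p"] bdot_commute[of "Pu N0 p"] bdot_commute[of "Pv N0 p"])
  have II_sym: "bdot (Pu x0 p) (Pv N0 p) = bdot (Pv x0 p) (Pu N0 p)" if p: "p \<in> D0" for p
    using II(2,3)[OF p] Pv_Pu_commute[OF hx p] by simp
  interpret tangential_pair x0 N0 xz D0 D1
  proof
    show "connected D0" "connected D1" using surf0 surfz by (simp_all add: surface_def)
    \<comment> \<open>By \<open>II\<close> and \<open>II_sym\<close> this is the numerator of the
      Gauss curvature.\<close>
    show "bdot (Pu x0 p) (Pu N0 p) * bdot (Pv x0 p) (Pv N0 p) - (bdot (Pu x0 p) (Pv N0 p))^2 \<noteq> 0" if p: "p \<in> D0" for p
    proof -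
      have "gauss_curv x0 N0 p \<noteq> 0" using nondev0 p by (simp add: non_developable_def)
      then show ?thesis by (auto simp: gauss_curv_def II[OF p] II_sym[OF p])
    qed
    show "cross3 (Pu xz p) (Pv xz p) \<noteq> 0" if "p \<in> D1" for p using surfz that by (simp add: surface_def)
    show "\<exists>p\<in>D0. \<exists>p'\<in>D1. bdot (xz p' - x0 p) (N0 p) = 0"
      using S_nonempty by (fastforce simp: tangency_set_def)
    fix p p' assume p: "p \<in> D0" "p' \<in> D1" "bdot (xz p' - x0 p) (N0 p) = 0"
    then have S: "(p, p') \<in> tangency_set x0 N0 D0 xz D1" by (simp add: tangency_set_def)
    show "bdot (Pu xz p') (N0 p) \<noteq> 0 \<and> bdot (Pv xz p') (N0 p) \<noteq> 0"
      using bspec[OF S_nondeg S] by simp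
    have outer_mv: "outer u v *v z = bdot v z *s u" for u v z :: "complex^3"
      by (simp add: vec_eq_iff outer_def matrix_vector_mult_def bdot_def sum_distrib_left mult_ac)
    \<comment> \<open>The projection removes from the vector its component along \<open>N0\<close>,
      which is twice the product of the two pairings.\<close>
    have "(mat 1 - outer (N0 p) (N0 p)) ** (outer (Pu xz p') (Pv xz p') + outer (Pv xz p') (Pu xz p')) *v N0 p
        = bdot (Pv xz p') (N0 p) *s Pu xz p' + bdot (Pu xz p') (N0 p) *s Pv xz p'
        - (2 * bdot (Pu xz p') (N0 p) * bdot (Pv xz p') (N0 p)) *s N0 p"
      by (simp add: matrix_vector_mul_assoc[symmetric] matrix_vector_mult_add_rdistrib
          matrix_vector_mult_diff_rdistrib outer_mv bdot_commute[of "N0 p"] mult.commute)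
    then show "bdot (Pv xz p') (N0 p) *s Pu xz p' + bdot (Pu xz p') (N0 p) *s Pv xz p'
        - (2 * bdot (Pu xz p') (N0 p) * bdot (Pv xz p') (N0 p)) *s N0 p
      = bdot (Pu (Pv xz) p') (N0 p) *s (xz p' - x0 p)"
      using bspec[OF integrability S] by simp
  qed (use hx hN hy NN Nxu Nxv NNu NNv II_sym in auto)
  show ?thesis using ruled_u ruled_v confocal_quadrics by blast
qed

end
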